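(* Let $m\ge 1$, $n\ge 1$ be integers, $\alpha\ge 0$ real, $N=m+n$, and $Q=m+n(\alpha+1)$. Consider the equation $$-\Delta_\alpha u=|u|^{p-1}u\quad\text{on }\mathbb{R}^N=\mathbb{R}^m\times\mathbb{R}^n,\qquad \Delta_\alpha u=\Delta_x u+(\alpha+1)^2|x|^{2\alpha}\Delta_y u .$$ (1) If $p\in(1,p_{\mathrm S}(Q))$, then $u=0$ is the unique $C^2$ solution $u:\mathbb{R}^N\to\mathbb{R}$ of this equation that is stable outside a compact set. (2) If $p\in(p_{\mathrm S}(Q),p_{\mathrm{JL}}(Q))$, then $u=0$ is the unique $C^2$ solution $u:\mathbb{R}^N\to\mathbb{R}$ of this equation that is stable outside a compact set.
   Context: Points of $\mathbb{R}^N=\mathbb{R}^m\times\mathbb{R}^n$ are written $z=(x,y)$ and $dz$ is Lebesgue measure. The Grushin gradient is $\nabla_\alpha=(\nabla_x,(\alpha+1)|x|^\alpha\nabla_y)$. A $C^2$ solution $u$ of $-\Delta_\alpha u=|u|^{p-1}u$ is stable outside a compact set if there is a compact set $K\subset\mathbb{R}^N$ such that $$\int_{\mathbb{R}^N}|\nabla_\alpha\varphi|^2\,dz\ \ge\ \int_{\mathbb{R}^N}p|u|^{p-1}\varphi^2\,dz\qquad\text{for all }\varphi\in C_c^1(\mathbb{R}^N\setminus K).$$ Critical exponents, for real $Q\ge 2$: $p_{\mathrm S}(Q)=\frac{Q+2}{Q-2}$ if $Q>2$ and $p_{\mathrm S}(2)=+\infty$; $p_{\mathrm{JL}}(Q)=+\infty$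 if $Q\le 10$, and $p_{\mathrm{JL}}(Q)=\frac{(Q-2)^2-4Q+8\sqrt{Q-1}}{(Q-2)(Q-10)}$ if $Q>10$. *)

theory Defs
  imports "HOL-Analysis.Analysis"
begin

definition dir_deriv :: "'a::euclidean_space \<Rightarrow> ('a \<Rightarrow> real) \<Rightarrow> 'a \<Rightarrow> real" where
  "dir_deriv v f z = frechet_derivative f (at z) v"

definition C1_fun :: "('a::euclidean_space \<Rightarrow> real) \<Rightarrow> bool" where
  "C1_fun f \<longleftrightarrow> (\<forall>z. f differentiable (at z)) \<and> (\<forall>v. continuous_on UNIV (dir_deriv v f))"

definition C2_fun :: "('a::euclidean_space \<Rightarrow> real) \<Rightarrow> bool" where
  "C2_fun f \<longleftrightarrow> C1_fun f \<and> (\<forall>v. C1_fun (dir_deriv v f))"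

(* Elements of C_c^1(S), S open, identified with their extensions by zero to the whole space. *)
definition C1_compact_support :: "'a::euclidean_space set \<Rightarrow> ('a \<Rightarrow> real) set" where
  "C1_compact_support S =
     {\<phi>. C1_fun \<phi> \<and> compact (closure {z. \<phi> z \<noteq> 0}) \<and> closure {z. \<phi> z \<noteq> 0} \<subseteq> S}"

definition grad_x :: "((real^'m) \<times> (real^'n) \<Rightarrow> real) \<Rightarrow> (real^'m) \<times> (real^'n) \<Rightarrow> real^'m" where
  "grad_x f z = (\<chi> i. dir_deriv (axis i 1, 0) f z)"

definition grad_y :: "((real^'m) \<times> (real^'n) \<Rightarrow> real) \<Rightarrow> (real^'m) \<times> (real^'n) \<Rightarrow> real^'n" where
  "grad_y f z = (\<chi> j. dir_deriv (0, axis j 1) f z)"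

definition laplacian_x :: "((real^'m) \<times> (real^'n) \<Rightarrow> real) \<Rightarrow> (real^'m) \<times> (real^'n) \<Rightarrow> real" where
  "laplacian_x f z = (\<Sum>i\<in>UNIV. dir_deriv (axis i 1, 0) (dir_deriv (axis i 1, 0) f) z)"

definition laplacian_y :: "((real^'m) \<times> (real^'n) \<Rightarrow> real) \<Rightarrow> (real^'m) \<times> (real^'n) \<Rightarrow> real" where
  "laplacian_y f z = (\<Sum>j\<in>UNIV. dir_deriv (0, axis j 1) (dir_deriv (0, axis j 1) f) z)"

(* |x|^a for a \<ge> 0.  The case distinction is needed because 0 powr 0 = 0, whereas |x|^0 must be 1
   also at x = 0, so that a = 0 gives the Euclidean gradient and Laplacian. *)
definition norm_pow :: "'a::real_normed_vector \<Rightarrow> real \<Rightarrow> real" where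
  "norm_pow x a = (if a = 0 then 1 else norm x powr a)"

definition grushin_grad ::
    "real \<Rightarrow> ((real^'m) \<times> (real^'n) \<Rightarrow> real) \<Rightarrow> (real^'m) \<times> (real^'n) \<Rightarrow> (real^'m) \<times> (real^'n)" where
  "grushin_grad \<alpha> f z = (grad_x f z, ((\<alpha> + 1) * norm_pow (fst z) \<alpha>) *\<^sub>R grad_y f z)"

definition grushin_laplacian ::
    "real \<Rightarrow> ((real^'m) \<times> (real^'n) \<Rightarrow> real) \<Rightarrow> (real^'m) \<times> (real^'n) \<Rightarrow> real" where
  "grushin_laplacian \<alpha> f z =
     laplacian_x f z + (\<alpha> + 1)\<^sup>2 * norm_pow (fst z) (2 * \<alpha>) * laplacian_y f z"

definition grushin_solution ::
    "real \<Rightarrow> real \<Rightarrow> ((real^'m) \<times> (real^'n) \<Rightarrow> real) \<Rightarrow> bool" where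
  "grushin_solution \<alpha> p u \<longleftrightarrow>
     C2_fun u \<and> (\<forall>z. - grushin_laplacian \<alpha> u z = \<bar>u z\<bar> powr (p - 1) * u z)"

(* For continuous u, p > 1 and \<alpha> \<ge> 0 both integrands are continuous with compact support, so the
   integrals are the genuine ones and not the default value 0 of a non-integrable function. *)
definition stable_outside_compact ::
    "real \<Rightarrow> real \<Rightarrow> ((real^'m) \<times> (real^'n) \<Rightarrow> real) \<Rightarrow> bool" where
  "stable_outside_compact \<alpha> p u \<longleftrightarrow>
     (\<exists>K. compact K \<and>
       (\<forall>\<phi>\<in>C1_compact_support (- K).
          (LINT z|lborel. (norm (grushin_grad \<alpha> \<phi> z))\<^sup>2)
            \<ge> (LINT z|lborel. p * \<bar>u z\<bar> powr (p - 1) * (\<phi> z)\<^sup>2)))"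

(* Critical exponents, meant for Q \<ge> 2. *)
definition p_S :: "real \<Rightarrow> ereal" where
  "p_S Q = (if Q > 2 then ereal ((Q + 2) / (Q - 2)) else \<infinity>)"

definition p_JL :: "real \<Rightarrow> ereal" where
  "p_JL Q =
     (if Q \<le> 10 then \<infinity>
      else ereal (((Q - 2)\<^sup>2 - 4 * Q + 8 * sqrt (Q - 1)) / ((Q - 2) * (Q - 10))))"

end

theory Submission
  imports Defs
begin

text \<open>
  Let \<open>H = 1 + |x|\<^bsup>2\<alpha>+2\<^esup> + |y|\<^sup>2\<close> be the (regularised) gauge and \<open>\<omega> = |x|\<^bsup>2\<alpha>\<^esup> / H\<close> the
  weight of the Hardy inequality \<open>((Q-2)/2)\<^sup>2 \<integral>\<omega>\<phi>\<^sup>2 \<le> \<integral>|\<nabla>\<phi>|\<^sup>2\<close>. Testing stability and the equation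
  with \<open>u w\<close> and \<open>u w\<^sup>2\<close> gives \<open>(1 - 1/p) \<integral>|\<nabla>(uw)|\<^sup>2 \<le> \<integral>u\<^sup>2|\<nabla>w|\<^sup>2\<close>; for radial \<open>w = W(H)\<close> the
  right-hand side is at most \<open>4(\<alpha>+1)\<^sup>2 \<integral>\<omega>u\<^sup>2(HW')\<^sup>2\<close>, so with Hardy one is left with a one-dimensional
  inequality for the measure \<open>\<omega>u\<^sup>2\<close>. Cutoffs show that the mass of \<open>R \<le> H \<le> 2R\<close> is at most
  \<open>C(1 + R\<^bsup>\<theta>\<^esup>)\<close> with \<open>2(\<alpha>+1)\<theta> = Q - 2(p+1)/(p-1)\<close>. For \<open>p < p\<^sub>S\<close> the exponent is negative. For \<open>p > p\<^sub>S\<close>, the condition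
  \<open>p < p\<^sub>J\<^sub>L\<close> says precisely that weights \<open>W\<close> decaying slightly faster than \<open>H\<^bsup>-\<theta>/2\<^esup>\<close> are still
  admissible in the one-dimensional inequality, and this makes \<open>\<omega>u\<^sup>2\<close> integrable. In both cases
  the energy of \<open>u\<close> is finite, and the Pohozaev identity yields \<open>\<integral>|u|\<^bsup>p+1\<^esup> = 0\<close>. No elliptic
  regularity or Sobolev embedding is needed.
\<close>

section \<open>Calculus with directional derivatives\<close>

text \<open>The coefficient |x|^(2 \<alpha>) degenerates on x = 0 and may fail to be smooth there,
  so it is never differentiated: translations in y leave it fixed, and the dilations multiply it by
  a constant, which only shifts Q to Q + 2 \<alpha>. The factor \<alpha> + 1 in the gradient makes
  the gauge fit the dilations: pairing the Grushin gradients of H and f gives 2 (\<alpha> + 1)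
  |x|^(2 \<alpha>) times the dilation derivative of f. Both thresholds come from scaling. With s = 2
  / (p - 1), the decay rate singled out by the equation, (\<alpha> + 1) \<theta> = (Q - 2)/2 - s, so
  \<theta> > 0 means p > p_S. Comparing the square of this with Hardy's constant times 1 - 1/p
  gives, after division by s, a quadratic inequality in s; for Q > 10 its smaller root is 2 / (p_JL
  - 1). At p = p_S the coefficient left by the Pohozaev identity is 0. In the Pohozaev step the mass
  of \<omega> u^2 on far shells is merely bounded. It is multiplied by an arbitrary \<epsilon>,
  while the energies on disjoint shells tend to 0 by themselves.\<close>

lemma dir_deriv_eq: "(f has_derivative f') (at z) \<Longrightarrow> dir_deriv v f z = f' v"
  unfolding dir_deriv_def using frechet_derivative_at[of f f' z] by simp

text \<open>\<open>dir_deriv\<close> rests on the chosen \<open>frechet_derivative\<close>;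
  uniqueness of the derivative lets any explicit formula take its place.\<close>

lemma C1_funI:
  assumes "\<And>z. (f has_derivative f' z) (at z)" "\<And>v. continuous_on UNIV (\<lambda>z. f' z v)"
  shows "C1_fun f"
proof -
  have "dir_deriv v f = (\<lambda>z. f' z v)" for v
    using dir_deriv_eq[OF assms(1)] by auto
  then show ?thesis
    unfolding C1_fun_def using assms by (auto simp: differentiable_def)
qed

lemma C1_fun_has_derivative:
  "C1_fun f \<Longrightarrow> (f has_derivative (\<lambda>v. dir_deriv v f z)) (at z)"
  using frechet_derivative_works[of f "at z"] by (simp add: C1_fun_def dir_deriv_def)

lemma C1_fun_continuous_dir_deriv: "C1_fun f \<Longrightarrow> continuous_on UNIV (dir_deriv v f)"
  by (simp add: C1_fun_def)

lemma C1_fun_continuous: "C1_fun f \<Longrightarrow> continuous_on UNIV f"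
  unfolding C1_fun_def
  by (meson continuous_at_imp_continuous_on differentiable_imp_continuous_within)

lemma C2_fun_C1: "C2_fun f \<Longrightarrow> C1_fun f" "C2_fun f \<Longrightarrow> C1_fun (dir_deriv v f)"
  by (auto simp: C2_fun_def)

lemma dir_deriv_linear:
  assumes "C1_fun f" shows "linear (\<lambda>v. dir_deriv v f z)"
  using C1_fun_has_derivative[OF assms] has_derivative_linear by blast

lemma C1_fun_bounded_linear:
  assumes "bounded_linear f" shows "C1_fun f"
  by (rule C1_funI[where f' = "\<lambda>_. f"]) (auto intro: bounded_linear_imp_has_derivative assms)

lemma C1_fun_const: "C1_fun (\<lambda>z. c)"
  by (rule C1_funI[where f' = "\<lambda>_ _. 0"]) auto

lemma has_derivative_C1_mult:
  assumes "C1_fun f" "C1_fun g"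
  shows "((\<lambda>z. f z * g z) has_derivative
           (\<lambda>v. f z * dir_deriv v g z + dir_deriv v f z * g z)) (at z)"
  using has_derivative_mult[OF C1_fun_has_derivative[OF assms(1)] C1_fun_has_derivative[OF assms(2)]] .

lemma C1_fun_mult:
  assumes "C1_fun f" "C1_fun g" shows "C1_fun (\<lambda>z. f z * g z)"
  by (rule C1_funI, rule has_derivative_C1_mult[OF assms])
    (intro continuous_intros C1_fun_continuous C1_fun_continuous_dir_deriv assms)

lemma dir_deriv_mult:
  assumes "C1_fun f" "C1_fun g"
  shows "dir_deriv v (\<lambda>z. f z * g z) z = f z * dir_deriv v g z + dir_deriv v f z * g z"
  by (rule dir_deriv_eq[OF has_derivative_C1_mult[OF assms]])

lemma has_derivative_C1_add:
  assumes "C1_fun f" "C1_fun g"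
  shows "((\<lambda>z. f z + g z) has_derivative (\<lambda>v. dir_deriv v f z + dir_deriv v g z)) (at z)"
  by (intro derivative_intros C1_fun_has_derivative assms)

lemma C1_fun_add:
  assumes "C1_fun f" "C1_fun g" shows "C1_fun (\<lambda>z. f z + g z)"
  by (rule C1_funI, rule has_derivative_C1_add[OF assms])
    (intro continuous_intros C1_fun_continuous_dir_deriv assms)

lemma dir_deriv_add:
  assumes "C1_fun f" "C1_fun g"
  shows "dir_deriv v (\<lambda>z. f z + g z) z = dir_deriv v f z + dir_deriv v g z"
  by (rule dir_deriv_eq[OF has_derivative_C1_add[OF assms]])

lemma has_derivative_C1_sum:
  assumes "\<And>i. C1_fun (f i)"
  shows "((\<lambda>z. \<Sum>i\<in>I. f i z) has_derivative (\<lambda>v. \<Sum>i\<in>I. dir_deriv v (f i) z)) (at z)"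
  by (intro derivative_intros C1_fun_has_derivative assms)

lemma C1_fun_sum:
  assumes "\<And>i. C1_fun (f i)" shows "C1_fun (\<lambda>z. \<Sum>i\<in>I. f i z)"
  by (rule C1_funI, rule has_derivative_C1_sum[OF assms])
    (intro continuous_intros C1_fun_continuous_dir_deriv assms)

lemma dir_deriv_sum:
  assumes "\<And>i. C1_fun (f i)"
  shows "dir_deriv v (\<lambda>z. \<Sum>i\<in>I. f i z) z = (\<Sum>i\<in>I. dir_deriv v (f i) z)"
  by (rule dir_deriv_eq[OF has_derivative_C1_sum[OF assms]])

lemma has_derivative_C1_comp:
  assumes "C1_fun f" "(W has_real_derivative d) (at (f z))"
  shows "((\<lambda>z. W (f z)) has_derivative (\<lambda>v. d * dir_deriv v f z)) (at z)"
  using has_derivative_compose[OF C1_fun_has_derivative[OF assms(1)], of W "(*) d" z] assms(2)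
  by (simp add: has_field_derivative_def)

lemma C1_fun_comp:
  assumes "C1_fun f" "\<And>z. (W has_real_derivative W' (f z)) (at (f z))"
    "continuous_on UNIV (\<lambda>z. W' (f z))"
  shows "C1_fun (\<lambda>z. W (f z))"
  by (rule C1_funI, rule has_derivative_C1_comp[OF assms(1,2)])
    (intro continuous_intros C1_fun_continuous_dir_deriv assms)

lemma dir_deriv_comp:
  assumes "C1_fun f" "(W has_real_derivative d) (at (f z))"
  shows "dir_deriv v (\<lambda>z. W (f z)) z = d * dir_deriv v f z"
  by (rule dir_deriv_eq[OF has_derivative_C1_comp[OF assms]])

lemma dir_deriv_outside:
  assumes "\<And>z. r < norm z \<Longrightarrow> f z = 0" "r < norm z"
  shows "dir_deriv v f z = 0"
proof -
  have "open {z::'a. r < norm z}" by (intro open_Collect_less continuous_intros)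
  then have "(f has_derivative (\<lambda>_. 0)) (at z)"
    by (rule has_derivative_transform_within_open[OF has_derivative_const]) (use assms in auto)
  then show ?thesis by (simp add: dir_deriv_eq[where f' = "\<lambda>_. 0"])
qed

lemma C1_fun_line:
  assumes "C1_fun f"
  shows "((\<lambda>s. f (z + s *\<^sub>R v)) has_real_derivative dir_deriv v f (z + s *\<^sub>R v)) (at s)"
proof -
  have "((\<lambda>s. f (z + s *\<^sub>R v)) has_derivative (\<lambda>h. dir_deriv (h *\<^sub>R v) f (z + s *\<^sub>R v))) (at s)"
    by (rule has_derivative_compose[OF _ C1_fun_has_derivative[OF assms]]) (auto intro!: derivative_eq_intros)
  then show ?thesis
    by (simp add: has_field_derivative_def linear_scale[OF dir_deriv_linear[OF assms]] mult_commute_abs)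
qed

text \<open>Schwarz' theorem, by applying the mean value theorem twice to the mixed second difference in
  both orders.\<close>

lemma C2_second_difference:
  assumes "C2_fun f" "0 < t"
  obtains r s where "0 < r" "r < t" "0 < s" "s < t"
    "f (z + t *\<^sub>R v + t *\<^sub>R w) - f (z + t *\<^sub>R v) - f (z + t *\<^sub>R w) + f z
       = t * t * dir_deriv w (dir_deriv v f) (z + r *\<^sub>R v + s *\<^sub>R w)"
proof -
  define g where "g r = f (z + t *\<^sub>R w + r *\<^sub>R v) - f (z + r *\<^sub>R v)" for r
  have dg: "(g has_real_derivative dir_deriv v f (z + t *\<^sub>R w + r *\<^sub>R v) - dir_deriv v f (z + r *\<^sub>R v)) (at r)" for r
    unfolding g_def by (intro derivative_intros C1_fun_line C2_fun_C1 assms)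
  obtain r where r: "0 < r" "r < t"
    "g t - g 0 = (t - 0) * (dir_deriv v f (z + t *\<^sub>R w + r *\<^sub>R v) - dir_deriv v f (z + r *\<^sub>R v))"
    using MVT2[OF assms(2) dg] by blast
  obtain s where s: "0 < s" "s < t"
    "dir_deriv v f (z + r *\<^sub>R v + t *\<^sub>R w) - dir_deriv v f (z + r *\<^sub>R v + 0 *\<^sub>R w)
       = (t - 0) * dir_deriv w (dir_deriv v f) (z + r *\<^sub>R v + s *\<^sub>R w)"
    using MVT2[OF assms(2) C1_fun_line[OF C2_fun_C1(2)[OF assms(1), of v], of "z + r *\<^sub>R v" w]] by blast
  have e: "z + r *\<^sub>R v + t *\<^sub>R w = z + t *\<^sub>R w + r *\<^sub>R v" "z + t *\<^sub>R v + t *\<^sub>R w = z + t *\<^sub>R w + t *\<^sub>R v"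
    by (simp_all add: algebra_simps)
  show thesis
    by (rule that[OF r(1,2) s(1,2)]) (use r(3) s(3) in \<open>simp add: g_def e algebra_simps\<close>)
qed

text \<open>The second difference is symmetric in v and w, so at every scale t the two mixed
  derivatives share a value at points within O(t) of z. Let t tend to 0 and use continuity.\<close>

lemma dir_deriv_commute:
  assumes "C2_fun f"
  shows "dir_deriv v (dir_deriv w f) z = dir_deriv w (dir_deriv v f) z"
proof -
  define t where "t n = inverse (real (Suc n))" for n
  have t: "t \<longlonglongrightarrow> 0" "\<And>n. 0 < t n" unfolding t_def using LIMSEQ_inverse_real_of_nat by auto
  have "\<exists>r s r' s'. 0 \<le> r \<and> r \<le> t n \<and> 0 \<le> s \<and> s \<le> t n \<and> 0 \<le> r' \<and> r' \<le> t n \<and> 0 \<le> s' \<and> s' \<le> t n \<and>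
      dir_deriv w (dir_deriv v f) (z + r *\<^sub>R v + s *\<^sub>R w) = dir_deriv v (dir_deriv w f) (z + r' *\<^sub>R v + s' *\<^sub>R w)" for n
  proof -
    obtain r s where rs: "0 < r" "r < t n" "0 < s" "s < t n"
      "f (z + t n *\<^sub>R v + t n *\<^sub>R w) - f (z + t n *\<^sub>R v) - f (z + t n *\<^sub>R w) + f z
         = t n * t n * dir_deriv w (dir_deriv v f) (z + r *\<^sub>R v + s *\<^sub>R w)"
      using C2_second_difference[OF assms t(2)] by blast
    obtain s' r' where rs': "0 < s'" "s' < t n" "0 < r'" "r' < t n"
      "f (z + t n *\<^sub>R w + t n *\<^sub>R v) - f (z + t n *\<^sub>R w) - f (z + t n *\<^sub>R v) + f z
         = t n * t n * dir_deriv v (dir_deriv w f) (z + s' *\<^sub>R w + r' *\<^sub>R v)"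
      using C2_second_difference[OF assms t(2)] by blast
    have e: "z + t n *\<^sub>R w + t n *\<^sub>R v = z + t n *\<^sub>R v + t n *\<^sub>R w" "z + s' *\<^sub>R w + r' *\<^sub>R v = z + r' *\<^sub>R v + s' *\<^sub>R w"
      by (simp_all add: algebra_simps)
    have "t n * t n * dir_deriv w (dir_deriv v f) (z + r *\<^sub>R v + s *\<^sub>R w)
        = t n * t n * dir_deriv v (dir_deriv w f) (z + r' *\<^sub>R v + s' *\<^sub>R w)"
      using rs(5) rs'(5) unfolding e by linarith
    then have "dir_deriv w (dir_deriv v f) (z + r *\<^sub>R v + s *\<^sub>R w) = dir_deriv v (dir_deriv w f) (z + r' *\<^sub>R v + s' *\<^sub>R w)"
      using t(2)[of n] by simp
    then show ?thesis using rs(1-4) rs'(1-4) by (meson less_imp_le)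
  qed
  then obtain r s r' s' where b: "\<And>n. 0 \<le> r n" "\<And>n. r n \<le> t n" "\<And>n. 0 \<le> s n" "\<And>n. s n \<le> t n"
      "\<And>n. 0 \<le> r' n" "\<And>n. r' n \<le> t n" "\<And>n. 0 \<le> s' n" "\<And>n. s' n \<le> t n"
    and eq: "\<And>n. dir_deriv w (dir_deriv v f) (z + r n *\<^sub>R v + s n *\<^sub>R w) = dir_deriv v (dir_deriv w f) (z + r' n *\<^sub>R v + s' n *\<^sub>R w)"
    by metis
  have sq: "q \<longlonglongrightarrow> 0" if "\<And>n. 0 \<le> q n" "\<And>n. q n \<le> t n" for q
    by (rule tendsto_sandwich[OF _ _ tendsto_const t(1)]) (use that in auto)
  have lim: "(\<lambda>n. dir_deriv w' (dir_deriv v' f) (z + a n *\<^sub>R v + b n *\<^sub>R w)) \<longlonglongrightarrow> dir_deriv w' (dir_deriv v' f) z"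
    if "a \<longlonglongrightarrow> 0" "b \<longlonglongrightarrow> 0" for a b v' w'
  proof -
    have "(\<lambda>n. z + a n *\<^sub>R v + b n *\<^sub>R w) \<longlonglongrightarrow> z + 0 *\<^sub>R v + 0 *\<^sub>R w"
      by (intro tendsto_intros that)
    moreover have "isCont (dir_deriv w' (dir_deriv v' f)) z"
      using C1_fun_continuous_dir_deriv[OF C2_fun_C1(2)[OF assms]] by (simp add: continuous_on_eq_continuous_at)
    ultimately show ?thesis using isCont_tendsto_compose by fastforce
  qed
  show ?thesis
    using LIMSEQ_unique[OF lim[of r s w v] lim[of r' s' v w, folded eq]] sq b by simp
qed

section \<open>Integrals of functions of bounded support, and flows\<close>

lemma integrable_continuous_bounded_support:
  fixes f :: "'a::euclidean_space \<Rightarrow> real"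
  assumes "continuous_on UNIV f" "\<And>z. r < norm z \<Longrightarrow> f z = 0"
  shows "integrable lborel f"
proof -
  have "integrable lborel (\<lambda>x. indicator (cball 0 r) x *\<^sub>R f x)"
    by (rule borel_integrable_compact) (use assms continuous_on_subset[OF assms(1)] in auto)
  also have "(\<lambda>x. indicator (cball 0 r) x *\<^sub>R f x) = f"
    using assms(2) by (fastforce simp: indicator_def fun_eq_iff)
  finally show ?thesis .
qed

lemma bounded_continuous_bounded_support:
  fixes f :: "'a::euclidean_space \<Rightarrow> real"
  assumes "continuous_on UNIV f" "\<And>z. r < norm z \<Longrightarrow> f z = 0"
  obtains B where "0 \<le> B" "\<And>z. \<bar>f z\<bar> \<le> B"
proof -
  have "bounded (f ` cball 0 r)"
    by (intro compact_imp_bounded compact_continuous_image) (use assms continuous_on_subset[OF assms(1)] in auto)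
  then obtain B where B: "\<And>z. norm z \<le> r \<Longrightarrow> \<bar>f z\<bar> \<le> B"
    unfolding bounded_iff by (metis image_eqI mem_cball_0 real_norm_def)
  have "\<bar>f z\<bar> \<le> \<bar>B\<bar>" for z
    using B[of z] assms(2)[of z] by (cases "norm z \<le> r") auto
  then show thesis using that[of "\<bar>B\<bar>"] by simp
qed

text \<open>Infinitesimal form of a change of variables along a flow.\<close>

lemma integral_flow_derivative:
  fixes w G D :: "'a::euclidean_space \<Rightarrow> real" and T :: "real \<Rightarrow> 'a \<Rightarrow> 'a"
  assumes w: "continuous_on UNIV w" and G: "continuous_on UNIV G" "\<And>z. r < norm z \<Longrightarrow> G z = 0"
    and D: "continuous_on UNIV D" "\<And>z. r < norm z \<Longrightarrow> D z = 0"
    and T: "\<And>s. continuous_on UNIV (T s)" "\<And>z. T 0 z = z"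
      "\<And>s z. 0 \<le> s \<Longrightarrow> s \<le> 1 \<Longrightarrow> r' < norm z \<Longrightarrow> r < norm (T s z)"
    and deriv: "\<And>s z. ((\<lambda>s. G (T s z)) has_real_derivative D (T s z)) (at s)"
    and change: "\<And>s. 0 \<le> s \<Longrightarrow> (LINT z|lborel. w z * G (T s z)) = exp (- c * s) * (LINT z|lborel. w z * G z)"
  shows "(LINT z|lborel. w z * D z) = - c * (LINT z|lborel. w z * G z)"
proof -
  obtain B where B: "0 \<le> B" "\<And>z. \<bar>D z\<bar> \<le> B"
    using bounded_continuous_bounded_support[OF D] by blast
  \<comment> \<open>Positive times only, because \<open>change\<close> is assumed for s \<ge> 0; a
    one-sided limit determines the value.\<close>
  define s where "s n = inverse (real (Suc n))" for n
  have s: "s \<longlonglongrightarrow> 0" "\<And>n. 0 < s n" "\<And>n. s n \<le> 1" "\<And>n. s n \<noteq> 0"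
    unfolding s_def using LIMSEQ_inverse_real_of_nat by (auto simp: field_simps)
  have sat: "filterlim s (at 0) sequentially"
    unfolding filterlim_at using s by (auto intro: always_eventually)
  define F where "F n z = w z * ((G (T (s n) z) - G z) / s n)" for n z
  have GT: "continuous_on UNIV (\<lambda>z. G (T q z))" for q
    using continuous_on_compose2[OF G(1) T(1)] by simp
  define R where "R = max r r'"
  have supp: "G z = 0" "D z = 0" "G (T (s n) z) = 0" if "R < norm z" for z n
    using G(2)[of z] D(2)[of z] G(2)[OF T(3)[of "s n" z]] that s(2,3)[of n] by (auto simp: R_def)
  have bd: "\<bar>F n z\<bar> \<le> indicator (cball 0 R) z * (\<bar>w z\<bar> * B)" for n z
  proof (cases "R < norm z")
    case True then show ?thesis by (simp add: F_def supp)
  next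
    case False
    \<comment> \<open>The mean value theorem in the time variable bounds the quotient by sup |D|,
      uniformly in n, which gives the dominating function.\<close>
    obtain q where "G (T (s n) z) - G (T 0 z) = (s n - 0) * D (T q z)"
      using MVT2[OF s(2) deriv] by blast
    then have "(G (T (s n) z) - G z) / s n = D (T q z)" using s(4) T(2) by simp
    then show ?thesis using False B by (simp add: F_def abs_mult mult_left_mono)
  qed
  have int: "integrable lborel (\<lambda>z. w z * G z)" "integrable lborel (\<lambda>z. w z * G (T (s n) z))"
      "integrable lborel (\<lambda>z. w z * D z)" for n
    by (rule integrable_continuous_bounded_support[where r = R], intro continuous_intros w G(1) D(1) GT, simp add: supp)+
  have intb: "integrable lborel (\<lambda>z. indicator (cball 0 R) z * (\<bar>w z\<bar> * B))"
    using borel_integrable_compact[of "cball 0 R" "\<lambda>z. \<bar>w z\<bar> * B"]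
      continuous_on_mult_right[OF continuous_on_rabs[OF continuous_on_subset[OF w]]] by simp
  have "(\<lambda>n. integral\<^sup>L lborel (F n)) \<longlonglongrightarrow> (LINT z|lborel. w z * D z)"
  proof (rule integral_dominated_convergence[OF _ _ intb])
    show "(\<lambda>z. w z * D z) \<in> borel_measurable lborel" using int(3) by simp
    show "F n \<in> borel_measurable lborel" for n
      unfolding F_def by (intro borel_measurable_times borel_measurable_divide borel_measurable_diff)
        (auto simp: borel_measurable_continuous_onI w G(1) GT)
    show "AE z in lborel. (\<lambda>n. F n z) \<longlonglongrightarrow> w z * D z"
    proof (rule AE_I2)
      fix z
      have "((\<lambda>h. (G (T h z) - G z) / h) \<longlongrightarrow> D z) (at 0)"
        using deriv[of z 0] T(2) by (simp add: has_field_derivative_iff)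
      then have "(\<lambda>n. (G (T (s n) z) - G z) / s n) \<longlonglongrightarrow> D z"
        by (rule filterlim_compose[OF _ sat])
      then show "(\<lambda>n. F n z) \<longlonglongrightarrow> w z * D z" unfolding F_def by (intro tendsto_intros)
    qed
    show "AE z in lborel. norm (F n z) \<le> indicator (cball 0 R) z * (\<bar>w z\<bar> * B)" for n
      using bd by simp
  qed
  \<comment> \<open>The same integrals evaluated exactly through \<open>change\<close>; the two
    limits must agree.\<close>
  moreover have "integral\<^sup>L lborel (F n) = (exp (- c * s n) - 1) / s n * (LINT z|lborel. w z * G z)" for n
  proof -
    have "F n = (\<lambda>z. (w z * G (T (s n) z) - w z * G z) / s n)"
      by (auto simp: F_def fun_eq_iff algebra_simps diff_divide_distrib)
    then have "integral\<^sup>L lborel (F n) = ((LINT z|lborel. w z * G (T (s n) z)) - (LINT z|lborel. w z * G z)) / s n"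
      using int by (simp add: Bochner_Integration.integral_diff)
    then show ?thesis using change[of "s n"] s(2)[of n] by (simp add: field_simps)
  qed
  moreover have "(\<lambda>n. (exp (- c * s n) - 1) / s n) \<longlonglongrightarrow> - c"
  proof -
    have "((\<lambda>h. exp (- c * h)) has_real_derivative - c) (at 0)"
      by (auto intro!: derivative_eq_intros)
    then have "((\<lambda>h. (exp (- c * h) - 1) / h) \<longlongrightarrow> - c) (at 0)"
      by (simp add: has_field_derivative_iff)
    then show ?thesis by (rule filterlim_compose[OF _ sat])
  qed
  ultimately have "(\<lambda>n. integral\<^sup>L lborel (F n)) \<longlonglongrightarrow> - c * (LINT z|lborel. w z * G z)"
    by (simp only: tendsto_mult_right)
  with \<open>(\<lambda>n. integral\<^sup>L lborel (F n)) \<longlonglongrightarrow> (LINT z|lborel. w z * D z)\<close> show ?thesis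
    using LIMSEQ_unique by blast
qed

section \<open>Dilations and Green's formula\<close>

abbreviation dx :: "'m::finite \<Rightarrow> ((real^'m) \<times> (real^'n) \<Rightarrow> real) \<Rightarrow> (real^'m) \<times> (real^'n) \<Rightarrow> real" where
  "dx i \<equiv> dir_deriv (axis i 1, 0)"

abbreviation dy :: "'n::finite \<Rightarrow> ((real^'m) \<times> (real^'n) \<Rightarrow> real) \<Rightarrow> (real^'m) \<times> (real^'n) \<Rightarrow> real" where
  "dy j \<equiv> dir_deriv (0, axis j 1)"

text \<open>The generator of the dilations \<open>(x, y) \<mapsto> (\<lambda> x, \<lambda>\<^bsup>\<alpha>+1\<^esup> y)\<close>.\<close>

definition dil_deriv :: "real \<Rightarrow> ((real^'m) \<times> (real^'n) \<Rightarrow> real) \<Rightarrow> (real^'m) \<times> (real^'n) \<Rightarrow> real" where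
  "dil_deriv \<alpha> f z = dir_deriv (fst z, (\<alpha> + 1) *\<^sub>R snd z) f z"

text \<open>Written with \<lambda> = exp s, so that it is a one-parameter group with the identity at
  s = 0.\<close>

definition dilation :: "real \<Rightarrow> real \<Rightarrow> (real^'m) \<times> (real^'n) \<Rightarrow> (real^'m) \<times> (real^'n)" where
  "dilation \<alpha> s z = (exp s *\<^sub>R fst z, exp ((\<alpha> + 1) * s) *\<^sub>R snd z)"

lemma sum_scaleR_axis: "(\<Sum>i\<in>UNIV. v $ i *\<^sub>R axis i 1) = (v :: real^'k)"
  using basis_expansion[of v] by (simp add: scalar_mult_eq_scaleR)

lemma dir_deriv_coordinates:
  fixes f :: "(real^'m) \<times> (real^'n) \<Rightarrow> real"
  assumes "C1_fun f"
  shows "dir_deriv (x, y) f z = (\<Sum>i\<in>UNIV. x $ i * dx i f z) + (\<Sum>j\<in>UNIV. y $ j * dy j f z)"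
proof -
  note lin = dir_deriv_linear[OF assms, of z]
  have "(x, 0) = (\<Sum>i\<in>UNIV. x $ i *\<^sub>R (axis i 1, 0::real^'n))"
    by (simp only: prod_eq_iff fst_sum snd_sum fst_scaleR snd_scaleR fst_conv snd_conv sum_scaleR_axis) simp
  then have 1: "dir_deriv (x, 0) f z = (\<Sum>i\<in>UNIV. x $ i * dx i f z)"
    by (simp only: linear_sum[OF lin] linear_scale[OF lin] real_scaleR_def)
  have "(0, y) = (\<Sum>i\<in>UNIV. y $ i *\<^sub>R (0::real^'m, axis i 1))"
    by (simp only: prod_eq_iff fst_sum snd_sum fst_scaleR snd_scaleR fst_conv snd_conv sum_scaleR_axis) simp
  then have 2: "dir_deriv (0, y) f z = (\<Sum>j\<in>UNIV. y $ j * dy j f z)"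
    by (simp only: linear_sum[OF lin] linear_scale[OF lin] real_scaleR_def)
  show ?thesis
    using linear_add[OF lin, of "(x,0)" "(0,y)"] 1 2 by simp
qed

lemma dil_deriv_coordinates:
  assumes "C1_fun f"
  shows "dil_deriv \<alpha> f z =
    (\<Sum>i\<in>UNIV. fst z $ i * dx i f z) + (\<Sum>j\<in>UNIV. (\<alpha> + 1) * snd z $ j * dy j f z)"
  using dir_deriv_coordinates[OF assms, of "fst z" "(\<alpha> + 1) *\<^sub>R snd z" z] by (simp add: dil_deriv_def)

lemma C1_fun_coordinates: "C1_fun (\<lambda>z. fst z $ i)" "C1_fun (\<lambda>z. c * snd z $ j)"
  by (intro C1_fun_bounded_linear bounded_linear_intros
      bounded_linear_compose[OF bounded_linear_vec_nth] bounded_linear_const_mult)+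

lemma dir_deriv_coordinate:
  "dir_deriv v (\<lambda>z. fst z $ i) z = fst v $ i" "dir_deriv v (\<lambda>z. c * snd z $ j) z = c * snd v $ j"
  by (rule dir_deriv_eq, rule bounded_linear_imp_has_derivative,
    intro bounded_linear_intros
      bounded_linear_compose[OF bounded_linear_vec_nth] bounded_linear_const_mult)+

lemma dil_deriv_fun_eq:
  assumes "C1_fun f"
  shows "dil_deriv \<alpha> f = (\<lambda>z. (\<Sum>i\<in>UNIV. fst z $ i * dx i f z) + (\<Sum>j\<in>UNIV. (\<alpha> + 1) * snd z $ j * dy j f z))"
  using dil_deriv_coordinates[OF assms] by blast

lemma continuous_dil_deriv:
  assumes "C1_fun f" shows "continuous_on UNIV (dil_deriv \<alpha> f)"
  unfolding dil_deriv_fun_eq[OF assms]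
  by (intro continuous_intros C1_fun_continuous_dir_deriv assms C1_fun_continuous C1_fun_coordinates)

lemma C1_fun_dil_deriv:
  assumes "C2_fun f" shows "C1_fun (dil_deriv \<alpha> f)"
  unfolding dil_deriv_fun_eq[OF C2_fun_C1(1)[OF assms]]
  by (intro C1_fun_add C1_fun_sum C1_fun_mult C1_fun_coordinates C2_fun_C1 assms)

text \<open>The dilation field has linear coefficients, so its commutator with a constant field is
  again a constant field. In the Pohozaev computation this extra term yields one copy of the x part
  of the energy and \<alpha> + 1 copies of the y part.\<close>

lemma dir_deriv_dil_deriv:
  assumes "C2_fun f"
  shows "dir_deriv v (dil_deriv \<alpha> f) z = dil_deriv \<alpha> (dir_deriv v f) z + dir_deriv (fst v, (\<alpha> + 1) *\<^sub>R snd v) f z"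
proof -
  note C = C2_fun_C1[OF assms]
  have c1: "C1_fun (\<lambda>z. fst z $ i * dx i f z)" for i
    by (intro C1_fun_mult C1_fun_coordinates C)
  have c2: "C1_fun (\<lambda>z. (\<alpha> + 1) * snd z $ j * dy j f z)" for j
    by (intro C1_fun_mult C1_fun_coordinates C)
  have x: "dir_deriv v (\<lambda>z. fst z $ i * dx i f z) z = fst z $ i * dx i (dir_deriv v f) z + fst v $ i * dx i f z" for i
    by (simp only: dir_deriv_mult[OF C1_fun_coordinates(1) C(2)] dir_deriv_coordinate dir_deriv_commute[OF assms, of v])
  have y: "dir_deriv v (\<lambda>z. (\<alpha> + 1) * snd z $ j * dy j f z) z
      = (\<alpha> + 1) * snd z $ j * dy j (dir_deriv v f) z + (\<alpha> + 1) * snd v $ j * dy j f z" for j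
    by (simp only: dir_deriv_mult[OF C1_fun_coordinates(2) C(2)] dir_deriv_coordinate dir_deriv_commute[OF assms, of v])
  have "dir_deriv v (dil_deriv \<alpha> f) z = (\<Sum>i\<in>UNIV. dir_deriv v (\<lambda>z. fst z $ i * dx i f z) z)
      + (\<Sum>j\<in>UNIV. dir_deriv v (\<lambda>z. (\<alpha> + 1) * snd z $ j * dy j f z) z)"
    unfolding dil_deriv_fun_eq[OF C(1)]
    by (simp only: dir_deriv_add[OF C1_fun_sum[OF c1] C1_fun_sum[OF c2]] dir_deriv_sum[OF c1] dir_deriv_sum[OF c2])
  then show ?thesis
    unfolding x y dil_deriv_coordinates[OF C(2)]
      dir_deriv_coordinates[OF C(1), of "fst v" "(\<alpha> + 1) *\<^sub>R snd v"]
    by (simp add: sum.distrib)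
qed

lemma dil_deriv_mult:
  "C1_fun f \<Longrightarrow> C1_fun g \<Longrightarrow> dil_deriv \<alpha> (\<lambda>z. f z * g z) z = f z * dil_deriv \<alpha> g z + dil_deriv \<alpha> f z * g z"
  by (simp add: dil_deriv_def dir_deriv_mult)

lemma dil_deriv_sum:
  "(\<And>i. C1_fun (f i)) \<Longrightarrow> dil_deriv \<alpha> (\<lambda>z. \<Sum>i\<in>I. f i z) z = (\<Sum>i\<in>I. dil_deriv \<alpha> (f i) z)"
  by (simp add: dil_deriv_def dir_deriv_sum)

lemma dil_deriv_comp:
  "C1_fun f \<Longrightarrow> (W has_real_derivative d) (at (f z)) \<Longrightarrow> dil_deriv \<alpha> (\<lambda>z. W (f z)) z = d * dil_deriv \<alpha> f z"
  by (simp add: dil_deriv_def dir_deriv_comp)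

section \<open>Powers of |x| and the Grushin gradient\<close>

lemma norm_pow_nonneg [simp]: "0 \<le> norm_pow x b"
  by (simp add: norm_pow_def)

lemma continuous_norm_pow:
  fixes f :: "'a::topological_space \<Rightarrow> 'b::real_normed_vector"
  assumes "0 \<le> b" "continuous_on S f" shows "continuous_on S (\<lambda>z. norm_pow (f z) b)"
proof (cases "b = 0")
  case False
  then have "continuous_on S (\<lambda>z. norm (f z) powr b)"
    using assms by (intro continuous_on_powr' continuous_intros) auto
  then show ?thesis using False by (simp add: norm_pow_def)
qed (simp add: norm_pow_def)

lemma norm_pow_scaleR: "norm_pow (exp s *\<^sub>R x) b = exp (b * s) * norm_pow x b"
  by (simp add: norm_pow_def powr_mult exp_powr_real mult.commute)

lemma norm_pow_power2: "(norm_pow x b)\<^sup>2 = norm_pow x (2 * b)"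
  by (simp add: norm_pow_def power2_eq_square flip: powr_add)

text \<open>Serves both the gauge, with c = 2 (\<alpha> + 1), and the primitive of the nonlinearity,
  with c = p + 1.\<close>

lemma has_derivative_norm_powr:
  fixes x :: "'a::real_inner"
  assumes "1 < c"
  shows "((\<lambda>x. norm x powr c) has_derivative (\<lambda>v. c * norm x powr (c - 2) * (x \<bullet> v))) (at x)"
proof (cases "x = 0")
  \<comment> \<open>At the origin the claimed derivative is 0 through the inner product, and the
    difference quotient |v|^(c - 1) tends to 0 since c > 1.\<close>
  case True
  have "((\<lambda>v. norm v powr (c - 1)) \<longlongrightarrow> 0) (at (0::'a))"
  proof -
    have "((\<lambda>v. norm v powr (c - 1)) \<longlongrightarrow> norm (0::'a) powr (c - 1)) (at (0::'a))"
      by (rule tendsto_powr') (use assms in \<open>auto intro!: tendsto_norm_zero tendsto_ident_at\<close>)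
    then show ?thesis by simp
  qed
  moreover have "norm v powr c / norm v = norm v powr (c - 1)" for v :: 'a
    by (cases "v = 0") (simp_all add: powr_diff)
  ultimately have "((\<lambda>v. norm v powr c / norm v) \<longlongrightarrow> 0) (at (0::'a))" by simp
  then show ?thesis using True by (simp add: has_derivative_at)
next
  case False
  then have n: "0 < norm x" by simp
  have "((\<lambda>t. t powr c) has_derivative (\<lambda>h. h * (c * norm x powr (c - 1)))) (at (norm x))"
    using has_real_derivative_powr[OF n, of c] by (simp add: has_field_derivative_def mult_commute_abs)
  from has_derivative_compose[OF has_derivative_norm[OF False] this]
  have "((\<lambda>x. norm x powr c) has_derivative (\<lambda>v. (v \<bullet> sgn x) * (c * norm x powr (c - 1)))) (at x)"
    by simp
  moreover have "(v \<bullet> sgn x) * (c * norm x powr (c - 1)) = c * norm x powr (c - 2) * (x \<bullet> v)" for v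
    using n by (simp add: sgn_div_norm powr_diff inner_commute power2_eq_square field_simps powr_numeral)
  ultimately show ?thesis by simp
qed

lemma grushin_grad_inner:
  "grushin_grad \<alpha> f z \<bullet> grushin_grad \<alpha> g z =
    (\<Sum>i\<in>UNIV. dx i f z * dx i g z) + (\<alpha> + 1)\<^sup>2 * norm_pow (fst z) (2 * \<alpha>) * (\<Sum>j\<in>UNIV. dy j f z * dy j g z)"
  by (simp add: grushin_grad_def power2_eq_square flip: norm_pow_power2)
    (simp add: inner_vec_def grad_x_def grad_y_def)

lemma grushin_grad_mult:
  assumes "C1_fun f" "C1_fun g"
  shows "grushin_grad \<alpha> (\<lambda>z. f z * g z) z = f z *\<^sub>R grushin_grad \<alpha> g z + g z *\<^sub>R grushin_grad \<alpha> f z"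
  by (simp add: grushin_grad_def grad_x_def grad_y_def dir_deriv_mult[OF assms] vec_eq_iff algebra_simps)

lemma grushin_grad_comp:
  assumes "C1_fun f" "(W has_real_derivative d) (at (f z))"
  shows "grushin_grad \<alpha> (\<lambda>z. W (f z)) z = d *\<^sub>R grushin_grad \<alpha> f z"
  by (simp add: grushin_grad_def grad_x_def grad_y_def dir_deriv_comp[where W = W, OF assms] vec_eq_iff algebra_simps)

lemma continuous_grushin_grad_inner:
  assumes "0 \<le> \<alpha>" "C1_fun f" "C1_fun g"
  shows "continuous_on UNIV (\<lambda>z. grushin_grad \<alpha> f z \<bullet> grushin_grad \<alpha> g z)"
  unfolding grushin_grad_inner using assms
  by (intro continuous_intros continuous_norm_pow C1_fun_continuous_dir_deriv) auto

lemma continuous_norm_grushin_grad: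
  assumes "0 \<le> \<alpha>" "C1_fun f"
  shows "continuous_on UNIV (\<lambda>z. (norm (grushin_grad \<alpha> f z))\<^sup>2)"
  unfolding power2_norm_eq_inner using continuous_grushin_grad_inner[OF assms assms(2)] .

lemma grushin_grad_outside:
  assumes "\<And>z. r < norm z \<Longrightarrow> f z = 0" "r < norm z"
  shows "grushin_grad \<alpha> f z = 0"
  by (simp add: grushin_grad_def grad_x_def grad_y_def dir_deriv_outside[of r f, OF assms] vec_eq_iff zero_prod_def)

section \<open>Integration by parts through translations and dilations\<close>

lemma integral_lborel_translation:
  fixes f :: "'a::euclidean_space \<Rightarrow> real"
  assumes "continuous_on UNIV f"
  shows "(LINT z|lborel. f (z + c)) = (LINT z|lborel. f z)"
proof -
  have "(LINT z|lborel. f z) = (LINT z|distr lborel borel ((+) c). f z)"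
    by (simp add: lborel_distr_plus)
  also have "\<dots> = (LINT z|lborel. f (c + z))"
    by (rule integral_distr) (auto intro!: borel_measurable_continuous_onI assms)
  finally show ?thesis by (simp add: add.commute)
qed

text \<open>The flow argument for translations along v, with c = 0. The weight w, constant along v,
  is there to carry |x|^(2 \<alpha>) when v points in a y direction.\<close>

lemma integral_dir_deriv_eq_0:
  fixes w G :: "'a::euclidean_space \<Rightarrow> real"
  assumes "C1_fun G" "\<And>z. r < norm z \<Longrightarrow> G z = 0"
    and "continuous_on UNIV w" "\<And>s z. w (z + s *\<^sub>R v) = w z"
  shows "(LINT z|lborel. w z * dir_deriv v G z) = 0"
proof -
  have "(LINT z|lborel. w z * dir_deriv v G z) = - 0 * (LINT z|lborel. w z * G z)"
  proof (rule integral_flow_derivative[where T = "\<lambda>s z. z + s *\<^sub>R v" and r' = "r + norm v"])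
    show "r < norm (z + s *\<^sub>R v)" if "0 \<le> s" "s \<le> 1" "r + norm v < norm z" for s z
    proof -
      have "norm z \<le> norm (z + s *\<^sub>R v) + norm (s *\<^sub>R v)"
        using norm_triangle_ineq4[of "z + s *\<^sub>R v" "s *\<^sub>R v"] by simp
      moreover have "norm (s *\<^sub>R v) \<le> norm v" using that by (simp add: mult_left_le_one_le)
      ultimately show ?thesis using that by simp
    qed
    show "(LINT z|lborel. w z * G (z + s *\<^sub>R v)) = exp (- 0 * s) * (LINT z|lborel. w z * G z)" for s
      using integral_lborel_translation[of "\<lambda>z. w z * G z" "s *\<^sub>R v"] assms(3,4) C1_fun_continuous[OF assms(1)]
      by (simp add: continuous_on_mult)
  qed (auto intro!: continuous_intros C1_fun_line assms C1_fun_continuous C1_fun_continuous_dir_deriv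
      simp: dir_deriv_outside[OF assms(2)])
  then show ?thesis by simp
qed

lemma prod_Basis_Pair:
  fixes c :: "'a::euclidean_space \<times> 'b::euclidean_space \<Rightarrow> real"
  shows "(\<Prod>j\<in>Basis. c j) = (\<Prod>i\<in>Basis. c (i, 0)) * (\<Prod>j\<in>Basis. c (0, j))"
  unfolding Basis_prod_def
  by (subst prod.union_disjoint) (auto simp: prod.reindex inj_on_def)

text \<open>A diagonal linear map with m entries exp s and n entries exp ((\<alpha> + 1) s): its
  determinant exp (Q s) is where Q comes from.\<close>

lemma integral_dilation:
  fixes f :: "(real^'m) \<times> (real^'n) \<Rightarrow> real"
  assumes f: "f \<in> borel_measurable borel" and Q: "Q = real CARD('m) + real CARD('n) * (\<alpha> + 1)"
  shows "(LINT z|lborel. f (dilation \<alpha> s z)) = exp (- Q * s) * (LINT z|lborel. f z)"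
proof -
  define c :: "(real^'m) \<times> (real^'n) \<Rightarrow> real"
    where "c j = (if snd j = 0 then exp s else exp ((\<alpha> + 1) * s))" for j
  have T: "dilation \<alpha> s = (\<lambda>x. 0 + (\<Sum>j\<in>Basis. (c j * (x \<bullet> j)) *\<^sub>R j))"
  proof
    fix x :: "(real^'m) \<times> (real^'n)"
    show "dilation \<alpha> s x = 0 + (\<Sum>j\<in>Basis. (c j * (x \<bullet> j)) *\<^sub>R j)"
    proof (rule euclidean_eqI)
      fix b :: "(real^'m) \<times> (real^'n)" assume b: "b \<in> Basis"
      then have "dilation \<alpha> s x \<bullet> b = c b * (x \<bullet> b)"
        by (cases x) (auto simp: dilation_def c_def Basis_prod_def)
      then show "dilation \<alpha> s x \<bullet> b = (0 + (\<Sum>j\<in>Basis. (c j * (x \<bullet> j)) *\<^sub>R j)) \<bullet> b"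
        using b by (simp add: inner_sum_left_Basis)
    qed
  qed
  have prod: "(\<Prod>j\<in>Basis. \<bar>c j\<bar>) = exp (Q * s)"
  proof -
    have "(\<Prod>j\<in>Basis. \<bar>c j\<bar>) = exp s ^ CARD('m) * exp ((\<alpha> + 1) * s) ^ CARD('n)"
      unfolding prod_Basis_Pair by (simp add: c_def nonzero_Basis)
    also have "\<dots> = exp (real CARD('m) * s) * exp (real CARD('n) * ((\<alpha> + 1) * s))"
      by (simp add: exp_of_nat_mult)
    also have "\<dots> = exp (Q * s)" by (simp add: Q algebra_simps flip: exp_add)
    finally show ?thesis .
  qed
  have Tm: "(dilation \<alpha> s :: (real^'m) \<times> (real^'n) \<Rightarrow> _) \<in> borel_measurable borel"
    unfolding dilation_def by (intro borel_measurable_continuous_onI continuous_intros)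
  have "(lborel :: ((real^'m) \<times> (real^'n)) measure) = density (distr lborel borel (dilation \<alpha> s)) (\<lambda>_. exp (Q * s))"
  proof -
    have "c j \<noteq> 0" for j by (simp add: c_def)
    note l = lborel_affine_euclidean[of c 0, OF this]
    show ?thesis by (rule trans[OF l]) (simp only: T prod)
  qed
  then have "(LINT z|lborel. f z) = (LINT z|density (distr lborel borel (dilation \<alpha> s)) (\<lambda>_. exp (Q * s)). f z)"
    by simp
  also have "\<dots> = (LINT z|distr lborel borel (dilation \<alpha> s). exp (Q * s) *\<^sub>R f z)"
    by (rule integral_density) (use f in auto)
  also have "\<dots> = exp (Q * s) * (LINT z|lborel. f (dilation \<alpha> s z))"
    by (subst integral_distr) (use f Tm in simp_all)
  finally show ?thesis by (simp add: exp_minus field_simps)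
qed

text \<open>For s \<ge> 0 dilations move points outwards, so in the flow argument the composed
  functions vanish outside the same ball.\<close>

lemma norm_dilation_ge:
  assumes "0 \<le> \<alpha>" "0 \<le> s" shows "norm z \<le> norm (dilation \<alpha> s z)"
proof -
  have "1 \<le> exp s" "1 \<le> exp ((\<alpha> + 1) * s)" using assms by auto
  then have "norm (fst z) \<le> norm (fst (dilation \<alpha> s z))" "norm (snd z) \<le> norm (snd (dilation \<alpha> s z))"
    by (simp_all add: dilation_def mult_le_cancel_right1)
  then show ?thesis
    by (cases z) (auto simp: dilation_def norm_Pair intro!: add_mono power_mono)
qed

text \<open>The weight is homogeneous of degree b, so pulling it through a dilation costs exp (b s);
  the Jacobian contributes the Q.\<close>

lemma integral_dil_deriv:
  fixes G :: "(real^'m) \<times> (real^'n) \<Rightarrow> real"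
  assumes G: "C1_fun G" "\<And>z. r < norm z \<Longrightarrow> G z = 0"
    and Q: "Q = real CARD('m) + real CARD('n) * (\<alpha> + 1)" and "0 \<le> \<alpha>" "0 \<le> b"
  shows "(LINT z|lborel. norm_pow (fst z) b * dil_deriv \<alpha> G z) = - (Q + b) * (LINT z|lborel. norm_pow (fst z) b * G z)"
proof (rule integral_flow_derivative[where T = "dilation \<alpha>" and r' = r])
  show c: "continuous_on UNIV (\<lambda>z. norm_pow (fst z) b)"
    by (intro continuous_norm_pow assms continuous_intros)
  show cG: "continuous_on UNIV G" by (rule C1_fun_continuous[OF G(1)])
  show "continuous_on UNIV (dilation \<alpha> s)" for s
    unfolding dilation_def by (intro continuous_intros)
  show "r < norm (dilation \<alpha> s z)" if "0 \<le> s" "s \<le> 1" "r < norm z" for s and z :: "(real^'m) \<times> (real^'n)"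
    using norm_dilation_ge[OF assms(4) that(1), of z] that by simp
  show "((\<lambda>s. G (dilation \<alpha> s z)) has_real_derivative dil_deriv \<alpha> G (dilation \<alpha> s z)) (at s)" for s z
  proof -
    let ?v = "(fst (dilation \<alpha> s z), (\<alpha> + 1) *\<^sub>R snd (dilation \<alpha> s z))"
    have "((\<lambda>s. dilation \<alpha> s z) has_derivative (\<lambda>h. h *\<^sub>R ?v)) (at s)"
      unfolding dilation_def by (auto intro!: derivative_eq_intros simp: algebra_simps)
    from has_derivative_compose[OF this C1_fun_has_derivative[OF G(1)]]
    show ?thesis
      unfolding linear_scale[OF dir_deriv_linear[OF G(1)]]
      by (simp add: has_field_derivative_def dil_deriv_def mult_commute_abs)
  qed
  show "(LINT z|lborel. norm_pow (fst z) b * G (dilation \<alpha> s z)) = exp (- (Q + b) * s) * (LINT z|lborel. norm_pow (fst z) b * G z)" for s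
  proof -
    have "(LINT z|lborel. norm_pow (fst (dilation \<alpha> s z)) b * G (dilation \<alpha> s z))
        = exp (- Q * s) * (LINT z|lborel. norm_pow (fst z) b * G z)"
      by (rule integral_dilation[OF _ Q]) (intro borel_measurable_continuous_onI continuous_intros c cG)
    then have "exp (b * s) * (LINT z|lborel. norm_pow (fst z) b * G (dilation \<alpha> s z))
        = exp (- Q * s) * (LINT z|lborel. norm_pow (fst z) b * G z)"
      by (simp add: dilation_def norm_pow_scaleR mult.assoc)
    then have "(LINT z|lborel. norm_pow (fst z) b * G (dilation \<alpha> s z))
        = exp (- (b * s)) * (exp (- Q * s) * (LINT z|lborel. norm_pow (fst z) b * G z))"
      by (simp add: exp_minus field_simps)
    also have "\<dots> = exp (- (Q + b) * s) * (LINT z|lborel. norm_pow (fst z) b * G z)"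
      by (simp add: algebra_simps flip: exp_add mult.assoc)
    finally show ?thesis .
  qed
qed (simp_all add: G continuous_dil_deriv, simp_all add: dilation_def dil_deriv_def dir_deriv_outside[OF G(2)])

text \<open>A sum of divergence identities for \<zeta> times the partial derivatives of u. The
  coefficient A of the y part depends on x alone, hence is invariant under translations in
  y.\<close>

lemma grushin_green:
  fixes u \<zeta> :: "(real^'m) \<times> (real^'n) \<Rightarrow> real"
  assumes u: "C2_fun u" and z: "C1_fun \<zeta>" "\<And>z. r < norm z \<Longrightarrow> \<zeta> z = 0" and "0 \<le> \<alpha>"
  shows "(LINT z|lborel. grushin_grad \<alpha> u z \<bullet> grushin_grad \<alpha> \<zeta> z) = - (LINT z|lborel. \<zeta> z * grushin_laplacian \<alpha> u z)"
proof -
  define A :: "(real^'m) \<times> (real^'n) \<Rightarrow> real" where "A z = (\<alpha> + 1)\<^sup>2 * norm_pow (fst z) (2 * \<alpha>)" for z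
  note C = C2_fun_C1[OF u]
  have cA: "continuous_on UNIV A" unfolding A_def
    by (intro continuous_intros continuous_norm_pow) (use assms in auto)
  have C1: "C1_fun (\<lambda>z. \<zeta> z * dir_deriv v u z)" for v by (intro C1_fun_mult C z)
  define X where "X i z = 1 * dx i (\<lambda>z. \<zeta> z * dx i u z) z" for i z
  define Y where "Y j z = A z * dy j (\<lambda>z. \<zeta> z * dy j u z) z" for j z
  have X0: "(LINT z|lborel. X i z) = 0" for i unfolding X_def
    by (rule integral_dir_deriv_eq_0[OF C1, where r = r]) (auto simp: z)
  have Y0: "(LINT z|lborel. Y j z) = 0" for j unfolding Y_def
    by (rule integral_dir_deriv_eq_0[OF C1, where r = r]) (auto simp: z cA, simp add: A_def)
  have iX: "integrable lborel (X i)" for i unfolding X_def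
    by (rule integrable_continuous_bounded_support[where r = r])
      (auto intro!: C1_fun_continuous_dir_deriv C1 simp: dir_deriv_outside[of r] z)
  have iY: "integrable lborel (Y j)" for j unfolding Y_def
    by (rule integrable_continuous_bounded_support[where r = r])
      (auto intro!: C1_fun_continuous_dir_deriv C1 continuous_on_mult cA simp: dir_deriv_outside[of r] z)
  have eq: "(\<Sum>i\<in>UNIV. X i z) + (\<Sum>j\<in>UNIV. Y j z)
      = grushin_grad \<alpha> u z \<bullet> grushin_grad \<alpha> \<zeta> z + \<zeta> z * grushin_laplacian \<alpha> u z" for z
  proof -
    have "X i z = dx i u z * dx i \<zeta> z + \<zeta> z * dx i (dx i u) z" for i
      unfolding X_def by (simp add: dir_deriv_mult C z)
    moreover have "Y j z = A z * (dy j u z * dy j \<zeta> z) + \<zeta> z * (A z * dy j (dy j u) z)" for j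
      unfolding Y_def by (simp add: dir_deriv_mult C z algebra_simps)
    ultimately show ?thesis
      by (simp add: grushin_grad_inner grushin_laplacian_def laplacian_x_def laplacian_y_def A_def[symmetric]
          sum.distrib distrib_left flip: sum_distrib_left)
  qed
  have "0 = (LINT z|lborel. (\<Sum>i\<in>UNIV. X i z) + (\<Sum>j\<in>UNIV. Y j z))"
    by (simp only: Bochner_Integration.integral_add Bochner_Integration.integral_sum
        Bochner_Integration.integrable_sum iX iY X0 Y0 sum.neutral_const add_0)
  also have "\<dots> = (LINT z|lborel. grushin_grad \<alpha> u z \<bullet> grushin_grad \<alpha> \<zeta> z + \<zeta> z * grushin_laplacian \<alpha> u z)"
    by (simp only: eq)
  also have "\<dots> = (LINT z|lborel. grushin_grad \<alpha> u z \<bullet> grushin_grad \<alpha> \<zeta> z) + (LINT z|lborel. \<zeta> z * grushin_laplacian \<alpha> u z)"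
  proof (rule Bochner_Integration.integral_add)
    show "integrable lborel (\<lambda>z. grushin_grad \<alpha> u z \<bullet> grushin_grad \<alpha> \<zeta> z)"
      by (rule integrable_continuous_bounded_support[where r = r])
        (auto intro: continuous_grushin_grad_inner assms C simp: grushin_grad_outside[of r] z)
    show "integrable lborel (\<lambda>z. \<zeta> z * grushin_laplacian \<alpha> u z)"
      unfolding grushin_laplacian_def laplacian_x_def laplacian_y_def
      by (rule integrable_continuous_bounded_support[where r = r])
        (intro continuous_intros continuous_norm_pow C1_fun_continuous_dir_deriv C C1_fun_continuous z(1),
          simp_all add: z assms)
  qed
  finally show ?thesis by simp
qed

section \<open>The gauge, Hardy's inequality and cutoffs\<close>

definition hgauge :: "real \<Rightarrow> (real^'m) \<times> (real^'n) \<Rightarrow> real" where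
  "hgauge \<alpha> z = 1 + norm (fst z) powr (2 * (\<alpha> + 1)) + (norm (snd z))\<^sup>2"

definition hardy_weight :: "real \<Rightarrow> (real^'m) \<times> (real^'n) \<Rightarrow> real" where
  "hardy_weight \<alpha> z = norm_pow (fst z) (2 * \<alpha>) / hgauge \<alpha> z"

lemma gauge_ge_1: "1 \<le> hgauge \<alpha> z"
  by (simp add: hgauge_def)

lemma gauge_pos: "0 < hgauge \<alpha> z"
  using gauge_ge_1[of \<alpha> z] by linarith

lemma gauge_nonzero [simp]: "hgauge \<alpha> z \<noteq> 0"
  using gauge_pos[of \<alpha> z] by linarith

context
  fixes \<alpha> :: real
  assumes alpha: "0 \<le> \<alpha>"
begin

lemma gauge_has_derivative:
  "(hgauge \<alpha> has_derivative
     (\<lambda>v. 2 * (\<alpha> + 1) * norm_pow (fst z) (2 * \<alpha>) * (fst z \<bullet> fst v) + 2 * (snd z \<bullet> snd v))) (at z)"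
proof -
  have 1: "((\<lambda>z. norm (fst z) powr (2 * (\<alpha> + 1))) has_derivative
     (\<lambda>v. 2 * (\<alpha> + 1) * norm (fst z) powr (2 * (\<alpha> + 1) - 2) * (fst z \<bullet> fst v))) (at z)"
    by (rule has_derivative_compose[OF _ has_derivative_norm_powr]) (use alpha in \<open>auto intro!: derivative_intros\<close>)
  have 2: "((\<lambda>z. (norm (snd z))\<^sup>2) has_derivative (\<lambda>v. 2 * (snd z \<bullet> snd v))) (at z)"
    unfolding power2_norm_eq_inner by (auto intro!: derivative_eq_intros simp: inner_commute)
  \<comment> \<open>For \<alpha> = 0 and x = 0 the two powers differ (0 against 1), but then the
    inner product is 0.\<close>
  have 3: "norm (fst z) powr (2 * \<alpha>) * (fst z \<bullet> fst v) = norm_pow (fst z) (2 * \<alpha>) * (fst z \<bullet> fst v)" for v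
    by (cases "fst z = 0") (auto simp: norm_pow_def)
  have "((\<lambda>z. 1 + norm (fst z) powr (2 * (\<alpha> + 1)) + (norm (snd z))\<^sup>2) has_derivative
     (\<lambda>v. (0 + 2 * (\<alpha> + 1) * norm (fst z) powr (2 * (\<alpha> + 1) - 2) * (fst z \<bullet> fst v)) + 2 * (snd z \<bullet> snd v))) (at z)"
    by (intro has_derivative_add 1 2 has_derivative_const)
  then show ?thesis
    unfolding hgauge_def[abs_def] by (simp add: mult.assoc 3)
qed

lemma C1_fun_gauge: "C1_fun (hgauge \<alpha>)"
  by (rule C1_funI, rule gauge_has_derivative)
    (intro continuous_intros continuous_norm_pow, use alpha in auto)

lemma continuous_gauge: "continuous_on S (hgauge \<alpha>)"
  using continuous_on_subset[OF C1_fun_continuous[OF C1_fun_gauge]] by blast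

lemma norm_powr_eq_norm_pow: "norm x powr (2 * (\<alpha> + 1)) = norm_pow x (2 * \<alpha>) * (x \<bullet> x)"
  using alpha by (cases "x = 0") (auto simp: norm_pow_def powr_add distrib_left power2_norm_eq_inner)

text \<open>Euler's identity: H - 1 is homogeneous of degree 2 (\<alpha> + 1) under the
  dilations.\<close>

lemma dil_deriv_gauge: "dil_deriv \<alpha> (hgauge \<alpha>) z = 2 * (\<alpha> + 1) * (hgauge \<alpha> z - 1)"
  unfolding dil_deriv_def dir_deriv_eq[OF gauge_has_derivative]
  unfolding hgauge_def norm_powr_eq_norm_pow power2_norm_eq_inner by (simp add: algebra_simps)

text \<open>Up to the factor |x|^(2 \<alpha>), the gradient of the gauge is the dilation field. This
  is what links radial test functions with the scaling of the equation.\<close>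

lemma grushin_grad_gauge_inner:
  assumes "C1_fun f"
  shows "grushin_grad \<alpha> f z \<bullet> grushin_grad \<alpha> (hgauge \<alpha>) z
    = 2 * (\<alpha> + 1) * norm_pow (fst z) (2 * \<alpha>) * dil_deriv \<alpha> f z"
proof -
  define A where "A = norm_pow (fst z) (2 * \<alpha>)"
  have "dx i (hgauge \<alpha>) z = 2 * (\<alpha> + 1) * A * fst z $ i" for i
    by (simp add: dir_deriv_eq[OF gauge_has_derivative] A_def inner_axis)
  then have x: "(\<Sum>i\<in>UNIV. dx i f z * dx i (hgauge \<alpha>) z) = 2 * (\<alpha> + 1) * A * (\<Sum>i\<in>UNIV. fst z $ i * dx i f z)"
    by (simp add: sum_distrib_left mult_ac)
  have "dy j (hgauge \<alpha>) z = 2 * snd z $ j" for j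
    by (simp add: dir_deriv_eq[OF gauge_has_derivative] inner_axis)
  then have y: "(\<Sum>j\<in>UNIV. dy j f z * dy j (hgauge \<alpha>) z) = 2 * (\<Sum>j\<in>UNIV. snd z $ j * dy j f z)"
    by (simp add: sum_distrib_left mult_ac)
  have "(\<Sum>j\<in>UNIV. (\<alpha> + 1) * snd z $ j * dy j f z) = (\<alpha> + 1) * (\<Sum>j\<in>UNIV. snd z $ j * dy j f z)"
    by (simp add: sum_distrib_left mult.assoc)
  then show ?thesis
    unfolding grushin_grad_inner dil_deriv_coordinates[OF assms] x y A_def[symmetric]
    by (simp add: power2_eq_square distrib_left)
qed

lemma norm_grushin_grad_gauge:
  "(norm (grushin_grad \<alpha> (hgauge \<alpha>) z))\<^sup>2 = 4 * (\<alpha> + 1)\<^sup>2 * norm_pow (fst z) (2 * \<alpha>) * (hgauge \<alpha> z - 1)"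
  unfolding power2_norm_eq_inner grushin_grad_gauge_inner[OF C1_fun_gauge] dil_deriv_gauge
  by (simp add: power2_eq_square algebra_simps)

text \<open>Cauchy-Schwarz against the gradient of the gauge, with one factor |x|^(2 \<alpha>)
  cancelled. Where that factor is 0, so is the left-hand side.\<close>

lemma dil_deriv_bound:
  assumes "C1_fun f"
  shows "norm_pow (fst z) (2 * \<alpha>) * (dil_deriv \<alpha> f z)\<^sup>2 \<le> hgauge \<alpha> z * (norm (grushin_grad \<alpha> f z))\<^sup>2"
proof -
  define A where "A = norm_pow (fst z) (2 * \<alpha>)"
  define g where "g = (norm (grushin_grad \<alpha> f z))\<^sup>2"
  have "(2 * (\<alpha> + 1) * A * dil_deriv \<alpha> f z)\<^sup>2 \<le> g * (4 * (\<alpha> + 1)\<^sup>2 * A * (hgauge \<alpha> z - 1))"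
    using Cauchy_Schwarz_ineq[of "grushin_grad \<alpha> f z" "grushin_grad \<alpha> (hgauge \<alpha>) z"]
    unfolding grushin_grad_gauge_inner[OF assms] norm_grushin_grad_gauge[symmetric] A_def g_def power2_norm_eq_inner .
  then have "(2 * (\<alpha> + 1))\<^sup>2 * A * (A * (dil_deriv \<alpha> f z)\<^sup>2) \<le> (2 * (\<alpha> + 1))\<^sup>2 * A * (g * (hgauge \<alpha> z - 1))"
    by (simp add: power_mult_distrib power2_eq_square algebra_simps)
  moreover have A: "0 \<le> A" "0 \<le> g" "1 \<le> hgauge \<alpha> z" by (auto simp: A_def g_def gauge_ge_1)
  ultimately have "A * (dil_deriv \<alpha> f z)\<^sup>2 \<le> g * (hgauge \<alpha> z - 1)"
  proof (cases "A = 0")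
    case False
    then have "0 < (2 * (\<alpha> + 1))\<^sup>2 * A" using A alpha by simp
    then show ?thesis
      using \<open>(2 * (\<alpha> + 1))\<^sup>2 * A * _ \<le> _\<close> by (simp only: mult_le_cancel_left_pos)
  qed simp
  also have "\<dots> \<le> g * hgauge \<alpha> z" using A by (intro mult_left_mono) auto
  finally show ?thesis by (simp add: A_def g_def mult.commute)
qed

lemma hardy_weight_nonneg: "0 \<le> hardy_weight \<alpha> z"
  using gauge_pos[of \<alpha> z] by (simp add: hardy_weight_def)

lemma continuous_hardy_weight: "continuous_on UNIV (hardy_weight \<alpha>)"
  unfolding hardy_weight_def[abs_def]
  by (intro continuous_intros continuous_gauge continuous_norm_pow)
    (use alpha in auto)

text \<open>In the homogeneous radius \<rho> = H^(1 / (2 (\<alpha> + 1))) this reads \<omega> \<le>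
  \<rho>^(-2). It follows from |x| \<le> \<rho>.\<close>

lemma hardy_weight_le: "hardy_weight \<alpha> z \<le> hgauge \<alpha> z powr (- 1 / (\<alpha> + 1))"
proof -
  have "norm_pow (fst z) (2 * \<alpha>) \<le> hgauge \<alpha> z powr (\<alpha> / (\<alpha> + 1))"
  proof (cases "\<alpha> = 0")
    case False
    have e: "2 * (\<alpha> + 1) * (\<alpha> / (\<alpha> + 1)) = 2 * \<alpha>" using alpha by (simp add: field_simps)
    have "norm_pow (fst z) (2 * \<alpha>) = (norm (fst z) powr (2 * (\<alpha> + 1))) powr (\<alpha> / (\<alpha> + 1))"
      using False unfolding powr_powr e by (simp add: norm_pow_def)
    also have "\<dots> \<le> hgauge \<alpha> z powr (\<alpha> / (\<alpha> + 1))"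
      using alpha by (intro powr_mono2) (auto simp: hgauge_def)
    finally show ?thesis .
  qed (use gauge_pos[of 0 z] in \<open>simp add: norm_pow_def\<close>)
  then have "hardy_weight \<alpha> z \<le> hgauge \<alpha> z powr (\<alpha> / (\<alpha> + 1)) / hgauge \<alpha> z powr 1"
    using gauge_pos[of \<alpha> z] by (simp add: hardy_weight_def divide_right_mono)
  also have "\<dots> = hgauge \<alpha> z powr (\<alpha> / (\<alpha> + 1) - 1)" by (simp add: powr_diff)
  also have "\<alpha> / (\<alpha> + 1) - 1 = - 1 / (\<alpha> + 1)" using alpha by (simp add: field_simps)
  finally show ?thesis .
qed

text \<open>Sublevel sets of the gauge are bounded, so radial cutoffs have bounded support.\<close>

lemma gauge_coercive:
  assumes "1 \<le> R" "2 * R < norm z" shows "R < hgauge \<alpha> z"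
proof -
  have "norm z \<le> norm (fst z) + norm (snd z)"
    by (cases z) (simp add: norm_Pair sqrt_sum_squares_le_sum)
  then consider "R < norm (fst z)" | "R < norm (snd z)" using assms by linarith
  then show ?thesis
  proof cases
    case 1
    have "R < norm (fst z) powr 1" using 1 assms by simp
    also have "\<dots> \<le> norm (fst z) powr (2 * (\<alpha> + 1))" using 1 assms alpha by (intro powr_mono) auto
    also have "\<dots> \<le> hgauge \<alpha> z" by (simp add: hgauge_def)
    finally show ?thesis .
  next
    case 2
    have "R * 1 \<le> R * R" using assms by (intro mult_left_mono) auto
    also have "\<dots> < norm (snd z) * norm (snd z)" using 2 assms by (intro mult_strict_mono) auto
    also have "\<dots> \<le> hgauge \<alpha> z" by (simp add: hgauge_def power2_eq_square)
    finally show ?thesis by simp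
  qed
qed

text \<open>Integrate the divergence of |x|^(2 \<alpha>) (\<phi>^2 / H) times the dilation field,
  which has integral 0. Expanding gives (Q - 2) \<omega> \<phi>^2 plus a cross term in the dilation
  derivative of \<phi>; completing the square with s = (Q - 2)/2 exchanges the cross term for the
  gradient.\<close>

lemma hardy_inequality:
  fixes \<phi> :: "(real^'m) \<times> (real^'n) \<Rightarrow> real"
  assumes phi: "C1_fun \<phi>" "\<And>z. r < norm z \<Longrightarrow> \<phi> z = 0"
    and Q: "Q = real CARD('m) + real CARD('n) * (\<alpha> + 1)" "2 < Q"
  shows "((Q - 2) / 2)\<^sup>2 * (LINT z|lborel. hardy_weight \<alpha> z * (\<phi> z)\<^sup>2) \<le> (LINT z|lborel. (norm (grushin_grad \<alpha> \<phi> z))\<^sup>2)"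
proof -
  define A :: "(real^'m) \<times> (real^'n) \<Rightarrow> real" where "A z = norm_pow (fst z) (2 * \<alpha>)" for z
  have A0: "0 \<le> A z" for z by (simp add: A_def)
  have cA: "continuous_on UNIV A"
    unfolding A_def by (intro continuous_norm_pow continuous_intros) (use alpha in auto)
  have inv: "(inverse has_real_derivative - (inverse (hgauge \<alpha> z))\<^sup>2) (at (hgauge \<alpha> z))" for z :: "(real^'m) \<times> (real^'n)"
    using DERIV_inverse[of "hgauge \<alpha> z" UNIV] gauge_pos[of \<alpha> z] by (simp add: numeral_2_eq_2)
  have Cinv: "C1_fun (\<lambda>z::(real^'m) \<times> (real^'n). inverse (hgauge \<alpha> z))"
    by (rule C1_fun_comp[OF C1_fun_gauge inv])
      (intro continuous_intros continuous_gauge, auto)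
  define G where "G z = \<phi> z * \<phi> z * inverse (hgauge \<alpha> z)" for z
  have G: "C1_fun G" unfolding G_def by (intro C1_fun_mult phi Cinv)
  have Gs: "r < norm z \<Longrightarrow> G z = 0" for z by (simp add: G_def phi)
  have dG: "dil_deriv \<alpha> G z = 2 * \<phi> z * dil_deriv \<alpha> \<phi> z / hgauge \<alpha> z
      - (\<phi> z)\<^sup>2 * (2 * (\<alpha> + 1) * (hgauge \<alpha> z - 1)) / (hgauge \<alpha> z)\<^sup>2" for z
  proof -
    have "dil_deriv \<alpha> G z = (\<phi> z * \<phi> z) * (- (inverse (hgauge \<alpha> z))\<^sup>2 * (2 * (\<alpha> + 1) * (hgauge \<alpha> z - 1)))
        + (\<phi> z * dil_deriv \<alpha> \<phi> z + dil_deriv \<alpha> \<phi> z * \<phi> z) * inverse (hgauge \<alpha> z)"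
      unfolding G_def by (simp only: dil_deriv_mult[OF C1_fun_mult[OF phi(1) phi(1)] Cinv] dil_deriv_mult[OF phi(1) phi(1)]
        dil_deriv_comp[OF C1_fun_gauge inv] dil_deriv_gauge)
    then show ?thesis by (simp add: field_simps power2_eq_square)
  qed
  define s where "s = (Q - 2) / 2"
  have s: "0 < s" using Q by (simp add: s_def)
  have "(LINT z|lborel. A z * dil_deriv \<alpha> G z) = - (Q + 2 * \<alpha>) * (LINT z|lborel. A z * G z)"
    unfolding A_def by (rule integral_dil_deriv[where r = r, OF G]) (use alpha Q Gs in auto)
  moreover have iG1: "integrable lborel (\<lambda>z. A z * G z)"
    by (rule integrable_continuous_bounded_support[where r = r])
      (auto intro: continuous_on_mult cA C1_fun_continuous G simp: Gs)
  moreover have iG2: "integrable lborel (\<lambda>z. A z * dil_deriv \<alpha> G z)"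
    by (rule integrable_continuous_bounded_support[where r = r])
      (intro continuous_on_mult cA continuous_dil_deriv G,
        simp add: dil_deriv_def dir_deriv_outside[of r G, OF Gs])
  ultimately have 0: "0 = (LINT z|lborel. A z * dil_deriv \<alpha> G z + (Q + 2 * \<alpha>) * (A z * G z))"
    by simp (simp add: algebra_simps)
  have i1: "integrable lborel (\<lambda>z. hardy_weight \<alpha> z * (\<phi> z)\<^sup>2)"
    by (rule integrable_continuous_bounded_support[where r = r])
      (auto intro!: continuous_intros continuous_hardy_weight C1_fun_continuous[OF phi(1)] simp: phi)
  have i2: "integrable lborel (\<lambda>z. (norm (grushin_grad \<alpha> \<phi> z))\<^sup>2)"
    by (rule integrable_continuous_bounded_support[where r = r])
      (auto intro!: continuous_norm_grushin_grad alpha phi simp: grushin_grad_outside[of r] phi)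
  have pt: "s * (hardy_weight \<alpha> z * (\<phi> z)\<^sup>2) - (norm (grushin_grad \<alpha> \<phi> z))\<^sup>2 / s
      \<le> A z * dil_deriv \<alpha> G z + (Q + 2 * \<alpha>) * (A z * G z)" for z
  proof -
    define H where "H = hgauge \<alpha> z"
    have H: "0 < H" "1 \<le> H" using gauge_ge_1[of \<alpha> z] by (auto simp: H_def)
    define \<delta> where "\<delta> = dil_deriv \<alpha> \<phi> z"
    have "A z * \<delta>\<^sup>2 / H \<le> (norm (grushin_grad \<alpha> \<phi> z))\<^sup>2"
      using dil_deriv_bound[OF phi(1), of z] H by (simp add: A_def \<delta>_def H_def field_simps)
    then have "A z * \<delta>\<^sup>2 / H / s \<le> (norm (grushin_grad \<alpha> \<phi> z))\<^sup>2 / s" using s by (intro divide_right_mono) auto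
    moreover have "0 \<le> A z / H * (s * \<phi> z + \<delta>)\<^sup>2 / s" using H s A0[of z] by simp
    moreover have "A z / H * (s * \<phi> z + \<delta>)\<^sup>2 / s = s * (A z / H * (\<phi> z)\<^sup>2) + 2 * (A z / H * \<phi> z * \<delta>) + A z * \<delta>\<^sup>2 / H / s"
      using H s by (simp add: field_simps power2_eq_square)
    moreover have "A z * dil_deriv \<alpha> G z + (Q + 2 * \<alpha>) * (A z * G z)
       = 2 * (A z / H * \<phi> z * \<delta>) + 2 * (s * (A z / H * (\<phi> z)\<^sup>2)) + 2 * (\<alpha> + 1) * A z * (\<phi> z)\<^sup>2 / H\<^sup>2"
      unfolding dG G_def s_def H_def[symmetric] \<delta>_def[symmetric]
      using H by (simp add: field_simps power2_eq_square)
    \<comment> \<open>The remainder caused by the summand 1 in H (the dilation derivative of H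
      contains H - 1 and not H); its sign is favourable.\<close>
    moreover have "0 \<le> 2 * (\<alpha> + 1) * A z * (\<phi> z)\<^sup>2 / H\<^sup>2" using A0 alpha by simp
    moreover have "c \<le> g \<Longrightarrow> 0 \<le> l \<Longrightarrow> l = a + 2 * b + c \<Longrightarrow> x = 2 * b + 2 * a + d \<Longrightarrow> 0 \<le> d \<Longrightarrow> a - g \<le> x"
      for a b c d g l x :: real by linarith
    ultimately show ?thesis unfolding hardy_weight_def A_def[symmetric] H_def[symmetric] by blast
  qed
  have "(LINT z|lborel. s * (hardy_weight \<alpha> z * (\<phi> z)\<^sup>2) - (norm (grushin_grad \<alpha> \<phi> z))\<^sup>2 / s) \<le> 0"
    unfolding 0 by (rule integral_mono) (use iG1 iG2 i1 i2 pt in auto)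
  then have "s * (LINT z|lborel. hardy_weight \<alpha> z * (\<phi> z)\<^sup>2) \<le> (LINT z|lborel. (norm (grushin_grad \<alpha> \<phi> z))\<^sup>2) / s"
    using i1 i2 by simp
  then show ?thesis using s by (simp add: s_def[symmetric] field_simps power2_eq_square)
qed

lemma gauge_dilation: "hgauge \<alpha> (dilation \<alpha> s z) - 1 = exp (2 * (\<alpha> + 1) * s) * (hgauge \<alpha> z - 1)"
proof -
  have "(exp s) powr (2 * (\<alpha> + 1)) = exp (2 * (\<alpha> + 1) * s)" "(exp ((\<alpha> + 1) * s))\<^sup>2 = exp (2 * (\<alpha> + 1) * s)"
    by (simp_all add: exp_powr_real power2_eq_square algebra_simps flip: exp_add)
  then show ?thesis
    by (simp add: hgauge_def dilation_def powr_mult power_mult_distrib distrib_left)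
qed

end

section \<open>Shells of the gauge and their volume\<close>

definition shell :: "real \<Rightarrow> real \<Rightarrow> real \<Rightarrow> ((real^'m) \<times> (real^'n)) set" where
  "shell \<alpha> a b = {z. a \<le> hgauge \<alpha> z \<and> hgauge \<alpha> z \<le> b}"

lemma indicator_shell: "indicator (shell \<alpha> a b) z = (if a \<le> hgauge \<alpha> z \<and> hgauge \<alpha> z \<le> b then 1 else (0::real))"
  by (simp add: shell_def)

lemma compact_shell:
  assumes "0 \<le> \<alpha>" shows "compact (shell \<alpha> a b)"
proof -
  have "closed (shell \<alpha> a b)" unfolding shell_def
    by (intro closed_Collect_conj closed_Collect_le continuous_intros continuous_gauge assms)
  moreover have "norm z \<le> 2 * max 1 b" if "z \<in> shell \<alpha> a b" for z
    using gauge_coercive[OF assms, of "max 1 b" z] that by (force simp: shell_def not_less[symmetric])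
  then have "bounded (shell \<alpha> a b)" unfolding bounded_iff by blast
  ultimately show ?thesis by (simp add: compact_eq_bounded_closed)
qed

lemma integrable_shell:
  assumes "0 \<le> \<alpha>" "continuous_on UNIV g"
  shows "integrable lborel (\<lambda>z. indicator (shell \<alpha> a b) z * (g z :: real))"
  using borel_integrable_compact[OF compact_shell[OF assms(1)] continuous_on_subset[OF assms(2) subset_UNIV]] by simp

text \<open>By scaling from H \<le> 2. It is H - 1 that is homogeneous, so the dilation with exp (2
  (\<alpha> + 1) s) = R carries H \<le> 2 onto H \<le> R + 1.\<close>

lemma volume_gauge_le:
  assumes "0 \<le> \<alpha>" "Q = real CARD('m) + real CARD('n) * (\<alpha> + 1)"
  obtains C where "0 \<le> C"
    "\<And>R. 1 \<le> R \<Longrightarrow> (LINT z|lborel. indicator (shell \<alpha> 1 R :: ((real^'m) \<times> (real^'n)) set) z) \<le> C * R powr (Q / (2 * (\<alpha> + 1)))"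
proof -
  define C :: real where "C = (LINT z|lborel. indicator (shell \<alpha> 1 2 :: ((real^'m) \<times> (real^'n)) set) z)"
  have int: "integrable lborel (\<lambda>z. indicator (shell \<alpha> 1 R :: ((real^'m) \<times> (real^'n)) set) z :: real)" for R
    using integrable_shell[OF assms(1), of "\<lambda>_::(real^'m) \<times> (real^'n). 1"] by simp
  have "(LINT z|lborel. indicator (shell \<alpha> 1 R :: ((real^'m) \<times> (real^'n)) set) z) \<le> C * R powr (Q / (2 * (\<alpha> + 1)))" if "1 \<le> R" for R
  proof -
    define s where "s = ln R / (2 * (\<alpha> + 1))"
    have es: "exp (2 * (\<alpha> + 1) * s) = R" using assms that by (simp add: s_def)
    have "exp (Q * s) = R powr (Q / (2 * (\<alpha> + 1)))" using that by (simp add: s_def powr_def)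
    moreover have "C = exp (- Q * s) * (LINT z|lborel. indicator (shell \<alpha> 1 (R + 1) :: ((real^'m) \<times> (real^'n)) set) z)"
    proof -
      have "hgauge \<alpha> (dilation \<alpha> s z) \<le> R + 1 \<longleftrightarrow> hgauge \<alpha> z \<le> 2" for z :: "(real^'m) \<times> (real^'n)"
      proof -
        have "R * (hgauge \<alpha> z - 1) \<le> R * 1 \<longleftrightarrow> hgauge \<alpha> z - 1 \<le> 1"
          using that by (intro mult_le_cancel_left_pos) auto
        then show ?thesis using gauge_dilation[OF assms(1), of s z] unfolding es by argo
      qed
      then have "C = (LINT z|lborel. indicator (shell \<alpha> 1 (R + 1) :: ((real^'m) \<times> (real^'n)) set) (dilation \<alpha> s z))"
        unfolding C_def by (intro Bochner_Integration.integral_cong) (simp_all add: indicator_shell gauge_ge_1)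
      also have "\<dots> = exp (- Q * s) * (LINT z|lborel. indicator (shell \<alpha> 1 (R + 1) :: ((real^'m) \<times> (real^'n)) set) z)"
        by (rule integral_dilation[OF _ assms(2)])
          (use borel_measurable_integrable[OF int[of "R + 1"]] in simp)
      finally show ?thesis .
    qed
    ultimately have "(LINT z|lborel. indicator (shell \<alpha> 1 (R + 1) :: ((real^'m) \<times> (real^'n)) set) z) = C * R powr (Q / (2 * (\<alpha> + 1)))"
      using that by (simp add: exp_minus field_simps)
    moreover have "(LINT z|lborel. indicator (shell \<alpha> 1 R :: ((real^'m) \<times> (real^'n)) set) z)
        \<le> (LINT z|lborel. indicator (shell \<alpha> 1 (R + 1) :: ((real^'m) \<times> (real^'n)) set) z :: real)"
      by (rule integral_mono[OF int int]) (simp add: indicator_shell)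
    ultimately show ?thesis by simp
  qed
  moreover have "0 \<le> C" unfolding C_def by simp
  ultimately show thesis using that by blast
qed

section \<open>Radial cutoffs\<close>

lemma pos_part_square_has_derivative: "((\<lambda>t. (max 0 t)\<^sup>2) has_real_derivative 2 * max 0 t) (at t)" for t :: real
proof -
  consider "t < 0" | "t = 0" | "0 < t" by linarith
  then show ?thesis
  proof cases
    case 1
    have "((\<lambda>t. 0) has_real_derivative 2 * max 0 t) (at t)" using 1 by simp
    then show ?thesis
      by (rule has_field_derivative_transform_within_open[where S = "{..<0}"]) (use 1 in auto)

  next
    case 2
    have "((\<lambda>h::real. max 0 h) \<longlongrightarrow> 0) (at 0)"
      by (rule tendsto_eq_intros refl)+ simp
    moreover have "(max 0 h)\<^sup>2 / h = max 0 h" for h :: real by (simp add: max_def power2_eq_square)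
    ultimately show ?thesis using 2 by (simp add: has_field_derivative_iff)
  next
    case 3
    have "((\<lambda>t. t\<^sup>2) has_real_derivative 2 * max 0 t) (at t)" using 3 by (auto intro!: derivative_eq_intros)
    then show ?thesis
      by (rule has_field_derivative_transform_within_open[where S = "{0<..}"]) (use 3 in auto)

  qed
qed

text \<open>With \<open>q t = (max 0 t)\<^sup>2\<close>, the function \<open>t \<mapsto> q (1 - q (1 - t))\<close> is a \<open>C\<^sup>1\<close> step from 0 to 1 on
  the unit interval.\<close>

definition cutoff :: "real \<Rightarrow> real \<Rightarrow> real" where
  "cutoff R t = (max 0 (1 - (max 0 (t / R - 1))\<^sup>2))\<^sup>2"

definition cutoff' :: "real \<Rightarrow> real \<Rightarrow> real" where
  "cutoff' R t = - 4 * max 0 (1 - (max 0 (t / R - 1))\<^sup>2) * max 0 (t / R - 1) / R"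

lemma cutoff_has_derivative: "(cutoff R has_real_derivative cutoff' R t) (at t)"
proof -
  have "((\<lambda>t. 1 - (max 0 (t / R - 1))\<^sup>2) has_real_derivative - (2 * max 0 (t / R - 1) * (1 / R))) (at t)"
  proof -
    have "((\<lambda>t. t / R - 1) has_real_derivative 1 / R) (at t)"
      using DERIV_diff[OF DERIV_cdivide[OF DERIV_ident] DERIV_const] by simp
    from DERIV_diff[OF DERIV_const[of 1] DERIV_chain2[OF pos_part_square_has_derivative this]]
    show ?thesis by simp
  qed
  from DERIV_chain2[OF pos_part_square_has_derivative this]
  show ?thesis unfolding cutoff_def[abs_def] cutoff'_def by (simp add: field_simps)
qed

lemma continuous_cutoff': "continuous_on S (cutoff' R)"
  unfolding cutoff'_def[abs_def] divide_inverse by (intro continuous_intros)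

lemma cutoff_bounds: "0 \<le> cutoff R t" "cutoff R t \<le> 1"
  by (auto simp: cutoff_def intro!: power_le_one)

lemma cutoff_inside:
  assumes "0 < R" "t \<le> R" shows "cutoff R t = 1" "cutoff' R t = 0"
proof -
  have "t / R - 1 \<le> 0" using assms by simp
  then have "max 0 (t / R - 1) = 0" by simp
  then show "cutoff R t = 1" "cutoff' R t = 0" by (simp_all add: cutoff_def cutoff'_def)
qed

lemma cutoff_outside:
  assumes "0 < R" "2 * R \<le> t" shows "cutoff R t = 0" "cutoff' R t = 0"
proof -
  have "1 \<le> t / R - 1" using assms by (simp add: field_simps)
  then have "1 \<le> (max 0 (t / R - 1))\<^sup>2" by (simp add: max_def)
  then have "max 0 (1 - (max 0 (t / R - 1))\<^sup>2) = 0" by simp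
  then show "cutoff R t = 0" "cutoff' R t = 0" by (simp_all add: cutoff_def cutoff'_def)
qed

text \<open>t \<open>cutoff'\<close> R t depends on t / R only, so the bound is free of R: 8 is the
  4 in \<open>cutoff'\<close> times t / R \<le> 2. Such derivatives with respect to log t are what
  the radial inequalities see.\<close>

lemma cutoff'_bound:
  assumes "0 < R" shows "\<bar>t * cutoff' R t\<bar> \<le> 8 * indicator {R..2 * R} t"
proof (cases "R \<le> t \<and> t \<le> 2 * R")
  case True
  define x where "x = t / R"
  define y where "y = max 0 (1 - (max 0 (x - 1))\<^sup>2) * max 0 (x - 1)"
  have x: "1 \<le> x" "x \<le> 2" using True assms by (auto simp: x_def field_simps)
  then have "y \<le> 1 * 1" unfolding y_def by (intro mult_mono) auto
  then have "x * y \<le> 2 * 1" using x by (intro mult_mono) (auto simp: y_def)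
  moreover have "t * cutoff' R t = - (4 * (x * y))"
    using assms by (simp add: cutoff'_def x_def y_def)
  moreover have "0 \<le> x * y" using x by (simp add: y_def)
  ultimately show ?thesis using True by simp
next
  case False
  then show ?thesis using cutoff_inside(2)[OF assms, of t] cutoff_outside(2)[OF assms, of t] by auto
qed

section \<open>Stability with radial weights\<close>

lemma integral_le_pointwise:
  fixes f g :: "'a \<Rightarrow> real"
  assumes "integrable M f" "integrable M g" "\<And>z. f z \<le> g z"
  shows "integral\<^sup>L M f \<le> integral\<^sup>L M g"
  using assms by (intro integral_mono) auto

text \<open>The dichotomy \<open>c \<le> e U\<^bsup>p-1\<^esup> x\<^sup>2\<close> or not replaces Young's inequality.\<close>

lemma young_cutoff:
  fixes U x c e p :: real and k :: nat
  assumes "1 < p" "0 \<le> U" "0 \<le> x" "x \<le> 1" "0 \<le> c" "0 < e" "1 + 2 / (p - 1) \<le> real k"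
  shows "c * (U\<^sup>2 * x ^ (2 * k - 2)) \<le> e * (U powr (p + 1) * x ^ (2 * k)) + c * (c / e) powr (2 / (p - 1))"
proof -
  have "0 < 2 / (p - 1)" using assms by simp
  then have k2: "2 \<le> k" using assms(7) by linarith
  have Up: "U powr (p + 1) = U powr (p - 1) * U powr 2"
    using powr_add[of U "p - 1" 2] by (simp add: add.commute)
  show ?thesis
  proof (cases "x = 0 \<or> U = 0")
    case True
    then show ?thesis using assms k2 by (auto simp: power_0_left intro!: add_nonneg_nonneg)
  next
    case False
    then have pos: "0 < x" "0 < U" using assms by auto
  show ?thesis
  proof (cases "c \<le> e * (U powr (p - 1) * x\<^sup>2)")
    case True
    have "c * (U\<^sup>2 * x ^ (2 * k - 2)) \<le> (e * (U powr (p - 1) * x\<^sup>2)) * (U\<^sup>2 * x ^ (2 * k - 2))"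
      using True pos by (intro mult_right_mono) auto
    also have "\<dots> = e * (U powr (p + 1) * (x\<^sup>2 * x ^ (2 * k - 2)))" using pos by (simp add: Up mult_ac powr_numeral)
    also have "x\<^sup>2 * x ^ (2 * k - 2) = x ^ (2 * k)"
    proof -
      have "2 + (2 * k - 2) = 2 * k" using k2 by simp
      then show ?thesis using power_add[of x 2 "2 * k - 2"] by (simp only:)
    qed
    finally show ?thesis using assms by (simp add: add_increasing2)
  next
    case False
    then have "U powr (p - 1) * x\<^sup>2 < c / e" using assms by (simp add: field_simps)
    then have "(U powr (p - 1) * x\<^sup>2) powr (2 / (p - 1)) \<le> (c / e) powr (2 / (p - 1))"
      using assms by (intro powr_mono2) auto
    moreover have "(U powr (p - 1) * x\<^sup>2) powr (2 / (p - 1)) = U\<^sup>2 * x powr (4 / (p - 1))"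
    proof -
      have "(U powr (p - 1) * x\<^sup>2) powr (2 / (p - 1)) = (U powr (p - 1)) powr (2 / (p - 1)) * (x powr 2) powr (2 / (p - 1))"
        using pos by (simp add: powr_mult powr_numeral)
      also have "\<dots> = U powr 2 * x powr (4 / (p - 1))"
      proof -
        have "p - 1 \<noteq> 0" using assms(1) by simp
        from nonzero_mult_div_cancel_left[OF this, of 2] have "(p - 1) * (2 / (p - 1)) = 2"
          by (simp only: times_divide_eq_right)
        moreover have "2 * (2 / (p - 1)) = 4 / (p - 1)" by simp
        ultimately show ?thesis by (simp only: powr_powr)
      qed
      finally show ?thesis using pos by (simp add: powr_numeral)
    qed
    \<comment> \<open>As x \<le> 1, this amounts to 4 / (p - 1) \<le> 2 k - 2, which is the
      hypothesis on k.\<close>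
    moreover have "x ^ (2 * k - 2) \<le> x powr (4 / (p - 1))"
    proof -
      have "x ^ (2 * k - 2) = x powr (real (2 * k - 2))" using pos by (simp add: powr_realpow)
      also have "\<dots> \<le> x powr (4 / (p - 1))"
      proof (rule powr_mono')
        have "real (2 * k - 2) = 2 * real k - 2" using k2 by (simp add: of_nat_diff)
        then show "4 / (p - 1) \<le> real (2 * k - 2)" using assms(7) by simp
      qed (use assms in auto)
      finally show ?thesis .
    qed
    ultimately have "U\<^sup>2 * x ^ (2 * k - 2) \<le> (c / e) powr (2 / (p - 1))"
      using mult_left_mono[of "x ^ (2 * k - 2)" "x powr (4 / (p - 1))" "U\<^sup>2"] by simp
    then have "c * (U\<^sup>2 * x ^ (2 * k - 2)) \<le> c * (c / e) powr (2 / (p - 1))"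
      using assms by (intro mult_left_mono) auto
    moreover have "0 \<le> e * (U powr (p + 1) * x ^ (2 * k))" using assms by simp
    ultimately show ?thesis by linarith
  qed
  qed
qed

locale grushin_stable =
  fixes \<alpha> Q p :: real and u :: "(real^'m) \<times> (real^'n) \<Rightarrow> real" and K :: "((real^'m) \<times> (real^'n)) set"
  assumes alpha: "0 \<le> \<alpha>"
    and Q: "Q = real CARD('m) + real CARD('n) * (\<alpha> + 1)"
    and p: "1 < p"
    and sol: "grushin_solution \<alpha> p u"
    and K: "compact K"
    and stable: "\<And>\<phi>. \<phi> \<in> C1_compact_support (- K) \<Longrightarrow>
      (LINT z|lborel. p * \<bar>u z\<bar> powr (p - 1) * (\<phi> z)\<^sup>2) \<le> (LINT z|lborel. (norm (grushin_grad \<alpha> \<phi> z))\<^sup>2)"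
begin

lemma C2_u: "C2_fun u"
  using sol by (simp add: grushin_solution_def)

lemma laplacian_u: "grushin_laplacian \<alpha> u z = - (\<bar>u z\<bar> powr (p - 1) * u z)"
  using sol unfolding grushin_solution_def by (metis minus_minus)

lemmas C1_u = C2_fun_C1[OF C2_u]

lemma continuous_u: "continuous_on S u"
  using continuous_on_subset[OF C1_fun_continuous[OF C1_u(1)]] by blast

lemma continuous_u_powr: "0 < c \<Longrightarrow> continuous_on S (\<lambda>z. \<bar>u z\<bar> powr c)"
  by (intro continuous_on_powr' continuous_intros continuous_u) auto

lemma u_powr_mult: "\<bar>u z\<bar> powr (p - 1) * (u z)\<^sup>2 = \<bar>u z\<bar> powr (p + 1)"
proof (cases "u z = 0")
  case False
  then show ?thesis using powr_add[of "\<bar>u z\<bar>" "p - 1" 2] by (simp add: add.commute powr_numeral)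
qed simp

text \<open>Pointwise, the square of the gradient of u w is the gradient of u paired with that of u
  w^2, plus u^2 |grad w|^2. Green's formula and the equation integrate the first summand.\<close>

lemma energy_identity:
  assumes w: "C1_fun w" "\<And>z. r < norm z \<Longrightarrow> w z = 0"
  shows "(LINT z|lborel. (norm (grushin_grad \<alpha> (\<lambda>z. u z * w z) z))\<^sup>2)
    = (LINT z|lborel. \<bar>u z\<bar> powr (p + 1) * (w z)\<^sup>2) + (LINT z|lborel. (u z)\<^sup>2 * (norm (grushin_grad \<alpha> w z))\<^sup>2)"
proof -
  define \<zeta> where "\<zeta> z = u z * (w z * w z)" for z
  have zeta: "C1_fun \<zeta>" unfolding \<zeta>_def by (intro C1_fun_mult C1_u w)
  have pt: "(norm (grushin_grad \<alpha> (\<lambda>z. u z * w z) z))\<^sup>2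
      = grushin_grad \<alpha> u z \<bullet> grushin_grad \<alpha> \<zeta> z + (u z)\<^sup>2 * (norm (grushin_grad \<alpha> w z))\<^sup>2" for z
    unfolding \<zeta>_def power2_norm_eq_inner grushin_grad_mult[OF C1_u(1) C1_fun_mult[OF w(1) w(1)]]
      grushin_grad_mult[OF C1_u(1) w(1)] grushin_grad_mult[OF w(1) w(1)]
    by (simp add: inner_add_left inner_add_right inner_commute power2_eq_square algebra_simps)
  have i1: "integrable lborel (\<lambda>z. grushin_grad \<alpha> u z \<bullet> grushin_grad \<alpha> \<zeta> z)"
    by (rule integrable_continuous_bounded_support[where r = r])
      (auto intro: continuous_grushin_grad_inner alpha C1_u zeta simp: grushin_grad_outside[of r] w \<zeta>_def)
  have i2: "integrable lborel (\<lambda>z. (u z)\<^sup>2 * (norm (grushin_grad \<alpha> w z))\<^sup>2)"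
    by (rule integrable_continuous_bounded_support[where r = r])
      (intro continuous_on_mult continuous_on_power[OF continuous_u] continuous_norm_grushin_grad alpha w,
        simp add: grushin_grad_outside[of r w] w)
  have "(LINT z|lborel. grushin_grad \<alpha> u z \<bullet> grushin_grad \<alpha> \<zeta> z) = - (LINT z|lborel. \<zeta> z * grushin_laplacian \<alpha> u z)"
    by (rule grushin_green[OF C2_u zeta _ alpha, where r = r]) (simp add: \<zeta>_def w)
  also have "\<dots> = (LINT z|lborel. \<bar>u z\<bar> powr (p + 1) * (w z)\<^sup>2)"
    unfolding laplacian_u \<zeta>_def u_powr_mult[symmetric] by (simp add: power2_eq_square mult_ac)
  finally show ?thesis unfolding pt using i1 i2 by simp
qed

text \<open>Let I, G, J be the integrals of |u|^(p + 1) w^2, |grad (u w)|^2 and u^2 |grad w|^2.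
  Stability tested with u w says p I \<le> G, and the energy identity says G = I + J; eliminating G
  or I gives the two claims.\<close>

lemma stability_inequalities:
  assumes w: "C1_fun w" "\<And>z. r < norm z \<Longrightarrow> w z = 0" and "closure {z. w z \<noteq> 0} \<inter> K = {}"
  shows "(p - 1) * (LINT z|lborel. \<bar>u z\<bar> powr (p + 1) * (w z)\<^sup>2)
      \<le> (LINT z|lborel. (u z)\<^sup>2 * (norm (grushin_grad \<alpha> w z))\<^sup>2)"
    and "(p - 1) * (LINT z|lborel. (norm (grushin_grad \<alpha> (\<lambda>z. u z * w z) z))\<^sup>2)
      \<le> p * (LINT z|lborel. (u z)\<^sup>2 * (norm (grushin_grad \<alpha> w z))\<^sup>2)"
proof -
  let ?\<phi> = "\<lambda>z. u z * w z"
  have sub: "closure {z. ?\<phi> z \<noteq> 0} \<subseteq> closure {z. w z \<noteq> 0}" by (rule closure_mono) auto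
  have "{z. w z \<noteq> 0} \<subseteq> cball 0 r" using w(2) by (force simp: not_less[symmetric])
  then have "bounded {z. w z \<noteq> 0}" by (rule bounded_subset[OF bounded_cball])
  then have "compact (closure {z. ?\<phi> z \<noteq> 0})"
    using bounded_subset[OF bounded_closure sub] by (simp add: compact_eq_bounded_closed)
  then have "?\<phi> \<in> C1_compact_support (- K)"
    using sub assms(3) by (auto simp: C1_compact_support_def intro!: C1_fun_mult C1_u w)
  from stable[OF this] have "(LINT z|lborel. p * (\<bar>u z\<bar> powr (p + 1) * (w z)\<^sup>2)) \<le> (LINT z|lborel. (norm (grushin_grad \<alpha> ?\<phi> z))\<^sup>2)"
    unfolding u_powr_mult[symmetric] by (simp add: power_mult_distrib mult_ac)
  then have 1: "p * (LINT z|lborel. \<bar>u z\<bar> powr (p + 1) * (w z)\<^sup>2) \<le> (LINT z|lborel. (norm (grushin_grad \<alpha> ?\<phi> z))\<^sup>2)"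
    by simp
  note 2 = energy_identity[of w r, OF w]
  show "(p - 1) * (LINT z|lborel. \<bar>u z\<bar> powr (p + 1) * (w z)\<^sup>2)
      \<le> (LINT z|lborel. (u z)\<^sup>2 * (norm (grushin_grad \<alpha> w z))\<^sup>2)"
    using 1 2 unfolding left_diff_distrib by linarith
  show "(p - 1) * (LINT z|lborel. (norm (grushin_grad \<alpha> ?\<phi> z))\<^sup>2)
      \<le> p * (LINT z|lborel. (u z)\<^sup>2 * (norm (grushin_grad \<alpha> w z))\<^sup>2)"
  proof -
    have "p * (LINT z|lborel. (norm (grushin_grad \<alpha> ?\<phi> z))\<^sup>2) = p * (LINT z|lborel. \<bar>u z\<bar> powr (p + 1) * (w z)\<^sup>2)
        + p * (LINT z|lborel. (u z)\<^sup>2 * (norm (grushin_grad \<alpha> w z))\<^sup>2)"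
      using arg_cong[OF 2, of "(*) p"] by (simp only: distrib_left)
    then show ?thesis using 1 unfolding left_diff_distrib by linarith
  qed
qed

text \<open>A gauge level above K, fixed once so that all later estimates use the same inner
  radius.\<close>

definition H0 :: real where
  "H0 = (SOME h. 1 \<le> h \<and> (\<forall>z\<in>K. hgauge \<alpha> z < h))"

lemma H0: "1 \<le> H0" "z \<in> K \<Longrightarrow> hgauge \<alpha> z < H0"
proof -
  have "bounded (hgauge \<alpha> ` K)"
    by (intro compact_imp_bounded compact_continuous_image continuous_gauge alpha K)
  then obtain B where "\<forall>z\<in>K. \<bar>hgauge \<alpha> z\<bar> \<le> B" unfolding bounded_iff by auto
  then have "\<exists>h. 1 \<le> h \<and> (\<forall>z\<in>K. hgauge \<alpha> z < h)"
    by (intro exI[of _ "\<bar>B\<bar> + 1"]) force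
  from someI_ex[OF this] show "1 \<le> H0" "z \<in> K \<Longrightarrow> hgauge \<alpha> z < H0" by (auto simp: H0_def)
qed

abbreviation dens :: "(real^'m) \<times> (real^'n) \<Rightarrow> real" where
  "dens z \<equiv> hardy_weight \<alpha> z * (u z)\<^sup>2"

abbreviation mass :: "((real^'m) \<times> (real^'n) \<Rightarrow> real) \<Rightarrow> real \<Rightarrow> real \<Rightarrow> real" where
  "mass g a b \<equiv> (LINT z|lborel. indicator (shell \<alpha> a b) z * g z)"

lemma continuous_density: "continuous_on UNIV dens"
  by (intro continuous_on_mult continuous_on_power continuous_hardy_weight alpha continuous_u)

lemma density_nonneg: "0 \<le> dens z"
  by (simp add: hardy_weight_nonneg alpha)

text \<open>Reduction to one variable: |grad W(H)|^2 is at most 4 (\<alpha> + 1)^2 \<omega> (H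
  W'(H))^2, so only the derivative of W with respect to log t enters. Differentiability is asked for
  t \<ge> 1, the range of the gauge.\<close>

lemma radial_inequalities:
  assumes W: "\<And>t. 1 \<le> t \<Longrightarrow> (W has_real_derivative W' t) (at t)" "continuous_on {1..} W'"
    and supp: "\<And>t. t < H0 \<Longrightarrow> W t = 0" "\<And>t. R < t \<Longrightarrow> W t = 0"
  shows "(p - 1) * (LINT z|lborel. \<bar>u z\<bar> powr (p + 1) * (W (hgauge \<alpha> z))\<^sup>2)
      \<le> 4 * (\<alpha> + 1)\<^sup>2 * (LINT z|lborel. dens z * (hgauge \<alpha> z * W' (hgauge \<alpha> z))\<^sup>2)"
    and "(p - 1) * (LINT z|lborel. (norm (grushin_grad \<alpha> (\<lambda>z. u z * W (hgauge \<alpha> z)) z))\<^sup>2)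
      \<le> p * (4 * (\<alpha> + 1)\<^sup>2 * (LINT z|lborel. dens z * (hgauge \<alpha> z * W' (hgauge \<alpha> z))\<^sup>2))"
    and "2 < Q \<Longrightarrow> (p - 1) / p * ((Q - 2) / 2)\<^sup>2 * (LINT z|lborel. dens z * (W (hgauge \<alpha> z))\<^sup>2)
      \<le> 4 * (\<alpha> + 1)\<^sup>2 * (LINT z|lborel. dens z * (hgauge \<alpha> z * W' (hgauge \<alpha> z))\<^sup>2)"
    and "integrable lborel (\<lambda>z. \<bar>u z\<bar> powr (p + 1) * (W (hgauge \<alpha> z))\<^sup>2)"
      "integrable lborel (\<lambda>z. dens z * (hgauge \<alpha> z * W' (hgauge \<alpha> z))\<^sup>2)"
      "integrable lborel (\<lambda>z. dens z * (W (hgauge \<alpha> z))\<^sup>2)"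
      "integrable lborel (\<lambda>z. (norm (grushin_grad \<alpha> (\<lambda>z. u z * W (hgauge \<alpha> z)) z))\<^sup>2)"
proof -
  define r where "r = 2 * max 1 R"
  define w where "w z = W (hgauge \<alpha> z)" for z :: "(real^'m) \<times> (real^'n)"
  have far: "R < hgauge \<alpha> z" if "r < norm z" for z :: "(real^'m) \<times> (real^'n)"
    using gauge_coercive[OF alpha, of "max 1 R" z] that by (simp add: r_def)
  have cW': "continuous_on UNIV (\<lambda>z::(real^'m) \<times> (real^'n). W' (hgauge \<alpha> z))"
    by (rule continuous_on_compose2[OF W(2) continuous_gauge[OF alpha]]) (auto simp: gauge_ge_1)
  have w: "C1_fun w" unfolding w_def
    by (rule C1_fun_comp[OF C1_fun_gauge[OF alpha] W(1) cW']) (rule gauge_ge_1)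
  have w0: "w z = 0" if "r < norm z" for z using far[OF that] supp(2) by (simp add: w_def)
  have W'0: "W' t = 0" if "R < t" "1 \<le> t" for t
  proof -
    have "(W has_real_derivative 0) (at t)"
      by (rule has_field_derivative_transform_within_open[where S = "{R<..}" and f = "\<lambda>_. 0"]) (use that supp in auto)
    then show ?thesis using W(1)[OF that(2)] DERIV_unique by blast
  qed
  have W'0z: "W' (hgauge \<alpha> z) = 0" if "r < norm z" for z :: "(real^'m) \<times> (real^'n)"
    using W'0[OF far[OF that] gauge_ge_1] .
  \<comment> \<open>The gauge on K is strictly below \<open>H0\<close>, so the closed set H \<ge>
    H0, which contains the closed support, misses K.\<close>
  have clos: "closure {z. w z \<noteq> 0} \<inter> K = {}"
  proof -
    have "closed {z::(real^'m) \<times> (real^'n). H0 \<le> hgauge \<alpha> z}"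
      by (intro closed_Collect_le continuous_intros continuous_gauge alpha)
    then have "closure {z. w z \<noteq> 0} \<subseteq> {z. H0 \<le> hgauge \<alpha> z}"
      by (rule closure_minimal[rotated]) (use supp(1) in \<open>force simp: w_def not_less[symmetric]\<close>)
    then show ?thesis using H0(2) by force
  qed
  note cw = C1_fun_continuous[OF w]
  show int1: "integrable lborel (\<lambda>z. \<bar>u z\<bar> powr (p + 1) * (W (hgauge \<alpha> z))\<^sup>2)"
    unfolding w_def[symmetric] by (rule integrable_continuous_bounded_support[where r = r])
      (use p in \<open>auto intro!: continuous_on_mult continuous_on_power continuous_u_powr cw simp: w0\<close>)
  show int2: "integrable lborel (\<lambda>z. dens z * (hgauge \<alpha> z * W' (hgauge \<alpha> z))\<^sup>2)"
    by (rule integrable_continuous_bounded_support[where r = r])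
      (auto intro!: continuous_on_mult continuous_on_power continuous_hardy_weight alpha continuous_u
        continuous_gauge cW' simp: W'0z)
  show int3: "integrable lborel (\<lambda>z. dens z * (W (hgauge \<alpha> z))\<^sup>2)"
    unfolding w_def[symmetric] by (rule integrable_continuous_bounded_support[where r = r])
      (auto intro!: continuous_on_mult continuous_on_power continuous_hardy_weight alpha continuous_u cw simp: w0)
  show int4: "integrable lborel (\<lambda>z. (norm (grushin_grad \<alpha> (\<lambda>z. u z * W (hgauge \<alpha> z)) z))\<^sup>2)"
    unfolding w_def[symmetric] by (rule integrable_continuous_bounded_support[where r = r])
      (auto intro!: continuous_norm_grushin_grad alpha C1_fun_mult C1_u w simp: grushin_grad_outside[of r] w0)
  have int5: "integrable lborel (\<lambda>z. (u z)\<^sup>2 * (norm (grushin_grad \<alpha> w z))\<^sup>2)"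
    by (rule integrable_continuous_bounded_support[where r = r])
      (intro continuous_on_mult continuous_on_power[OF continuous_u] continuous_norm_grushin_grad alpha w,
        simp add: grushin_grad_outside[of r w] w0)
  have le: "(LINT z|lborel. (u z)\<^sup>2 * (norm (grushin_grad \<alpha> w z))\<^sup>2)
      \<le> 4 * (\<alpha> + 1)\<^sup>2 * (LINT z|lborel. dens z * (hgauge \<alpha> z * W' (hgauge \<alpha> z))\<^sup>2)"
  proof -
    have "(u z)\<^sup>2 * (norm (grushin_grad \<alpha> w z))\<^sup>2 \<le> 4 * (\<alpha> + 1)\<^sup>2 * (dens z * (hgauge \<alpha> z * W' (hgauge \<alpha> z))\<^sup>2)" for z
    proof -
      define A H where "A = norm_pow (fst z) (2 * \<alpha>)" and "H = hgauge \<alpha> z"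
      have "A * (H - 1) \<le> A * H" by (intro mult_left_mono) (auto simp: A_def)
      then have "(4 * (\<alpha> + 1)\<^sup>2 * (u z)\<^sup>2 * (W' H)\<^sup>2) * (A * (H - 1)) \<le> (4 * (\<alpha> + 1)\<^sup>2 * (u z)\<^sup>2 * (W' H)\<^sup>2) * (A * H)"
        by (rule mult_left_mono) auto
      moreover have "(u z)\<^sup>2 * (norm (grushin_grad \<alpha> w z))\<^sup>2 = (4 * (\<alpha> + 1)\<^sup>2 * (u z)\<^sup>2 * (W' H)\<^sup>2) * (A * (H - 1))"
        unfolding w_def grushin_grad_comp[OF C1_fun_gauge[OF alpha] W(1)[OF gauge_ge_1]]
        by (simp add: power_mult_distrib norm_grushin_grad_gauge[OF alpha] A_def H_def)
      moreover have "4 * (\<alpha> + 1)\<^sup>2 * (dens z * (H * W' H)\<^sup>2) = (4 * (\<alpha> + 1)\<^sup>2 * (u z)\<^sup>2 * (W' H)\<^sup>2) * (A * H)"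
        using gauge_pos[of \<alpha> z] by (simp add: hardy_weight_def A_def H_def power2_eq_square)
      ultimately have "(u z)\<^sup>2 * (norm (grushin_grad \<alpha> w z))\<^sup>2 \<le> 4 * (\<alpha> + 1)\<^sup>2 * (dens z * (H * W' H)\<^sup>2)"
        by (simp only:)
      then show ?thesis by (simp only: H_def)
    qed
    then show ?thesis
      using integral_le_pointwise[OF int5 integrable_mult_right[OF int2, of "4 * (\<alpha> + 1)\<^sup>2"]] by simp
  qed
  note st = stability_inequalities[of w r, OF w w0 clos]
  show "(p - 1) * (LINT z|lborel. \<bar>u z\<bar> powr (p + 1) * (W (hgauge \<alpha> z))\<^sup>2)
      \<le> 4 * (\<alpha> + 1)\<^sup>2 * (LINT z|lborel. dens z * (hgauge \<alpha> z * W' (hgauge \<alpha> z))\<^sup>2)"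
    using st(1) le unfolding w_def by linarith
  have "p * (LINT z|lborel. (u z)\<^sup>2 * (norm (grushin_grad \<alpha> w z))\<^sup>2)
      \<le> p * (4 * (\<alpha> + 1)\<^sup>2 * (LINT z|lborel. dens z * (hgauge \<alpha> z * W' (hgauge \<alpha> z))\<^sup>2))"
    using le p by (intro mult_left_mono) auto
  then show grad: "(p - 1) * (LINT z|lborel. (norm (grushin_grad \<alpha> (\<lambda>z. u z * W (hgauge \<alpha> z)) z))\<^sup>2)
      \<le> p * (4 * (\<alpha> + 1)\<^sup>2 * (LINT z|lborel. dens z * (hgauge \<alpha> z * W' (hgauge \<alpha> z))\<^sup>2))"
    using st(2) unfolding w_def by linarith
  show "(p - 1) / p * ((Q - 2) / 2)\<^sup>2 * (LINT z|lborel. dens z * (W (hgauge \<alpha> z))\<^sup>2)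
      \<le> 4 * (\<alpha> + 1)\<^sup>2 * (LINT z|lborel. dens z * (hgauge \<alpha> z * W' (hgauge \<alpha> z))\<^sup>2)" if "2 < Q"
  proof -
    have "((Q - 2) / 2)\<^sup>2 * (LINT z|lborel. hardy_weight \<alpha> z * (u z * w z)\<^sup>2)
        \<le> (LINT z|lborel. (norm (grushin_grad \<alpha> (\<lambda>z. u z * w z) z))\<^sup>2)"
      by (rule hardy_inequality[OF alpha _ _ Q that, where r = r]) (auto intro: C1_fun_mult C1_u w simp: w0)
    then have "((Q - 2) / 2)\<^sup>2 * (LINT z|lborel. dens z * (W (hgauge \<alpha> z))\<^sup>2)
        \<le> (LINT z|lborel. (norm (grushin_grad \<alpha> (\<lambda>z. u z * W (hgauge \<alpha> z)) z))\<^sup>2)"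
      by (simp add: w_def power_mult_distrib mult.assoc)
    then have "(p - 1) * (((Q - 2) / 2)\<^sup>2 * (LINT z|lborel. dens z * (W (hgauge \<alpha> z))\<^sup>2))
        \<le> p * (4 * (\<alpha> + 1)\<^sup>2 * (LINT z|lborel. dens z * (hgauge \<alpha> z * W' (hgauge \<alpha> z))\<^sup>2))"
      using p by (intro order_trans[OF mult_left_mono grad]) auto
    then show ?thesis using p by (simp add: pos_divide_le_eq mult_ac)
  qed
qed

section \<open>Growth estimates\<close>

text \<open>The growth exponent of a model solution: if |u| is of order \<rho>^(-2 / (p - 1)) with
  \<rho> = H^(1 / (2 (\<alpha> + 1))), the integrals of |u|^(p + 1) and of \<open>dens\<close> over
  R \<le> H \<le> 2 R are at most of order R^\<theta>.\<close>

definition \<theta> :: real where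
  "\<theta> = (Q - 2 * (p + 1) / (p - 1)) / (2 * (\<alpha> + 1))"

lemma hardy_weight_le_shell:
  assumes "0 < R" "R \<le> hgauge \<alpha> z"
  shows "hardy_weight \<alpha> z \<le> R powr (- 1 / (\<alpha> + 1))"
proof -
  have "hgauge \<alpha> z powr (- 1 / (\<alpha> + 1)) \<le> R powr (- 1 / (\<alpha> + 1))"
    using assms alpha by (intro powr_mono2') auto
  then show ?thesis using hardy_weight_le[OF alpha, of z] by linarith
qed

text \<open>The remainder of \<open>young_cutoff\<close> for a coefficient of order R^(-1 /
  (\<alpha> + 1)). The powers add up by 1 + 2 / (p - 1) = (p + 1) / (p - 1), the quantity that
  \<theta> subtracts from the volume exponent.\<close>

lemma powr_combine:
  assumes "0 < R" "0 \<le> c" "0 < e"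
  shows "(c * R powr (- 1 / (\<alpha> + 1))) * (c * R powr (- 1 / (\<alpha> + 1)) / e) powr (2 / (p - 1))
    = c * (c / e) powr (2 / (p - 1)) * R powr (- ((p + 1) / (p - 1)) / (\<alpha> + 1))"
proof -
  have "(c * R powr (- 1 / (\<alpha> + 1)) / e) powr (2 / (p - 1)) = (c / e * R powr (- 1 / (\<alpha> + 1))) powr (2 / (p - 1))"
    by simp
  also have "\<dots> = (c / e) powr (2 / (p - 1)) * (R powr (- 1 / (\<alpha> + 1))) powr (2 / (p - 1))"
    by (rule powr_mult)
  also have "(R powr (- 1 / (\<alpha> + 1))) powr (2 / (p - 1)) = R powr (- 1 / (\<alpha> + 1) * (2 / (p - 1)))"
    by (rule powr_powr)
  finally have "(c * R powr (- 1 / (\<alpha> + 1))) * (c * R powr (- 1 / (\<alpha> + 1)) / e) powr (2 / (p - 1))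
    = c * (c / e) powr (2 / (p - 1)) * (R powr (- 1 / (\<alpha> + 1)) * R powr (- 1 / (\<alpha> + 1) * (2 / (p - 1))))"
    by simp
  also have "R powr (- 1 / (\<alpha> + 1)) * R powr (- 1 / (\<alpha> + 1) * (2 / (p - 1)))
      = R powr (- 1 / (\<alpha> + 1) + - 1 / (\<alpha> + 1) * (2 / (p - 1)))"
    by (rule powr_add[symmetric])
  also have "- 1 / (\<alpha> + 1) + - 1 / (\<alpha> + 1) * (2 / (p - 1)) = - ((p + 1) / (p - 1)) / (\<alpha> + 1)"
  proof -
    have "1 + 2 / (p - 1) = (p + 1) / (p - 1)" using p by (simp add: field_simps)
    moreover have "- 1 / w + - 1 / w * y = - (1 + y) / w" for w y :: real by (simp add: diff_divide_distrib)
    ultimately show ?thesis by (simp only:)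
  qed
  finally show ?thesis .
qed

lemma volume_theta:
  obtains C where "0 \<le> C" "\<And>R. 1 \<le> R \<Longrightarrow>
    R powr (- ((p + 1) / (p - 1)) / (\<alpha> + 1)) * mass (\<lambda>_. 1) 1 (2 * R) \<le> C * R powr \<theta>"
proof -
  obtain C where C: "0 \<le> C" "\<And>R. 1 \<le> R \<Longrightarrow>
      (LINT z|lborel. indicator (shell \<alpha> 1 R :: ((real^'m) \<times> (real^'n)) set) z) \<le> C * R powr (Q / (2 * (\<alpha> + 1)))"
    using volume_gauge_le[OF alpha Q] by blast
  show thesis
  proof (rule that[of "C * 2 powr (Q / (2 * (\<alpha> + 1)))"])
    fix R :: real assume R: "1 \<le> R"
    have e: "- ((p + 1) / (p - 1)) / (\<alpha> + 1) + Q / (2 * (\<alpha> + 1)) = \<theta>"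
    proof -
      have e: "2 * x / y / (2 * w) = x / y / w" for x y w :: real by simp
      show ?thesis unfolding \<theta>_def diff_divide_distrib e minus_divide_left[symmetric] by simp
    qed
    have "mass (\<lambda>_. 1) 1 (2 * R) \<le> C * (2 * R) powr (Q / (2 * (\<alpha> + 1)))" using C(2)[of "2 * R"] R by simp
    also have "(2 * R) powr (Q / (2 * (\<alpha> + 1))) = 2 powr (Q / (2 * (\<alpha> + 1))) * R powr (Q / (2 * (\<alpha> + 1)))"
      by (rule powr_mult)
    finally have "R powr (- ((p + 1) / (p - 1)) / (\<alpha> + 1)) * mass (\<lambda>_. 1) 1 (2 * R)
        \<le> R powr (- ((p + 1) / (p - 1)) / (\<alpha> + 1)) * (C * (2 powr (Q / (2 * (\<alpha> + 1))) * R powr (Q / (2 * (\<alpha> + 1)))))"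
      by (intro mult_left_mono) auto
    also have "\<dots> = C * 2 powr (Q / (2 * (\<alpha> + 1))) * (R powr (- ((p + 1) / (p - 1)) / (\<alpha> + 1)) * R powr (Q / (2 * (\<alpha> + 1))))"
      by simp
    also have "\<dots> = C * 2 powr (Q / (2 * (\<alpha> + 1))) * R powr \<theta>"
      unfolding powr_add[symmetric] e ..
    finally show "R powr (- ((p + 1) / (p - 1)) / (\<alpha> + 1)) * mass (\<lambda>_. 1) 1 (2 * R) \<le> C * 2 powr (Q / (2 * (\<alpha> + 1))) * R powr \<theta>" .
  qed (use C in auto)
qed

lemma continuous_power: "continuous_on UNIV (\<lambda>z. \<bar>u z\<bar> powr (p + 1))"
  using continuous_u_powr[of "p + 1"] p by simp

lemmas integrable_mass = integrable_shell[OF alpha]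

lemma mass_nonneg: "(\<And>z. 0 \<le> g z) \<Longrightarrow> 0 \<le> mass g a b"
  by (intro Bochner_Integration.integral_nonneg) auto

text \<open>The stability inequality with \<open>(\<chi>\<^sub>R)\<^bsup>k\<^esup>\<close>, \<open>k\<close> so large that the right-hand side is
  absorbed up to a volume term.\<close>

lemma power_growth:
  obtains C where "0 \<le> C" "\<And>R. 2 * H0 \<le> R \<Longrightarrow> mass (\<lambda>z. \<bar>u z\<bar> powr (p + 1)) 1 R \<le> C * (1 + R powr \<theta>)"
proof -
  obtain k :: nat where k: "1 + 2 / (p - 1) \<le> real k" using real_arch_simple by blast
  have "0 < 2 / (p - 1)" using p by simp
  then have k2: "2 \<le> k" using k by linarith
  obtain V where V: "0 \<le> V" "\<And>R. 1 \<le> R \<Longrightarrow>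
      R powr (- ((p + 1) / (p - 1)) / (\<alpha> + 1)) * mass (\<lambda>_. 1) 1 (2 * R) \<le> V * R powr \<theta>"
    using volume_theta by blast
  \<comment> \<open>512 = 4 * 128, and 128 = 2 * 8^2: the bound 8 of \<open>cutoff'_bound\<close>
    squared, with a factor 2 lost in (a + b)^2 \<le> 2 a^2 + 2 b^2. The square of k comes from
    differentiating a k-th power.\<close>
  define c where "c = 512 * (\<alpha> + 1)\<^sup>2 * real k ^ 2"
  \<comment> \<open>Half of the factor p - 1 on the left of the stability inequality, so that the
    first Young term can be absorbed.\<close>
  define e where "e = (p - 1) / 2"
  define D where "D = c * (c / e) powr (2 / (p - 1))"
  define m0 where "m0 = mass dens H0 (2 * H0)"
  have ce: "0 \<le> c" "0 < e" using p by (auto simp: c_def e_def)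
  have D0: "0 \<le> D" using ce by (simp add: D_def)
  have m00: "0 \<le> m0" unfolding m0_def by (rule mass_nonneg) (rule density_nonneg)
  define N where "N = mass (\<lambda>z. \<bar>u z\<bar> powr (p + 1)) 1 (2 * H0)"
  have N0: "0 \<le> N" unfolding N_def by (rule mass_nonneg) simp
  show thesis
  proof (rule that[of "N + 512 * (\<alpha> + 1)\<^sup>2 * m0 / e + D * V / e"])
    show "0 \<le> N + 512 * (\<alpha> + 1)\<^sup>2 * m0 / e + D * V / e" using N0 m00 D0 V ce by simp
    fix R assume R: "2 * H0 \<le> R"
    have R1: "1 \<le> R" "0 < R" "0 < H0" using R H0(1) by auto
    \<comment> \<open>The inner factor keeps the support away from K; only the outer one, whose
      error has to be absorbed, carries the power k.\<close>
    define W where "W t = (1 - cutoff H0 t) * cutoff R t ^ k" for t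
    define W' where "W' t = (1 - cutoff H0 t) * (real k * cutoff R t ^ (k - 1) * cutoff' R t) - cutoff' H0 t * cutoff R t ^ k" for t
    have dW: "(W has_real_derivative W' t) (at t)" for t
      unfolding W_def[abs_def] W'_def
      by (auto intro!: derivative_eq_intros cutoff_has_derivative DERIV_chain2[OF cutoff_has_derivative])
    have cW': "continuous_on {1..} W'"
    proof -
      have "continuous_on S (cutoff q)" for S q
        by (rule DERIV_continuous_on[OF has_field_derivative_at_within[OF cutoff_has_derivative]])
      then show ?thesis unfolding W'_def[abs_def] by (intro continuous_intros continuous_cutoff')
    qed
    have s1: "W t = 0" if "t < H0" for t using cutoff_inside[of H0 t] R1 that by (simp add: W_def)
    have s2: "W t = 0" if "2 * R < t" for t using cutoff_outside[of R t] R1 that k2 by (simp add: W_def)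
    note rad = radial_inequalities[of W W' "2 * R", OF dW cW' s1 s2]
    let ?i1 = "\<lambda>z. indicator (shell \<alpha> H0 (2 * H0)) z :: real" and ?i2 = "\<lambda>z. indicator (shell \<alpha> R (2 * R)) z :: real"
    have pt: "4 * (\<alpha> + 1)\<^sup>2 * (dens z * (hgauge \<alpha> z * W' (hgauge \<alpha> z))\<^sup>2)
        \<le> 512 * (\<alpha> + 1)\<^sup>2 * (?i1 z * dens z)
          + (e * (\<bar>u z\<bar> powr (p + 1) * (W (hgauge \<alpha> z))\<^sup>2)
          + D * R powr (- ((p + 1) / (p - 1)) / (\<alpha> + 1)) * (indicator (shell \<alpha> 1 (2 * R)) z * 1))" for z
    proof -
      define t where "t = hgauge \<alpha> z"
      define x where "x = cutoff R t"
      have x: "0 \<le> x" "x \<le> 1" using cutoff_bounds by (auto simp: x_def)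
      have t1: "1 \<le> t" by (simp add: t_def gauge_ge_1)
      have i1: "?i1 z = indicator {H0..2 * H0} t" and i2: "?i2 z = indicator {R..2 * R} t"
        unfolding indicator_shell t_def by (simp_all add: indicator_def)
      have "t * W' t = (1 - cutoff H0 t) * (real k * x ^ (k - 1)) * (t * cutoff' R t) - t * cutoff' H0 t * x ^ k"
        by (simp add: W'_def x_def algebra_simps)
      then have "\<bar>t * W' t\<bar> \<le> \<bar>1 - cutoff H0 t\<bar> * (real k * x ^ (k - 1)) * \<bar>t * cutoff' R t\<bar> + \<bar>t * cutoff' H0 t\<bar> * x ^ k"
        using x abs_triangle_ineq4[of "(1 - cutoff H0 t) * (real k * x ^ (k - 1)) * (t * cutoff' R t)" "t * cutoff' H0 t * x ^ k"]
        by (simp add: abs_mult)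
      also have "\<dots> \<le> 1 * (real k * x ^ (k - 1)) * (8 * ?i2 z) + (8 * ?i1 z) * 1"
        unfolding i1 i2 using cutoff_bounds[of H0 t] cutoff'_bound[of R t] cutoff'_bound[of H0 t] R1 x
        by (intro add_mono mult_mono) (auto intro: power_le_one)
      finally have "(t * W' t)\<^sup>2 \<le> (1 * (real k * x ^ (k - 1)) * (8 * ?i2 z) + (8 * ?i1 z) * 1)\<^sup>2"
        using power_mono[of "\<bar>t * W' t\<bar>" _ 2] by simp
      also have "\<dots> \<le> 2 * (real k * x ^ (k - 1) * (8 * ?i2 z))\<^sup>2 + 2 * (8 * ?i1 z)\<^sup>2"
        using sum_squares_bound[of "real k * x ^ (k - 1) * (8 * ?i2 z)" "8 * ?i1 z"] by (simp add: power2_sum)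
      also have "\<dots> = 128 * (real k ^ 2 * x ^ (2 * k - 2) * ?i2 z) + 128 * ?i1 z"
      proof -
        have "(x ^ (k - 1))\<^sup>2 = x ^ (2 * k - 2)" 
        proof -
          have "(k - 1) * 2 = 2 * k - 2" by simp
          then show ?thesis by (simp only: power_mult[symmetric])
        qed
        then show ?thesis by (simp add: power_mult_distrib indicator_def)
      qed
      finally have A: "(t * W' t)\<^sup>2 \<le> 128 * (real k ^ 2 * x ^ (2 * k - 2) * ?i2 z) + 128 * ?i1 z" .
      have "4 * (\<alpha> + 1)\<^sup>2 * (dens z * (t * W' t)\<^sup>2)
          \<le> 4 * (\<alpha> + 1)\<^sup>2 * (dens z * (128 * (real k ^ 2 * x ^ (2 * k - 2) * ?i2 z) + 128 * ?i1 z))"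
        using A density_nonneg[of z] by (intro mult_left_mono) auto
      also have "\<dots> = 512 * (\<alpha> + 1)\<^sup>2 * (?i1 z * dens z) + c * (hardy_weight \<alpha> z * ((u z)\<^sup>2 * x ^ (2 * k - 2)) * ?i2 z)"
        by (simp add: c_def algebra_simps)
      finally have B: "4 * (\<alpha> + 1)\<^sup>2 * (dens z * (t * W' t)\<^sup>2)
          \<le> 512 * (\<alpha> + 1)\<^sup>2 * (?i1 z * dens z) + c * (hardy_weight \<alpha> z * ((u z)\<^sup>2 * x ^ (2 * k - 2)) * ?i2 z)" .
      have C: "c * (hardy_weight \<alpha> z * ((u z)\<^sup>2 * x ^ (2 * k - 2)) * ?i2 z)
          \<le> e * (\<bar>u z\<bar> powr (p + 1) * (W t)\<^sup>2) + D * R powr (- ((p + 1) / (p - 1)) / (\<alpha> + 1)) * (indicator (shell \<alpha> 1 (2 * R)) z * 1)"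
      proof (cases "R \<le> t \<and> t \<le> 2 * R")
        case True
        \<comment> \<open>Since 2 H0 \<le> R, the inner factor is already 1 on the outer shell, and
          the square of W is exactly the power of x that \<open>young_cutoff\<close>
          produces.\<close>
        then have "cutoff H0 t = 0" using R R1 by (intro cutoff_outside) auto
        then have Wt: "(W t)\<^sup>2 = x ^ (2 * k)" by (simp add: W_def x_def power_mult[symmetric] mult.commute)
        have "c * (hardy_weight \<alpha> z * ((u z)\<^sup>2 * x ^ (2 * k - 2)))
            \<le> c * (R powr (- 1 / (\<alpha> + 1)) * ((u z)\<^sup>2 * x ^ (2 * k - 2)))"
          using hardy_weight_le_shell[of R z] True R1 ce x by (intro mult_left_mono mult_right_mono) (auto simp: t_def)
        also have "\<dots> = (c * R powr (- 1 / (\<alpha> + 1))) * (\<bar>u z\<bar>\<^sup>2 * x ^ (2 * k - 2))" by simp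
        also have "\<dots> \<le> e * (\<bar>u z\<bar> powr (p + 1) * x ^ (2 * k))
            + (c * R powr (- 1 / (\<alpha> + 1))) * (c * R powr (- 1 / (\<alpha> + 1)) / e) powr (2 / (p - 1))"
          by (rule young_cutoff) (use p x ce k in auto)
        also have "(c * R powr (- 1 / (\<alpha> + 1))) * (c * R powr (- 1 / (\<alpha> + 1)) / e) powr (2 / (p - 1))
            = D * R powr (- ((p + 1) / (p - 1)) / (\<alpha> + 1))"
          unfolding D_def using R1 ce by (intro powr_combine) auto
        finally show ?thesis using True t1 Wt by (simp add: indicator_shell t_def)
      next
        case False
        then have "?i2 z = 0" by (auto simp: indicator_shell t_def)
        then show ?thesis using ce D0 by simp
      qed
      show ?thesis using B C unfolding t_def by linarith
    qed
    define X where "X = (LINT z|lborel. \<bar>u z\<bar> powr (p + 1) * (W (hgauge \<alpha> z))\<^sup>2)"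
    have "(p - 1) * X \<le> (LINT z|lborel. 4 * (\<alpha> + 1)\<^sup>2 * (dens z * (hgauge \<alpha> z * W' (hgauge \<alpha> z))\<^sup>2))"
      using rad(1) unfolding X_def by simp
    also have "\<dots> \<le> (LINT z|lborel. 512 * (\<alpha> + 1)\<^sup>2 * (?i1 z * dens z)
          + (e * (\<bar>u z\<bar> powr (p + 1) * (W (hgauge \<alpha> z))\<^sup>2)
          + D * R powr (- ((p + 1) / (p - 1)) / (\<alpha> + 1)) * (indicator (shell \<alpha> 1 (2 * R)) z * 1)))"
      by (intro integral_le_pointwise[OF _ _ pt] Bochner_Integration.integrable_add integrable_mult_right rad
          integrable_mass continuous_density continuous_on_const)
    also have "\<dots> = 512 * (\<alpha> + 1)\<^sup>2 * m0 + (e * X + D * (R powr (- ((p + 1) / (p - 1)) / (\<alpha> + 1)) * mass (\<lambda>_. 1) 1 (2 * R)))"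
    proof -
      have i1: "integrable lborel (\<lambda>z. 512 * (\<alpha> + 1)\<^sup>2 * (?i1 z * dens z))"
        and i2: "integrable lborel (\<lambda>z. e * (\<bar>u z\<bar> powr (p + 1) * (W (hgauge \<alpha> z))\<^sup>2))"
        by (intro integrable_mult_right rad integrable_mass continuous_density)+
      have i3: "integrable lborel (\<lambda>z::(real^'m) \<times> (real^'n). D * R powr (- ((p + 1) / (p - 1)) / (\<alpha> + 1)) * (indicator (shell \<alpha> 1 (2 * R)) z * 1))"
        by (rule integrable_mult_right, rule integrable_mass, rule continuous_on_const)
      show ?thesis
        unfolding m0_def X_def Bochner_Integration.integral_add[OF i1 Bochner_Integration.integrable_add[OF i2 i3]]
          Bochner_Integration.integral_add[OF i2 i3] Bochner_Integration.integral_mult_right_zero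
        by (simp only: mult.assoc)
    qed
    also have "D * (R powr (- ((p + 1) / (p - 1)) / (\<alpha> + 1)) * mass (\<lambda>_. 1) 1 (2 * R)) \<le> D * (V * R powr \<theta>)"
      using V(2)[OF R1(1)] D0 by (rule mult_left_mono)
    finally have "e * X \<le> 512 * (\<alpha> + 1)\<^sup>2 * m0 + D * V * R powr \<theta>"
      by (simp add: e_def field_simps)
    then have X: "X \<le> 512 * (\<alpha> + 1)\<^sup>2 * m0 / e + D * V / e * R powr \<theta>"
      using ce by (simp add: field_simps)
    have "mass (\<lambda>z. \<bar>u z\<bar> powr (p + 1)) 1 R \<le> (LINT z|lborel. indicator (shell \<alpha> 1 (2 * H0)) z * (\<bar>u z\<bar> powr (p + 1))
        + \<bar>u z\<bar> powr (p + 1) * (W (hgauge \<alpha> z))\<^sup>2)"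
    proof (rule integral_le_pointwise)
      fix z :: "(real^'m) \<times> (real^'n)"
      \<comment> \<open>Between 2 H0 and R both factors are 1; the fixed region H \<le> 2 H0 is paid
        for by the constant N.\<close>
      have "W (hgauge \<alpha> z) = 1" if "2 * H0 < hgauge \<alpha> z" "hgauge \<alpha> z \<le> R"
        using cutoff_outside[of H0 "hgauge \<alpha> z"] cutoff_inside[of R "hgauge \<alpha> z"] that R1 by (simp add: W_def)
      then show "indicator (shell \<alpha> 1 R) z * \<bar>u z\<bar> powr (p + 1) \<le> indicator (shell \<alpha> 1 (2 * H0)) z * \<bar>u z\<bar> powr (p + 1)
          + \<bar>u z\<bar> powr (p + 1) * (W (hgauge \<alpha> z))\<^sup>2"
        by (auto simp: indicator_shell not_le)
    qed (intro integrable_mass continuous_power Bochner_Integration.integrable_add rad)+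
    also have "\<dots> = N + X" unfolding N_def X_def
      by (intro Bochner_Integration.integral_add integrable_mass continuous_power rad)
    finally have "mass (\<lambda>z. \<bar>u z\<bar> powr (p + 1)) 1 R \<le> N + 512 * (\<alpha> + 1)\<^sup>2 * m0 / e + D * V / e * R powr \<theta>"
      using X by linarith
    also have "\<dots> \<le> (N + 512 * (\<alpha> + 1)\<^sup>2 * m0 / e + D * V / e) * (1 + R powr \<theta>)"
    proof -
      have key: "a + b * r \<le> (a + b) * (1 + r)" if "0 \<le> a" "0 \<le> b" "0 \<le> r" for a b r :: real
        using that by (simp add: distrib_left distrib_right)
      show ?thesis by (rule key) (use N0 m00 D0 V ce in simp_all)
    qed
    finally show "mass (\<lambda>z. \<bar>u z\<bar> powr (p + 1)) 1 R \<le> (N + 512 * (\<alpha> + 1)\<^sup>2 * m0 / e + D * V / e) * (1 + R powr \<theta>)" .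
  qed
qed

text \<open>Young's inequality again, now with x = 1 and e = 1: on a shell, \<open>dens\<close> is
  at most |u|^(p + 1), whose growth is known, plus a constant whose integral is a volume
  term.\<close>

lemma density_growth:
  obtains C where "0 \<le> C" "\<And>R. 2 * H0 \<le> R \<Longrightarrow> mass dens R (2 * R) \<le> C * (1 + R powr \<theta>)"
proof -
  obtain k :: nat where k: "1 + 2 / (p - 1) \<le> real k" using real_arch_simple by blast
  obtain V where V: "0 \<le> V" "\<And>R. 1 \<le> R \<Longrightarrow>
      R powr (- ((p + 1) / (p - 1)) / (\<alpha> + 1)) * mass (\<lambda>_. 1) 1 (2 * R) \<le> V * R powr \<theta>"
    using volume_theta by blast
  obtain C where C: "0 \<le> C" "\<And>R. 2 * H0 \<le> R \<Longrightarrow> mass (\<lambda>z. \<bar>u z\<bar> powr (p + 1)) 1 R \<le> C * (1 + R powr \<theta>)"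
    using power_growth by blast
  show thesis
  proof (rule that[of "C * (1 + 2 powr \<theta>) + V"])
    show "0 \<le> C * (1 + 2 powr \<theta>) + V" using C V by simp
    fix R assume R: "2 * H0 \<le> R"
    have R1: "1 \<le> R" "0 < R" using R H0(1) by auto
    have "mass dens R (2 * R) \<le> (LINT z|lborel. indicator (shell \<alpha> 1 (2 * R)) z * \<bar>u z\<bar> powr (p + 1)
        + R powr (- ((p + 1) / (p - 1)) / (\<alpha> + 1)) * (indicator (shell \<alpha> 1 (2 * R)) z * 1))"
    proof (rule integral_le_pointwise)
      fix z :: "(real^'m) \<times> (real^'n)"
      show "indicator (shell \<alpha> R (2 * R)) z * dens z \<le> indicator (shell \<alpha> 1 (2 * R)) z * \<bar>u z\<bar> powr (p + 1)
        + R powr (- ((p + 1) / (p - 1)) / (\<alpha> + 1)) * (indicator (shell \<alpha> 1 (2 * R)) z * 1)"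
      proof (cases "R \<le> hgauge \<alpha> z \<and> hgauge \<alpha> z \<le> 2 * R")
        case True
        have "dens z \<le> R powr (- 1 / (\<alpha> + 1)) * (\<bar>u z\<bar>\<^sup>2 * 1 ^ (2 * k - 2))"
          using hardy_weight_le_shell[of R z] True R1 by (simp add: mult_right_mono)
        also have "\<dots> \<le> 1 * (\<bar>u z\<bar> powr (p + 1) * 1 ^ (2 * k)) + R powr (- 1 / (\<alpha> + 1)) * (R powr (- 1 / (\<alpha> + 1)) / 1) powr (2 / (p - 1))"
          by (rule young_cutoff) (use p k in auto)
        also have "R powr (- 1 / (\<alpha> + 1)) * (R powr (- 1 / (\<alpha> + 1)) / 1) powr (2 / (p - 1)) = R powr (- ((p + 1) / (p - 1)) / (\<alpha> + 1))"
          using powr_combine[of R 1 1] R1 by simp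
        finally show ?thesis using True by (simp add: indicator_shell gauge_ge_1)
      qed (auto simp: indicator_shell)
    qed (intro integrable_mass continuous_power continuous_density Bochner_Integration.integrable_add integrable_mult_right
          continuous_on_const)+
    also have "\<dots> = mass (\<lambda>z. \<bar>u z\<bar> powr (p + 1)) 1 (2 * R) + R powr (- ((p + 1) / (p - 1)) / (\<alpha> + 1)) * mass (\<lambda>_. 1) 1 (2 * R)"
    proof -
      have "integrable lborel (\<lambda>z. indicator (shell \<alpha> 1 (2 * R)) z * \<bar>u z\<bar> powr (p + 1))"
        "integrable lborel (\<lambda>z::(real^'m) \<times> (real^'n). R powr (- ((p + 1) / (p - 1)) / (\<alpha> + 1)) * (indicator (shell \<alpha> 1 (2 * R)) z * 1))"
        by (intro integrable_mass continuous_power integrable_mult_right continuous_on_const)+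
      from Bochner_Integration.integral_add[OF this] show ?thesis
        by (simp only: Bochner_Integration.integral_mult_right_zero)
    qed
    also have "\<dots> \<le> C * (1 + (2 * R) powr \<theta>) + V * R powr \<theta>"
      using C(2)[of "2 * R"] V(2)[OF R1(1)] R R1 by (intro add_mono) auto
    also have "(2 * R) powr \<theta> = 2 powr \<theta> * R powr \<theta>" by (rule powr_mult)
    also have "C * (1 + 2 powr \<theta> * R powr \<theta>) + V * R powr \<theta> \<le> (C * (1 + 2 powr \<theta>) + V) * (1 + R powr \<theta>)"
    proof -
      have "0 \<le> C * 2 powr \<theta>" "0 \<le> C * R powr \<theta>" using C V by auto
      then show ?thesis using C V by (simp add: algebra_simps)
    qed
    finally show "mass dens R (2 * R) \<le> (C * (1 + 2 powr \<theta>) + V) * (1 + R powr \<theta>)" .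
  qed
qed

section \<open>Decay in the supercritical range\<close>

lemma continuous_cutoff: "continuous_on S (cutoff q)"
  by (rule DERIV_continuous_on[OF has_field_derivative_at_within[OF cutoff_has_derivative]])

lemma mass_mono:
  assumes "continuous_on UNIV g" "\<And>z. 0 \<le> g z" "a' \<le> a" "b \<le> b'"
  shows "mass g a b \<le> mass g a' b'"
  by (rule integral_le_pointwise[OF integrable_mass[OF assms(1)] integrable_mass[OF assms(1)]])
    (use assms in \<open>auto simp: indicator_shell\<close>)

text \<open>On the middle range the weight \<open>(M + t)\<^bsup>-b\<^esup>\<close> has logarithmic slope at most \<open>b\<close>, which
  Hardy's constant dominates; the outer cutoff costs \<open>R\<^bsup>\<theta> - 2b\<^esup>\<close>, which vanishes in the limit.\<close>

lemma density_decay: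
  assumes "2 < Q" and b: "0 < b" "\<theta> < 2 * b" "4 * (\<alpha> + 1)\<^sup>2 * b\<^sup>2 < (p - 1) / p * ((Q - 2) / 2)\<^sup>2"
  obtains C where "\<And>M. 2 * H0 \<le> M \<Longrightarrow> mass dens (2 * H0) M \<le> C"
proof -
  \<comment> \<open>The strict gap between Hardy's constant and the cost of slope b; it remains
    after absorption.\<close>
  define \<delta> where "\<delta> = (p - 1) / p * ((Q - 2) / 2)\<^sup>2 - 4 * (\<alpha> + 1)\<^sup>2 * b\<^sup>2"
  have \<delta>: "0 < \<delta>" using b by (simp add: \<delta>_def)
  define c where "c = 4 * (\<alpha> + 1)\<^sup>2 * (16 * b + 128)"
  have c0: "0 \<le> c" using b by (simp add: c_def)
  define m0 where "m0 = mass dens H0 (2 * H0)"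
  obtain G where G: "0 \<le> G" "\<And>R. 2 * H0 \<le> R \<Longrightarrow> mass dens R (2 * R) \<le> G * (1 + R powr \<theta>)"
    using density_growth by blast
  have "mass dens (2 * H0) M \<le> c * m0 / (\<delta> * (2 powr - b)\<^sup>2)" if M: "2 * H0 \<le> M" for M
  proof -
    have M0: "0 < M" "1 \<le> H0" using M H0(1) by auto
    \<comment> \<open>The shift by M makes the weight comparable to M^(-b) on the whole range t
      \<le> M: it lies between (2 M)^(-b) and M^(-b). The factor M^(-2 b) therefore cancels in the
      end and the bound is independent of M.\<close>
    define D where "D t = (M + t) powr (- b)" for t
    define D' where "D' t = - b * (M + t) powr (- b - 1)" for t
    have D0: "0 \<le> D t" for t by (simp add: D_def)
    have dD: "(D has_real_derivative D' t) (at t)" if "1 \<le> t" for t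
      unfolding D_def[abs_def] D'_def using that M0
      by (auto intro!: derivative_eq_intros)
    have tD: "\<bar>t * D' t\<bar> \<le> b * D t" if "1 \<le> t" for t
    proof -
      have "t * D' t = - (b * (t / (M + t)) * D t)"
        using that M0 by (simp add: D'_def D_def powr_diff)
      moreover have "0 \<le> b * (t / (M + t)) * D t" using that M0 b D0[of t] by auto
      moreover have "b * (t / (M + t)) * D t \<le> b * 1 * D t"
        using that M0 b D0[of t] by (intro mult_right_mono mult_left_mono) auto
      ultimately show ?thesis by linarith
    qed
    have step: "\<delta> * ((2 * M) powr - b)\<^sup>2 * mass dens (2 * H0) M
        \<le> c * ((M powr - b)\<^sup>2 * m0) + c * ((R powr - b)\<^sup>2 * (G * (1 + R powr \<theta>)))" if R: "M \<le> R" for R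
    proof -
      have R0: "0 < R" "2 * H0 \<le> R" "1 \<le> R" using R M0 M by auto
      define W where "W t = (1 - cutoff H0 t) * (D t * cutoff R t)" for t
      define W' where "W' t = (1 - cutoff H0 t) * (D t * cutoff' R t + D' t * cutoff R t) - cutoff' H0 t * (D t * cutoff R t)" for t
      have dW: "(W has_real_derivative W' t) (at t)" if "1 \<le> t" for t
      proof -
        have "((\<lambda>t. 1 - cutoff H0 t) has_real_derivative (0 - cutoff' H0 t)) (at t)"
          by (intro DERIV_diff DERIV_const cutoff_has_derivative)
        from DERIV_mult[OF this DERIV_mult[OF dD[OF that] cutoff_has_derivative[of R]]]
        show ?thesis unfolding W_def[abs_def] W'_def by (simp add: algebra_simps)
      qed
      have cW': "continuous_on {1..} W'"
        unfolding W'_def[abs_def] D_def[abs_def] D'_def[abs_def]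
        by (intro continuous_intros continuous_cutoff' continuous_cutoff) (use M0 in auto)
      have s1: "W t = 0" if "t < H0" for t using cutoff_inside[of H0 t] M0 that by (simp add: W_def)
      have s2: "W t = 0" if "2 * R < t" for t using cutoff_outside[of R t] R0 that by (simp add: W_def)
      note rad = radial_inequalities[of W W' "2 * R", OF dW cW' s1 s2]
      let ?i1 = "\<lambda>z. indicator (shell \<alpha> H0 (2 * H0)) z :: real" and ?i2 = "\<lambda>z. indicator (shell \<alpha> R (2 * R)) z :: real"
      define X where "X = (LINT z|lborel. dens z * (W (hgauge \<alpha> z))\<^sup>2)"
      have pt: "4 * (\<alpha> + 1)\<^sup>2 * (dens z * (hgauge \<alpha> z * W' (hgauge \<alpha> z))\<^sup>2)
          \<le> 4 * (\<alpha> + 1)\<^sup>2 * b\<^sup>2 * (dens z * (W (hgauge \<alpha> z))\<^sup>2)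
            + (c * (M powr - b)\<^sup>2 * (?i1 z * dens z) + c * (R powr - b)\<^sup>2 * (?i2 z * dens z))" for z
      proof -
        define t where "t = hgauge \<alpha> z"
        have t1: "1 \<le> t" by (simp add: t_def gauge_ge_1)
        have i1: "?i1 z = indicator {H0..2 * H0} t" and i2: "?i2 z = indicator {R..2 * R} t"
          unfolding indicator_shell t_def by (simp_all add: indicator_def)
        define y where "y = cutoff R t"
        define x where "x = 1 - cutoff H0 t"
        have xy: "0 \<le> x" "x \<le> 1" "0 \<le> y" "y \<le> 1" using cutoff_bounds[of H0 t] cutoff_bounds[of R t] by (auto simp: x_def y_def)
        have W0: "0 \<le> W t" "W t \<le> D t" using xy D0[of t]
          by (auto simp: W_def x_def[symmetric] y_def[symmetric] intro!: mult_left_le_one_le[THEN order_trans] mult_right_le_one_le)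
        have "\<bar>t * W' t\<bar> = \<bar>x * D t * (t * cutoff' R t) + x * y * (t * D' t) - t * cutoff' H0 t * (D t * y)\<bar>"
          by (simp add: W'_def x_def y_def algebra_simps)
        also have "\<dots> \<le> \<bar>x * D t * (t * cutoff' R t)\<bar> + \<bar>x * y * (t * D' t)\<bar> + \<bar>t * cutoff' H0 t * (D t * y)\<bar>"
          by linarith
        also have "\<dots> = x * D t * \<bar>t * cutoff' R t\<bar> + x * y * \<bar>t * D' t\<bar> + \<bar>t * cutoff' H0 t\<bar> * (D t * y)"
          using xy D0[of t] by (simp add: abs_mult)
        also have "\<dots> \<le> 1 * D t * (8 * ?i2 z) + x * y * (b * D t) + (8 * ?i1 z) * (D t * 1)"
          unfolding i1 i2 using xy D0[of t] cutoff'_bound[of R t] cutoff'_bound[of H0 t] R0 M0 tD[OF t1]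
          by (intro add_mono mult_mono mult_nonneg_nonneg) auto
        also have "\<dots> = b * W t + 8 * D t * (?i1 z + ?i2 z)"
          by (simp add: W_def x_def y_def algebra_simps)
        finally have "\<bar>t * W' t\<bar>\<^sup>2 \<le> (b * W t + 8 * D t * (?i1 z + ?i2 z))\<^sup>2" by (intro power_mono) auto
        also have "\<dots> = b\<^sup>2 * (W t)\<^sup>2 + 16 * b * (W t * D t) * (?i1 z + ?i2 z) + 64 * (D t)\<^sup>2 * (?i1 z + ?i2 z)\<^sup>2"
          by (simp add: power2_eq_square algebra_simps)
        also have "\<dots> \<le> b\<^sup>2 * (W t)\<^sup>2 + 16 * b * (D t * D t) * (?i1 z + ?i2 z) + 64 * (D t)\<^sup>2 * (2 * (?i1 z + ?i2 z))"
        proof (intro add_mono mult_left_mono mult_right_mono)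
          \<comment> \<open>The two shells touch when R = 2 H0, so the sum of the indicators can be
            2; this is the factor 2 in 128 = 64 * 2.\<close>
          show "(?i1 z + ?i2 z)\<^sup>2 \<le> 2 * (?i1 z + ?i2 z)" by (simp add: indicator_def)
        qed (use W0 D0[of t] b in \<open>auto simp: indicator_def\<close>)
        also have "\<dots> = b\<^sup>2 * (W t)\<^sup>2 + (16 * b + 128) * ((D t)\<^sup>2 * ?i1 z + (D t)\<^sup>2 * ?i2 z)"
          by (simp add: power2_eq_square algebra_simps)
        also have "\<dots> \<le> b\<^sup>2 * (W t)\<^sup>2 + (16 * b + 128) * ((M powr - b)\<^sup>2 * ?i1 z + (R powr - b)\<^sup>2 * ?i2 z)"
        proof (intro add_left_mono mult_left_mono add_mono)
          have "D t \<le> M powr - b" unfolding D_def using M0 t1 b by (intro powr_mono2') auto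
          then show "(D t)\<^sup>2 * ?i1 z \<le> (M powr - b)\<^sup>2 * ?i1 z" by (intro mult_right_mono power_mono D0) auto
          have "D t \<le> R powr - b" if "R \<le> t" unfolding D_def using M0 R0 that b by (intro powr_mono2') auto
          then show "(D t)\<^sup>2 * ?i2 z \<le> (R powr - b)\<^sup>2 * ?i2 z"
            unfolding i2 by (auto simp: indicator_def intro!: power_mono D0)
        qed (use b in auto)
        finally have "4 * (\<alpha> + 1)\<^sup>2 * dens z * (t * W' t)\<^sup>2
            \<le> 4 * (\<alpha> + 1)\<^sup>2 * dens z * (b\<^sup>2 * (W t)\<^sup>2 + (16 * b + 128) * ((M powr - b)\<^sup>2 * ?i1 z + (R powr - b)\<^sup>2 * ?i2 z))"
          using density_nonneg[of z] by (intro mult_left_mono) auto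
        then show ?thesis unfolding t_def c_def by (simp add: algebra_simps)
      qed
      have "(p - 1) / p * ((Q - 2) / 2)\<^sup>2 * X \<le> (LINT z|lborel. 4 * (\<alpha> + 1)\<^sup>2 * (dens z * (hgauge \<alpha> z * W' (hgauge \<alpha> z))\<^sup>2))"
        using rad(3)[OF _ _ _ assms(1)] unfolding X_def by simp
      also have "\<dots> \<le> (LINT z|lborel. 4 * (\<alpha> + 1)\<^sup>2 * b\<^sup>2 * (dens z * (W (hgauge \<alpha> z))\<^sup>2)
            + (c * (M powr - b)\<^sup>2 * (?i1 z * dens z) + c * (R powr - b)\<^sup>2 * (?i2 z * dens z)))"
        by (intro integral_le_pointwise[OF _ _ pt] Bochner_Integration.integrable_add integrable_mult_right rad
            integrable_mass continuous_density)
      also have "\<dots> = 4 * (\<alpha> + 1)\<^sup>2 * b\<^sup>2 * X + (c * (M powr - b)\<^sup>2 * m0 + c * (R powr - b)\<^sup>2 * mass dens R (2 * R))"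
      proof -
        have i1: "integrable lborel (\<lambda>z. 4 * (\<alpha> + 1)\<^sup>2 * b\<^sup>2 * (dens z * (W (hgauge \<alpha> z))\<^sup>2))"
          by (intro integrable_mult_right rad)
        have i2: "integrable lborel (\<lambda>z. c * (M powr - b)\<^sup>2 * (?i1 z * dens z))"
          and i3: "integrable lborel (\<lambda>z. c * (R powr - b)\<^sup>2 * (?i2 z * dens z))"
          by (intro integrable_mult_right integrable_mass continuous_density)+
        show ?thesis
          unfolding m0_def X_def Bochner_Integration.integral_add[OF i1 Bochner_Integration.integrable_add[OF i2 i3]]
            Bochner_Integration.integral_add[OF i2 i3] Bochner_Integration.integral_mult_right_zero ..
      qed
      finally have "\<delta> * X \<le> c * (M powr - b)\<^sup>2 * m0 + c * (R powr - b)\<^sup>2 * mass dens R (2 * R)"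
        unfolding \<delta>_def left_diff_distrib by linarith
      also have "c * (R powr - b)\<^sup>2 * mass dens R (2 * R) \<le> c * (R powr - b)\<^sup>2 * (G * (1 + R powr \<theta>))"
        using G(2)[OF R0(2)] c0 by (intro mult_left_mono) auto
      finally have 1: "\<delta> * X \<le> c * (M powr - b)\<^sup>2 * m0 + c * (R powr - b)\<^sup>2 * (G * (1 + R powr \<theta>))" by simp
      have "((2 * M) powr - b)\<^sup>2 * mass dens (2 * H0) M = (LINT z|lborel. ((2 * M) powr - b)\<^sup>2 * (indicator (shell \<alpha> (2 * H0) M) z * dens z))"
        by simp
      also have "\<dots> \<le> X" unfolding X_def
      proof (intro integral_le_pointwise integrable_mult_right integrable_mass continuous_density rad)
        fix z :: "(real^'m) \<times> (real^'n)"
        show "((2 * M) powr - b)\<^sup>2 * (indicator (shell \<alpha> (2 * H0) M) z * dens z) \<le> dens z * (W (hgauge \<alpha> z))\<^sup>2"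
        proof (cases "2 * H0 \<le> hgauge \<alpha> z \<and> hgauge \<alpha> z \<le> M")
          case True
          then have "W (hgauge \<alpha> z) = D (hgauge \<alpha> z)"
            using cutoff_outside[of H0 "hgauge \<alpha> z"] cutoff_inside[of R "hgauge \<alpha> z"] R R0 M0 by (simp add: W_def)
          moreover have "(2 * M) powr - b \<le> D (hgauge \<alpha> z)"
            unfolding D_def using True M0 b gauge_pos[of \<alpha> z] by (intro powr_mono2') auto
          ultimately have "((2 * M) powr - b)\<^sup>2 \<le> (W (hgauge \<alpha> z))\<^sup>2" by (intro power_mono) auto
          then have "((2 * M) powr - b)\<^sup>2 * dens z \<le> (W (hgauge \<alpha> z))\<^sup>2 * dens z"
            by (rule mult_right_mono) (rule density_nonneg)
          then show ?thesis using True by (simp add: indicator_shell mult.commute)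
        next
          case False
          then have "indicator (shell \<alpha> (2 * H0) M) z = (0::real)" by (auto simp: indicator_shell)
          then show ?thesis using mult_nonneg_nonneg[OF density_nonneg[of z] zero_le_power2[of "W (hgauge \<alpha> z)"]] by (simp only: mult_zero_left mult_zero_right)
        qed
      qed
      finally have "\<delta> * (((2 * M) powr - b)\<^sup>2 * mass dens (2 * H0) M) \<le> \<delta> * X"
        using \<delta> by (intro mult_left_mono) auto
      with 1 show ?thesis by (simp only: mult.assoc)
    qed
    have "((\<lambda>R. (R powr - b)\<^sup>2 * (G * (1 + R powr \<theta>))) \<longlongrightarrow> G * (0 + 0)) at_top"
    proof -
      have ev: "eventually (\<lambda>R. G * (R powr (- (2 * b)) + R powr (\<theta> - 2 * b)) = (R powr - b)\<^sup>2 * (G * (1 + R powr \<theta>))) at_top"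
        using eventually_gt_at_top[of 0]
      proof (eventually_elim)
        case (elim R)
        have "(R powr - b)\<^sup>2 = R powr (- (2 * b))" by (simp add: power2_eq_square flip: powr_add)
        moreover have "R powr (- (2 * b)) * R powr \<theta> = R powr (\<theta> - 2 * b)" by (simp add: algebra_simps flip: powr_add)
        ultimately show ?case by (simp add: algebra_simps)
      qed
      have "((\<lambda>R. G * (R powr (- (2 * b)) + R powr (\<theta> - 2 * b))) \<longlongrightarrow> G * (0 + 0)) at_top"
        by (intro tendsto_intros tendsto_neg_powr filterlim_ident) (use b in auto)
      then show ?thesis by (rule Lim_transform_eventually[OF _ ev])
    qed
    from tendsto_add[OF tendsto_const tendsto_mult[OF tendsto_const this]]
    have lim: "((\<lambda>R. c * ((M powr - b)\<^sup>2 * m0) + c * ((R powr - b)\<^sup>2 * (G * (1 + R powr \<theta>))))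
        \<longlongrightarrow> c * ((M powr - b)\<^sup>2 * m0) + c * (G * (0 + 0))) at_top" .
    \<comment> \<open>R tends to infinity at fixed M; the outer shell contributes R^(-2 b) +
      R^(\<theta> - 2 b) and disappears.\<close>
    have "\<delta> * ((2 * M) powr - b)\<^sup>2 * mass dens (2 * H0) M \<le> c * ((M powr - b)\<^sup>2 * m0) + c * (G * (0 + 0))"
      by (rule tendsto_lowerbound[OF lim]) (auto intro: eventually_mono[OF eventually_ge_at_top[of M]] step)
    moreover have "((2 * M) powr - b)\<^sup>2 = (2 powr - b)\<^sup>2 * (M powr - b)\<^sup>2"
      by (simp add: powr_mult power_mult_distrib)
    ultimately have "(M powr - b)\<^sup>2 * (\<delta> * (2 powr - b)\<^sup>2 * mass dens (2 * H0) M) \<le> (M powr - b)\<^sup>2 * (c * m0)"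
      by (simp add: mult_ac)
    then have "\<delta> * (2 powr - b)\<^sup>2 * mass dens (2 * H0) M \<le> c * m0"
      using M0 by simp
    then show ?thesis using \<delta> by (simp add: pos_le_divide_eq mult_ac)
  qed
  then show thesis using that by blast
qed

text \<open>A weight with plateau 1 on 2 H0 \<le> H \<le> R has nonzero slope on two shells only,
  where the mass of \<open>dens\<close> is fixed or bounded by hypothesis. The stability
  inequalities then bound both energies uniformly in R.\<close>

lemma finite_energy:
  assumes "\<And>R. 2 * H0 \<le> R \<Longrightarrow> mass dens R (2 * R) \<le> C0"
  obtains C where "\<And>R. 2 * H0 \<le> R \<Longrightarrow> mass (\<lambda>z. \<bar>u z\<bar> powr (p + 1)) 1 R \<le> C"
    "\<And>R. 2 * H0 \<le> R \<Longrightarrow> mass (\<lambda>z. (norm (grushin_grad \<alpha> u z))\<^sup>2) 1 R \<le> C"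
proof -
  define m0 where "m0 = mass dens H0 (2 * H0)"
  define S where "S = 512 * (\<alpha> + 1)\<^sup>2 * (m0 + C0)"
  define N1 where "N1 = mass (\<lambda>z. \<bar>u z\<bar> powr (p + 1)) 1 (2 * H0)"
  define N2 where "N2 = mass (\<lambda>z. (norm (grushin_grad \<alpha> u z))\<^sup>2) 1 (2 * H0)"
  have cg: "continuous_on UNIV (\<lambda>z. (norm (grushin_grad \<alpha> u z))\<^sup>2)"
    by (rule continuous_norm_grushin_grad[OF alpha C1_u(1)])
  have key: "mass (\<lambda>z. \<bar>u z\<bar> powr (p + 1)) 1 R \<le> N1 + S / (p - 1) \<and>
      mass (\<lambda>z. (norm (grushin_grad \<alpha> u z))\<^sup>2) 1 R \<le> N2 + p * S / (p - 1)" if R: "2 * H0 \<le> R" for R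
  proof -
    have R0: "0 < R" "1 \<le> H0" using R H0(1) by auto
    define W where "W t = (1 - cutoff H0 t) * cutoff R t" for t
    define W' where "W' t = (1 - cutoff H0 t) * cutoff' R t - cutoff' H0 t * cutoff R t" for t
    have dW: "(W has_real_derivative W' t) (at t)" for t
    proof -
      have "((\<lambda>t. 1 - cutoff H0 t) has_real_derivative (0 - cutoff' H0 t)) (at t)"
        by (intro DERIV_diff DERIV_const cutoff_has_derivative)
      from DERIV_mult[OF this cutoff_has_derivative[of R]]
      show ?thesis unfolding W_def[abs_def] W'_def by (simp add: algebra_simps)
    qed
    have cW': "continuous_on {1..} W'"
      unfolding W'_def[abs_def] by (intro continuous_intros continuous_cutoff' continuous_cutoff)
    have s1: "W t = 0" if "t < H0" for t using cutoff_inside[of H0 t] R0 that by (simp add: W_def)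
    have s2: "W t = 0" if "2 * R < t" for t using cutoff_outside[of R t] R0 that by (simp add: W_def)
    note rad = radial_inequalities[of W W' "2 * R", OF dW cW' s1 s2]
    let ?i1 = "\<lambda>z. indicator (shell \<alpha> H0 (2 * H0)) z :: real" and ?i2 = "\<lambda>z. indicator (shell \<alpha> R (2 * R)) z :: real"
    have mid: "W t = 1" "W' t = 0" if "2 * H0 \<le> t" "t \<le> R" for t
      using cutoff_outside[of H0 t] cutoff_inside[of R t] that R0 by (simp_all add: W_def W'_def)
    have pt: "4 * (\<alpha> + 1)\<^sup>2 * (dens z * (hgauge \<alpha> z * W' (hgauge \<alpha> z))\<^sup>2)
        \<le> 512 * (\<alpha> + 1)\<^sup>2 * (?i1 z * dens z + ?i2 z * dens z)" for z
    proof -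
      define t where "t = hgauge \<alpha> z"
      have i1: "?i1 z = indicator {H0..2 * H0} t" and i2: "?i2 z = indicator {R..2 * R} t"
        unfolding indicator_shell t_def by (simp_all add: indicator_def)
      define y where "y = cutoff R t"
      define x where "x = 1 - cutoff H0 t"
      have xy: "0 \<le> x" "x \<le> 1" "0 \<le> y" "y \<le> 1" using cutoff_bounds[of H0 t] cutoff_bounds[of R t] by (auto simp: x_def y_def)
      have "\<bar>t * W' t\<bar> = \<bar>x * (t * cutoff' R t) - t * cutoff' H0 t * y\<bar>"
        by (simp add: W'_def x_def y_def algebra_simps)
      also have "\<dots> \<le> \<bar>x * (t * cutoff' R t)\<bar> + \<bar>t * cutoff' H0 t * y\<bar>" by linarith
      also have "\<dots> = x * \<bar>t * cutoff' R t\<bar> + \<bar>t * cutoff' H0 t\<bar> * y"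
        using xy by (simp add: abs_mult)
      also have "\<dots> \<le> 1 * (8 * ?i2 z) + (8 * ?i1 z) * 1"
        unfolding i1 i2 using xy cutoff'_bound[of R t] cutoff'_bound[of H0 t] R0
        by (intro add_mono mult_mono) auto
      finally have "\<bar>t * W' t\<bar>\<^sup>2 \<le> (1 * (8 * ?i2 z) + (8 * ?i1 z) * 1)\<^sup>2" by (intro power_mono) auto
      also have "\<dots> \<le> 128 * (?i1 z + ?i2 z)" by (simp add: indicator_def)
      finally have "4 * (\<alpha> + 1)\<^sup>2 * dens z * (t * W' t)\<^sup>2 \<le> 4 * (\<alpha> + 1)\<^sup>2 * dens z * (128 * (?i1 z + ?i2 z))"
        using density_nonneg[of z] by (intro mult_left_mono) auto
      then show ?thesis unfolding t_def by (simp add: algebra_simps)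
    qed
    have "(LINT z|lborel. 4 * (\<alpha> + 1)\<^sup>2 * (dens z * (hgauge \<alpha> z * W' (hgauge \<alpha> z))\<^sup>2))
        \<le> (LINT z|lborel. 512 * (\<alpha> + 1)\<^sup>2 * (?i1 z * dens z + ?i2 z * dens z))"
      by (intro integral_le_pointwise[OF _ _ pt] Bochner_Integration.integrable_add integrable_mult_right rad
          integrable_mass continuous_density)
    also have "\<dots> = 512 * (\<alpha> + 1)\<^sup>2 * (m0 + mass dens R (2 * R))"
      unfolding m0_def Bochner_Integration.integral_mult_right_zero
        Bochner_Integration.integral_add[OF integrable_mass[OF continuous_density] integrable_mass[OF continuous_density]] ..
    also have "\<dots> \<le> S" unfolding S_def using assms[OF R] by (intro mult_left_mono add_left_mono) auto
    finally have S: "4 * (\<alpha> + 1)\<^sup>2 * (LINT z|lborel. dens z * (hgauge \<alpha> z * W' (hgauge \<alpha> z))\<^sup>2) \<le> S"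
      by simp
    have "(p - 1) * (LINT z|lborel. \<bar>u z\<bar> powr (p + 1) * (W (hgauge \<alpha> z))\<^sup>2) \<le> S"
      using rad(1) S by linarith
    then have X1: "(LINT z|lborel. \<bar>u z\<bar> powr (p + 1) * (W (hgauge \<alpha> z))\<^sup>2) \<le> S / (p - 1)"
      using p by (simp add: pos_le_divide_eq mult.commute)
    have "p * (4 * (\<alpha> + 1)\<^sup>2 * (LINT z|lborel. dens z * (hgauge \<alpha> z * W' (hgauge \<alpha> z))\<^sup>2)) \<le> p * S"
      using S p by (intro mult_left_mono) auto
    then have "(p - 1) * (LINT z|lborel. (norm (grushin_grad \<alpha> (\<lambda>z. u z * W (hgauge \<alpha> z)) z))\<^sup>2) \<le> p * S"
      using rad(2) by linarith
    then have X2: "(LINT z|lborel. (norm (grushin_grad \<alpha> (\<lambda>z. u z * W (hgauge \<alpha> z)) z))\<^sup>2) \<le> p * S / (p - 1)"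
      using p by (simp add: pos_le_divide_eq mult.commute)
    have "mass (\<lambda>z. \<bar>u z\<bar> powr (p + 1)) 1 R \<le> (LINT z|lborel. indicator (shell \<alpha> 1 (2 * H0)) z * (\<bar>u z\<bar> powr (p + 1))
        + \<bar>u z\<bar> powr (p + 1) * (W (hgauge \<alpha> z))\<^sup>2)"
    proof (rule integral_le_pointwise)
      fix z :: "(real^'m) \<times> (real^'n)"
      show "indicator (shell \<alpha> 1 R) z * \<bar>u z\<bar> powr (p + 1) \<le> indicator (shell \<alpha> 1 (2 * H0)) z * \<bar>u z\<bar> powr (p + 1)
          + \<bar>u z\<bar> powr (p + 1) * (W (hgauge \<alpha> z))\<^sup>2"
        using mid(1)[of "hgauge \<alpha> z"] by (auto simp: indicator_shell not_le)
    qed (intro integrable_mass continuous_power Bochner_Integration.integrable_add rad)+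
    also have "\<dots> = N1 + (LINT z|lborel. \<bar>u z\<bar> powr (p + 1) * (W (hgauge \<alpha> z))\<^sup>2)" unfolding N1_def
      by (intro Bochner_Integration.integral_add integrable_mass continuous_power rad)
    finally have 1: "mass (\<lambda>z. \<bar>u z\<bar> powr (p + 1)) 1 R \<le> N1 + S / (p - 1)" using X1 by linarith
    have "mass (\<lambda>z. (norm (grushin_grad \<alpha> u z))\<^sup>2) 1 R
      \<le> (LINT z|lborel. indicator (shell \<alpha> 1 (2 * H0)) z * (norm (grushin_grad \<alpha> u z))\<^sup>2
        + (norm (grushin_grad \<alpha> (\<lambda>z. u z * W (hgauge \<alpha> z)) z))\<^sup>2)"
    proof (rule integral_le_pointwise)
      fix z :: "(real^'m) \<times> (real^'n)"
      \<comment> \<open>W = 1 and W' = 0 hold on the closed plateau, so the product rule returns the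
        gradient of u even at the ends.\<close>
      have "grushin_grad \<alpha> (\<lambda>z. u z * W (hgauge \<alpha> z)) z = grushin_grad \<alpha> u z" if "2 * H0 \<le> hgauge \<alpha> z" "hgauge \<alpha> z \<le> R"
      proof -
        have "C1_fun (\<lambda>z::(real^'m) \<times> (real^'n). W (hgauge \<alpha> z))"
          by (rule C1_fun_comp[OF C1_fun_gauge[OF alpha] dW])
            (rule continuous_on_compose2[OF cW' continuous_gauge[OF alpha]], auto simp: gauge_ge_1)
        from grushin_grad_mult[OF C1_u(1) this] show ?thesis
          using mid[OF that] by (simp add: grushin_grad_comp[OF C1_fun_gauge[OF alpha] dW])
      qed
      then show "indicator (shell \<alpha> 1 R) z * (norm (grushin_grad \<alpha> u z))\<^sup>2
          \<le> indicator (shell \<alpha> 1 (2 * H0)) z * (norm (grushin_grad \<alpha> u z))\<^sup>2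
            + (norm (grushin_grad \<alpha> (\<lambda>z. u z * W (hgauge \<alpha> z)) z))\<^sup>2"
        by (auto simp: indicator_shell not_le)
    qed (intro integrable_mass cg Bochner_Integration.integrable_add rad)+
    also have "\<dots> = N2 + (LINT z|lborel. (norm (grushin_grad \<alpha> (\<lambda>z. u z * W (hgauge \<alpha> z)) z))\<^sup>2)" unfolding N2_def
      by (intro Bochner_Integration.integral_add integrable_mass cg rad)
    finally have "mass (\<lambda>z. (norm (grushin_grad \<alpha> u z))\<^sup>2) 1 R \<le> N2 + p * S / (p - 1)" using X2 by linarith
    with 1 show ?thesis by simp
  qed
  show thesis
    by (rule that[of "max (N1 + S / (p - 1)) (N2 + p * S / (p - 1))"]) (use key in \<open>auto simp: le_max_iff_disj\<close>)
qed

end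

section \<open>The Pohozaev identity\<close>

text \<open>Ratio 4 makes the shells disjoint (2 * 4^k < 4^(k + 1)). Each integral is then at most
  an increment of the bounded increasing sequence a, and such increments tend to 0.\<close>

lemma shells_vanish:
  fixes g :: "(real^'m) \<times> (real^'n) \<Rightarrow> real"
  assumes "0 \<le> \<alpha>" and g: "continuous_on UNIV g" "\<And>z. 0 \<le> g z"
    and bound: "\<And>R. R0 \<le> R \<Longrightarrow> (LINT z|lborel. indicator (shell \<alpha> 1 R) z * g z) \<le> C"
  shows "(\<lambda>k. LINT z|lborel. indicator (shell \<alpha> (4 ^ Suc k) (2 * 4 ^ Suc k)) z * g z) \<longlonglongrightarrow> 0"
proof -
  note int = integrable_shell[OF assms(1) g(1)]
  define a where "a k = (LINT z|lborel. indicator (shell \<alpha> 1 (2 * 4 ^ k)) z * g z)" for k :: nat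
  have step: "(LINT z|lborel. indicator (shell \<alpha> (4 ^ Suc k) (2 * 4 ^ Suc k)) z * g z) \<le> a (Suc k) - a k" for k
  proof -
    define q :: real where "q = 4 ^ k"
    have q: "1 \<le> q" "4 ^ Suc k = 4 * q" by (simp_all add: q_def)
    have "(LINT z|lborel. indicator (shell \<alpha> (4 * q) (2 * (4 * q))) z * g z + indicator (shell \<alpha> 1 (2 * q)) z * g z)
        \<le> (LINT z|lborel. indicator (shell \<alpha> 1 (2 * (4 * q))) z * g z)"
      by (intro integral_le_pointwise Bochner_Integration.integrable_add int)
        (use g(2) q(1) in \<open>auto simp: indicator_shell gauge_ge_1\<close>)
    then have "(LINT z|lborel. indicator (shell \<alpha> (4 ^ Suc k) (2 * 4 ^ Suc k)) z * g z + indicator (shell \<alpha> 1 (2 * 4 ^ k)) z * g z)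
        \<le> (LINT z|lborel. indicator (shell \<alpha> 1 (2 * 4 ^ Suc k)) z * g z)"
      unfolding q(2) by (simp only: q_def)
    then show ?thesis by (simp add: a_def Bochner_Integration.integral_add[OF int int])
  qed
  have nn: "0 \<le> (LINT z|lborel. indicator (shell \<alpha> x y) z * g z)" for x y
    by (intro Bochner_Integration.integral_nonneg) (simp add: g)
  have "incseq a"
  proof (rule incseq_SucI)
    show "a k \<le> a (Suc k)" for k
      using order_trans[OF nn step, of k] by simp
  qed
  moreover have "a k \<le> C" for k
  proof -
    have "a k \<le> (LINT z|lborel. indicator (shell \<alpha> 1 (max R0 (2 * 4 ^ k))) z * g z)"
      unfolding a_def by (intro integral_le_pointwise int) (use g(2) in \<open>auto simp: indicator_shell\<close>)
    also have "\<dots> \<le> C" by (rule bound) simp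
    finally show ?thesis .
  qed
  ultimately obtain L where L: "a \<longlonglongrightarrow> L" using incseq_convergent[of a C] by blast
  have "(\<lambda>k. a (Suc k) - a k) \<longlonglongrightarrow> L - L" by (intro tendsto_diff LIMSEQ_Suc L)
  then have "(\<lambda>k. a (Suc k) - a k) \<longlonglongrightarrow> 0" by simp
  then show ?thesis
    by (rule tendsto_sandwich[OF always_eventually[OF allI[OF nn]] always_eventually[OF allI[OF step]] tendsto_const])
qed

context grushin_stable
begin

abbreviation grad2 :: "(real^'m) \<times> (real^'n) \<Rightarrow> real" where
  "grad2 z \<equiv> (norm (grushin_grad \<alpha> u z))\<^sup>2"

abbreviation Zu :: "(real^'m) \<times> (real^'n) \<Rightarrow> real" where
  "Zu \<equiv> dil_deriv \<alpha> u"

lemma continuous_grad2: "continuous_on UNIV grad2"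
  by (rule continuous_norm_grushin_grad[OF alpha C1_u(1)])

definition primitive :: "(real^'m) \<times> (real^'n) \<Rightarrow> real" where
  "primitive z = \<bar>u z\<bar> powr (p + 1) / (p + 1)"

lemma primitive_derivative:
  "((\<lambda>t. \<bar>t\<bar> powr (p + 1) / (p + 1)) has_real_derivative \<bar>t\<bar> powr (p - 1) * t) (at t)"
proof -
  have "((\<lambda>t. \<bar>t\<bar> powr (p + 1)) has_derivative (\<lambda>v. (p + 1) * \<bar>t\<bar> powr (p + 1 - 2) * (t * v))) (at t)"
    using has_derivative_norm_powr[of "p + 1" t] p by simp
  moreover have "(\<lambda>v. (p + 1) * \<bar>t\<bar> powr (p + 1 - 2) * (t * v)) = (*) ((p + 1) * (\<bar>t\<bar> powr (p - 1) * t))"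
    by (rule ext) simp
  ultimately have "((\<lambda>t. \<bar>t\<bar> powr (p + 1)) has_real_derivative (p + 1) * (\<bar>t\<bar> powr (p - 1) * t)) (at t)"
    by (simp add: has_field_derivative_def)
  from DERIV_cdivide[OF this, of "p + 1"] show ?thesis using p by simp
qed

lemma continuous_nonlinearity: "continuous_on UNIV (\<lambda>z. \<bar>u z\<bar> powr (p - 1) * u z)"
  by (intro continuous_on_mult continuous_u continuous_u_powr) (use p in auto)

lemma C1_primitive: "C1_fun primitive"
  unfolding primitive_def[abs_def]
  by (rule C1_fun_comp[OF C1_u(1) primitive_derivative continuous_nonlinearity])

lemma dil_deriv_primitive: "dil_deriv \<alpha> primitive z = \<bar>u z\<bar> powr (p - 1) * u z * Zu z"
  unfolding primitive_def[abs_def] by (rule dil_deriv_comp[OF C1_u(1) primitive_derivative])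

text \<open>Testing the equation with \<open>\<eta> Zu\<close>, where \<open>Z\<close> generates the dilations.\<close>

lemma pohozaev_identity:
  assumes eta: "C1_fun \<eta>" "\<And>z. r < norm z \<Longrightarrow> \<eta> z = 0"
  shows "(LINT z|lborel. \<eta> z * ((1 - Q / 2) * grad2 z + Q * primitive z)
      + (Zu z * (grushin_grad \<alpha> u z \<bullet> grushin_grad \<alpha> \<eta> z) + (primitive z - grad2 z / 2) * dil_deriv \<alpha> \<eta> z)) = 0"
    and "integrable lborel (\<lambda>z. \<eta> z * ((1 - Q / 2) * grad2 z + Q * primitive z)
      + (Zu z * (grushin_grad \<alpha> u z \<bullet> grushin_grad \<alpha> \<eta> z) + (primitive z - grad2 z / 2) * dil_deriv \<alpha> \<eta> z))"
proof -
  define A where "A z = norm_pow (fst z) (2 * \<alpha>)" for z :: "(real^'m) \<times> (real^'n)"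
  \<comment> \<open>The x and y parts of the energy are kept apart: their weights have homogeneity 0
    and 2 \<alpha>, and the commutator with the dilation field scales them differently.\<close>
  define X where "X z = (\<Sum>i\<in>UNIV. dx i u z * dx i u z)" for z
  define Y where "Y z = (\<Sum>j\<in>UNIV. dy j u z * dy j u z)" for z
  define f where "f z = \<bar>u z\<bar> powr (p - 1) * u z" for z
  have C1_Zu: "C1_fun Zu" by (rule C1_fun_dil_deriv[OF C2_u])
  have C1_X: "C1_fun X" unfolding X_def[abs_def] by (intro C1_fun_sum C1_fun_mult C1_u)
  have C1_Y: "C1_fun Y" unfolding Y_def[abs_def] by (intro C1_fun_sum C1_fun_mult C1_u)
  have cA: "continuous_on UNIV A"
    unfolding A_def by (intro continuous_norm_pow continuous_intros) (use alpha in auto)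
  have eta0: "grushin_grad \<alpha> \<eta> z = 0" "dil_deriv \<alpha> \<eta> z = 0" if "r < norm z" for z
    using that by (simp_all add: grushin_grad_outside[of r \<eta>] eta dil_deriv_def dir_deriv_outside[of r \<eta>])
  have grad2: "grad2 z = X z + (\<alpha> + 1)\<^sup>2 * A z * Y z" for z
    unfolding power2_norm_eq_inner grushin_grad_inner X_def Y_def A_def ..
  have dXZ: "dil_deriv \<alpha> X z = 2 * (\<Sum>i\<in>UNIV. dx i u z * dil_deriv \<alpha> (dx i u) z)" for z
  proof -
    have "C1_fun (\<lambda>z. dx i u z * dx i u z)" for i by (intro C1_fun_mult C1_u)
    then show ?thesis unfolding X_def[abs_def]
      by (simp add: dil_deriv_sum dil_deriv_mult C1_u sum_distrib_left mult_ac)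
  qed
  have dYZ: "dil_deriv \<alpha> Y z = 2 * (\<Sum>j\<in>UNIV. dy j u z * dil_deriv \<alpha> (dy j u) z)" for z
  proof -
    have "C1_fun (\<lambda>z. dy i u z * dy i u z)" for i by (intro C1_fun_mult C1_u)
    then show ?thesis unfolding Y_def[abs_def]
      by (simp add: dil_deriv_sum dil_deriv_mult C1_u sum_distrib_left mult_ac)
  qed
  have dxZu: "dx i Zu z = dil_deriv \<alpha> (dx i u) z + dx i u z" for i z
    by (simp add: dir_deriv_dil_deriv[OF C2_u])
  have dyZu: "dy j Zu z = dil_deriv \<alpha> (dy j u) z + (\<alpha> + 1) * dy j u z" for j z
    using linear_scale[OF dir_deriv_linear[OF C1_u(1)], of "\<alpha> + 1" "(0, axis j 1)" z]
    by (simp add: dir_deriv_dil_deriv[OF C2_u])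
  have uZu: "grushin_grad \<alpha> u z \<bullet> grushin_grad \<alpha> Zu z
      = dil_deriv \<alpha> X z / 2 + X z + (\<alpha> + 1)\<^sup>2 * A z * (dil_deriv \<alpha> Y z / 2 + (\<alpha> + 1) * Y z)" for z
  proof -
    have x: "(\<Sum>i\<in>UNIV. dx i u z * dx i Zu z) = dil_deriv \<alpha> X z / 2 + X z"
      unfolding dxZu dXZ by (simp add: X_def sum.distrib distrib_left)
    have y: "(\<Sum>j\<in>UNIV. dy j u z * dy j Zu z) = dil_deriv \<alpha> Y z / 2 + (\<alpha> + 1) * Y z"
      unfolding dyZu dYZ Y_def by (simp add: sum.distrib distrib_left[of "dy _ _ _"] sum_distrib_left mult_ac)
    show ?thesis unfolding grushin_grad_inner x y A_def ..
  qed

  \<comment> \<open>Four expressions with integral 0: \<open>E1\<close> by Green's formula and the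
    equation, the others as dilation divergences of the primitive, of X and of A Y, each times
    \<eta>.\<close>
  define E1 where "E1 z = grushin_grad \<alpha> u z \<bullet> grushin_grad \<alpha> (\<lambda>z. Zu z * \<eta> z) z - Zu z * \<eta> z * f z" for z
  define E2 where "E2 z = dil_deriv \<alpha> (\<lambda>z. primitive z * \<eta> z) z + Q * (primitive z * \<eta> z)" for z
  define E3 where "E3 z = dil_deriv \<alpha> (\<lambda>z. X z * \<eta> z) z + Q * (X z * \<eta> z)" for z
  define E4 where "E4 z = A z * dil_deriv \<alpha> (\<lambda>z. Y z * \<eta> z) z + (Q + 2 * \<alpha>) * (A z * (Y z * \<eta> z))" for z
  note C1_Zeta = C1_fun_mult[OF C1_Zu eta(1)]
  have E1: "integrable lborel E1" "integral\<^sup>L lborel E1 = 0"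
  proof -
    have i1: "integrable lborel (\<lambda>z. grushin_grad \<alpha> u z \<bullet> grushin_grad \<alpha> (\<lambda>z. Zu z * \<eta> z) z)"
      by (rule integrable_continuous_bounded_support[where r = r],
          rule continuous_grushin_grad_inner[OF alpha C1_u(1) C1_Zeta])
        (simp add: grushin_grad_outside[of r "\<lambda>z. Zu z * \<eta> z"] eta)
    have i2: "integrable lborel (\<lambda>z. Zu z * \<eta> z * f z)"
      unfolding f_def by (rule integrable_continuous_bounded_support[where r = r],
          intro continuous_on_mult[OF C1_fun_continuous[OF C1_Zeta] continuous_nonlinearity]) (simp add: eta)
    show "integrable lborel E1" unfolding E1_def[abs_def] using i1 i2 by (rule Bochner_Integration.integrable_diff)
    have "(LINT z|lborel. grushin_grad \<alpha> u z \<bullet> grushin_grad \<alpha> (\<lambda>z. Zu z * \<eta> z) z)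
        = - (LINT z|lborel. Zu z * \<eta> z * grushin_laplacian \<alpha> u z)"
      by (rule grushin_green[OF C2_u C1_Zeta _ alpha, where r = r]) (simp add: eta)
    also have "\<dots> = (LINT z|lborel. Zu z * \<eta> z * f z)" by (simp add: laplacian_u f_def)
    finally show "integral\<^sup>L lborel E1 = 0"
      unfolding E1_def[abs_def] Bochner_Integration.integral_diff[OF i1 i2] by simp
  qed
  have dil: "integrable lborel (\<lambda>z. norm_pow (fst z) b * dil_deriv \<alpha> (\<lambda>z. h z * \<eta> z) z + (Q + b) * (norm_pow (fst z) b * (h z * \<eta> z)))"
      "(LINT z|lborel. norm_pow (fst z) b * dil_deriv \<alpha> (\<lambda>z. h z * \<eta> z) z + (Q + b) * (norm_pow (fst z) b * (h z * \<eta> z))) = 0"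
    if h: "C1_fun h" and b: "0 \<le> b" for h b
  proof -
    note C1 = C1_fun_mult[OF h eta(1)]
    have s: "r < norm z \<Longrightarrow> h z * \<eta> z = 0" for z by (simp add: eta)
    have c: "continuous_on UNIV (\<lambda>z::(real^'m) \<times> (real^'n). norm_pow (fst z) b)"
      by (intro continuous_norm_pow continuous_intros b)
    have i1: "integrable lborel (\<lambda>z. norm_pow (fst z) b * dil_deriv \<alpha> (\<lambda>z. h z * \<eta> z) z)"
      by (rule integrable_continuous_bounded_support[where r = r],
          rule continuous_on_mult[OF c continuous_dil_deriv[OF C1]])
        (simp add: dil_deriv_def dir_deriv_outside[of r "\<lambda>z. h z * \<eta> z", OF s])
    have i2: "integrable lborel (\<lambda>z. norm_pow (fst z) b * (h z * \<eta> z))"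
      by (rule integrable_continuous_bounded_support[where r = r],
          rule continuous_on_mult[OF c C1_fun_continuous[OF C1]]) (simp add: eta)
    show "integrable lborel (\<lambda>z. norm_pow (fst z) b * dil_deriv \<alpha> (\<lambda>z. h z * \<eta> z) z + (Q + b) * (norm_pow (fst z) b * (h z * \<eta> z)))"
      by (intro Bochner_Integration.integrable_add i1 integrable_mult_right i2)
    have e: "(LINT z|lborel. norm_pow (fst z) b * dil_deriv \<alpha> (\<lambda>z. h z * \<eta> z) z) = - (Q + b) * (LINT z|lborel. norm_pow (fst z) b * (h z * \<eta> z))"
      by (rule integral_dil_deriv[where r = r, OF C1 _ Q alpha b]) (rule s)
    show "(LINT z|lborel. norm_pow (fst z) b * dil_deriv \<alpha> (\<lambda>z. h z * \<eta> z) z + (Q + b) * (norm_pow (fst z) b * (h z * \<eta> z))) = 0"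
      unfolding Bochner_Integration.integral_add[OF i1 integrable_mult_right[OF i2]] Bochner_Integration.integral_mult_right_zero
        e by (simp add: algebra_simps)
  qed
  have E2: "integrable lborel E2" "integral\<^sup>L lborel E2 = 0"
    using dil[OF C1_primitive, of 0] by (simp_all add: E2_def[abs_def] norm_pow_def)
  have E3: "integrable lborel E3" "integral\<^sup>L lborel E3 = 0"
    using dil[OF C1_X, of 0] by (simp_all add: E3_def[abs_def] norm_pow_def)
  have E4: "integrable lborel E4" "integral\<^sup>L lborel E4 = 0"
    using dil[OF C1_Y, of "2 * \<alpha>"] alpha by (simp_all add: E4_def[abs_def] A_def)
  \<comment> \<open>This combination cancels the second derivatives of u and the terms with f times
    \<open>Zu\<close>. X and (\<alpha> + 1)^2 A Y end up with the same coefficient 1 - Q/2, the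
    latter through \<alpha> + 1 - (Q + 2 \<alpha>)/2.\<close>
  have pt: "\<eta> z * ((1 - Q / 2) * grad2 z + Q * primitive z)
      + (Zu z * (grushin_grad \<alpha> u z \<bullet> grushin_grad \<alpha> \<eta> z) + (primitive z - grad2 z / 2) * dil_deriv \<alpha> \<eta> z)
      = E1 z + E2 z - (E3 z / 2 + (\<alpha> + 1)\<^sup>2 / 2 * E4 z)" for z
  proof -
    have e1: "E1 z = Zu z * (grushin_grad \<alpha> u z \<bullet> grushin_grad \<alpha> \<eta> z)
        + \<eta> z * (grushin_grad \<alpha> u z \<bullet> grushin_grad \<alpha> Zu z) - Zu z * \<eta> z * f z"
      unfolding E1_def grushin_grad_mult[OF C1_Zu eta(1)] by (simp add: inner_add_right)
    have e2: "E2 z = primitive z * dil_deriv \<alpha> \<eta> z + f z * Zu z * \<eta> z + Q * (primitive z * \<eta> z)"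
      unfolding E2_def dil_deriv_mult[OF C1_primitive eta(1)] dil_deriv_primitive f_def ..
    have e3: "E3 z = X z * dil_deriv \<alpha> \<eta> z + dil_deriv \<alpha> X z * \<eta> z + Q * (X z * \<eta> z)"
      unfolding E3_def dil_deriv_mult[OF C1_X eta(1)] ..
    have e4: "E4 z = A z * (Y z * dil_deriv \<alpha> \<eta> z + dil_deriv \<alpha> Y z * \<eta> z) + (Q + 2 * \<alpha>) * (A z * (Y z * \<eta> z))"
      unfolding E4_def dil_deriv_mult[OF C1_Y eta(1)] ..
    show ?thesis unfolding e1 e2 e3 e4 uZu grad2 by (simp add: field_simps)
  qed
  note i34 = Bochner_Integration.integrable_add[OF integrable_divide[OF E3(1), of 2] integrable_mult_right[OF E4(1), of "(\<alpha> + 1)\<^sup>2 / 2"]]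
  note i12 = Bochner_Integration.integrable_add[OF E1(1) E2(1)]
  show "integrable lborel (\<lambda>z. \<eta> z * ((1 - Q / 2) * grad2 z + Q * primitive z)
      + (Zu z * (grushin_grad \<alpha> u z \<bullet> grushin_grad \<alpha> \<eta> z) + (primitive z - grad2 z / 2) * dil_deriv \<alpha> \<eta> z))"
    unfolding pt by (rule Bochner_Integration.integrable_diff[OF i12 i34])
  show "(LINT z|lborel. \<eta> z * ((1 - Q / 2) * grad2 z + Q * primitive z)
      + (Zu z * (grushin_grad \<alpha> u z \<bullet> grushin_grad \<alpha> \<eta> z) + (primitive z - grad2 z / 2) * dil_deriv \<alpha> \<eta> z)) = 0"
    unfolding pt using E1 E2 E3 E4 by simp
qed

text \<open>The equation tested with u \<eta>; it serves to replace the gradient term of the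
  Pohozaev identity by |u|^(p + 1).\<close>

lemma energy_cutoff_identity:
  assumes eta: "C1_fun \<eta>" "\<And>z. r < norm z \<Longrightarrow> \<eta> z = 0"
  shows "(LINT z|lborel. \<eta> z * (grad2 z - \<bar>u z\<bar> powr (p + 1)) + u z * (grushin_grad \<alpha> u z \<bullet> grushin_grad \<alpha> \<eta> z)) = 0"
    and "integrable lborel (\<lambda>z. \<eta> z * (grad2 z - \<bar>u z\<bar> powr (p + 1)) + u z * (grushin_grad \<alpha> u z \<bullet> grushin_grad \<alpha> \<eta> z))"
proof -
  note C1 = C1_fun_mult[OF C1_u(1) eta(1)]
  have i1: "integrable lborel (\<lambda>z. grushin_grad \<alpha> u z \<bullet> grushin_grad \<alpha> (\<lambda>z. u z * \<eta> z) z)"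
    by (rule integrable_continuous_bounded_support[where r = r],
        rule continuous_grushin_grad_inner[OF alpha C1_u(1) C1])
      (simp add: grushin_grad_outside[of r "\<lambda>z. u z * \<eta> z"] eta)
  have i2: "integrable lborel (\<lambda>z. \<eta> z * \<bar>u z\<bar> powr (p + 1))"
    by (rule integrable_continuous_bounded_support[where r = r],
        rule continuous_on_mult[OF C1_fun_continuous[OF eta(1)] continuous_power]) (simp add: eta)
  have pt: "\<eta> z * (grad2 z - \<bar>u z\<bar> powr (p + 1)) + u z * (grushin_grad \<alpha> u z \<bullet> grushin_grad \<alpha> \<eta> z)
      = grushin_grad \<alpha> u z \<bullet> grushin_grad \<alpha> (\<lambda>z. u z * \<eta> z) z - \<eta> z * \<bar>u z\<bar> powr (p + 1)" for z
    unfolding grushin_grad_mult[OF C1_u(1) eta(1)] by (simp add: inner_add_right power2_norm_eq_inner algebra_simps)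
  have "(LINT z|lborel. grushin_grad \<alpha> u z \<bullet> grushin_grad \<alpha> (\<lambda>z. u z * \<eta> z) z)
      = - (LINT z|lborel. u z * \<eta> z * grushin_laplacian \<alpha> u z)"
    by (rule grushin_green[OF C2_u C1 _ alpha, where r = r]) (simp add: eta)
  also have "\<dots> = (LINT z|lborel. \<eta> z * \<bar>u z\<bar> powr (p + 1))"
    unfolding laplacian_u u_powr_mult[symmetric] by (simp add: power2_eq_square mult_ac)
  finally show "(LINT z|lborel. \<eta> z * (grad2 z - \<bar>u z\<bar> powr (p + 1)) + u z * (grushin_grad \<alpha> u z \<bullet> grushin_grad \<alpha> \<eta> z)) = 0"
    unfolding pt Bochner_Integration.integral_diff[OF i1 i2] by simp
  show "integrable lborel (\<lambda>z. \<eta> z * (grad2 z - \<bar>u z\<bar> powr (p + 1)) + u z * (grushin_grad \<alpha> u z \<bullet> grushin_grad \<alpha> \<eta> z))"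
    unfolding pt by (rule Bochner_Integration.integrable_diff[OF i1 i2])
qed

section \<open>Vanishing of the solution\<close>

text \<open>The Pohozaev identity minus 1 - Q/2 times the energy identity leaves |u|^(p + 1) with
  coefficient Q / (p + 1) - (Q - 2)/2, which is 0 exactly when p (Q - 2) = Q + 2. Every other term
  contains a derivative of the cutoff and lives on the shell from R to 2 R.\<close>

lemma pohozaev_estimate:
  assumes "2 * H0 \<le> R" "0 < \<epsilon>"
  defines "G \<equiv> mass grad2 R (2 * R)" and "U \<equiv> mass (\<lambda>z. \<bar>u z\<bar> powr (p + 1)) R (2 * R)" and "V \<equiv> mass dens R (2 * R)"
  shows "\<bar>Q / (p + 1) - (Q - 2) / 2\<bar> * mass (\<lambda>z. \<bar>u z\<bar> powr (p + 1)) 1 R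
    \<le> (\<alpha> + 1) * (24 * G + 16 * U + 8 * \<bar>1 - Q / 2\<bar> * (\<epsilon> * V + G / \<epsilon>))"
proof -
  have R0: "0 < R" "1 \<le> R" using assms(1) H0(1) by auto
  define r where "r = 2 * (2 * R)"
  define \<eta> where "\<eta> z = cutoff R (hgauge \<alpha> z)" for z :: "(real^'m) \<times> (real^'n)"
  define a where "a = \<alpha> + 1"
  define N where "N = Q / (p + 1) - (Q - 2) / 2"
  have a0: "0 < a" using alpha by (simp add: a_def)
  have eta: "C1_fun \<eta>" unfolding \<eta>_def
    by (rule C1_fun_comp[OF C1_fun_gauge[OF alpha] cutoff_has_derivative])
      (rule continuous_on_compose2[OF continuous_cutoff'[of UNIV] continuous_gauge[OF alpha]], simp)
  have eta0: "\<eta> z = 0" if "r < norm z" for z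
    using gauge_coercive[OF alpha, of "2 * R" z] that R0 cutoff_outside[of R "hgauge \<alpha> z"] by (simp add: \<eta>_def r_def)
  define d where "d z = cutoff' R (hgauge \<alpha> z)" for z :: "(real^'m) \<times> (real^'n)"
  let ?i = "\<lambda>z. indicator (shell \<alpha> R (2 * R)) z :: real"
  have d: "\<bar>d z\<bar> * hgauge \<alpha> z \<le> 8 * ?i z" for z
  proof -
    have "\<bar>hgauge \<alpha> z * d z\<bar> \<le> 8 * indicator {R..2 * R} (hgauge \<alpha> z)"
      unfolding d_def by (rule cutoff'_bound[OF R0(1)])
    then show ?thesis using gauge_pos[of \<alpha> z]
      by (cases "R \<le> hgauge \<alpha> z \<and> hgauge \<alpha> z \<le> 2 * R") (auto simp: indicator_shell abs_mult mult.commute)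
  qed
  define A where "A z = norm_pow (fst z) (2 * \<alpha>)" for z :: "(real^'m) \<times> (real^'n)"
  have A0: "0 \<le> A z" for z by (simp add: A_def)
  have ueta: "grushin_grad \<alpha> u z \<bullet> grushin_grad \<alpha> \<eta> z = d z * (2 * a * A z * Zu z)" for z
    unfolding \<eta>_def grushin_grad_comp[OF C1_fun_gauge[OF alpha] cutoff_has_derivative]
    by (simp add: d_def grushin_grad_gauge_inner[OF alpha C1_u(1)] A_def a_def)
  have Zeta: "dil_deriv \<alpha> \<eta> z = d z * (2 * a * (hgauge \<alpha> z - 1))" for z
    unfolding \<eta>_def dil_deriv_comp[OF C1_fun_gauge[OF alpha] cutoff_has_derivative]
    by (simp add: d_def dil_deriv_gauge[OF alpha] a_def)
  have AZ: "A z * (Zu z)\<^sup>2 \<le> hgauge \<alpha> z * grad2 z" for z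
    unfolding A_def by (rule dil_deriv_bound[OF alpha C1_u(1)])
  have Zeta_le: "\<bar>dil_deriv \<alpha> \<eta> z\<bar> \<le> 16 * a * ?i z" for z
  proof -
    have "\<bar>dil_deriv \<alpha> \<eta> z\<bar> = 2 * a * (\<bar>d z\<bar> * (hgauge \<alpha> z - 1))"
      unfolding Zeta using a0 gauge_ge_1[of \<alpha> z] by (simp add: abs_mult)
    also have "\<dots> \<le> 2 * a * (\<bar>d z\<bar> * hgauge \<alpha> z)" using a0 by (intro mult_left_mono) auto
    also have "\<dots> \<le> 2 * a * (8 * ?i z)" using a0 d by (intro mult_left_mono) auto
    finally show ?thesis by simp
  qed
  define e1 where "e1 z = Zu z * (grushin_grad \<alpha> u z \<bullet> grushin_grad \<alpha> \<eta> z) + (primitive z - grad2 z / 2) * dil_deriv \<alpha> \<eta> z" for z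
  define e2 where "e2 z = u z * (grushin_grad \<alpha> u z \<bullet> grushin_grad \<alpha> \<eta> z)" for z
  have prim: "0 \<le> primitive z" "primitive z \<le> \<bar>u z\<bar> powr (p + 1)" for z
    using p mult_left_mono[of 1 "p + 1" "\<bar>u z\<bar> powr (p + 1)"] by (simp_all add: primitive_def pos_divide_le_eq)
  \<comment> \<open>24 = 16 + 8: twice the slope bound 8 from the first term, and half of 16 from
    the gradient part of the second.\<close>
  have e1: "\<bar>e1 z\<bar> \<le> a * (24 * (?i z * grad2 z) + 16 * (?i z * \<bar>u z\<bar> powr (p + 1)))" for z
  proof -
    have "Zu z * (grushin_grad \<alpha> u z \<bullet> grushin_grad \<alpha> \<eta> z) = 2 * a * d z * (A z * (Zu z)\<^sup>2)"
      unfolding ueta by (simp add: power2_eq_square)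
    then have "\<bar>Zu z * (grushin_grad \<alpha> u z \<bullet> grushin_grad \<alpha> \<eta> z)\<bar> = 2 * a * \<bar>d z\<bar> * (A z * (Zu z)\<^sup>2)"
      using a0 A0[of z] by (simp add: abs_mult)
    also have "\<dots> \<le> 2 * a * \<bar>d z\<bar> * (hgauge \<alpha> z * grad2 z)" using a0 by (intro mult_left_mono AZ) auto
    also have "\<dots> = 2 * a * grad2 z * (\<bar>d z\<bar> * hgauge \<alpha> z)" by simp
    also have "\<dots> \<le> 2 * a * grad2 z * (8 * ?i z)" using a0 by (intro mult_left_mono d) auto
    finally have 1: "\<bar>Zu z * (grushin_grad \<alpha> u z \<bullet> grushin_grad \<alpha> \<eta> z)\<bar> \<le> 16 * a * (?i z * grad2 z)" by (simp add: mult_ac)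
    have "\<bar>primitive z - grad2 z / 2\<bar> \<le> \<bar>u z\<bar> powr (p + 1) + grad2 z / 2"
      using prim[of z] zero_le_power2[of "norm (grushin_grad \<alpha> u z)"] by linarith
    then have "\<bar>(primitive z - grad2 z / 2) * dil_deriv \<alpha> \<eta> z\<bar> \<le> (\<bar>u z\<bar> powr (p + 1) + grad2 z / 2) * (16 * a * ?i z)"
      unfolding abs_mult using Zeta_le[of z] by (intro mult_mono) auto
    then show ?thesis unfolding e1_def using 1
      abs_triangle_ineq[of "Zu z * (grushin_grad \<alpha> u z \<bullet> grushin_grad \<alpha> \<eta> z)" "(primitive z - grad2 z / 2) * dil_deriv \<alpha> \<eta> z"]
      by (simp add: algebra_simps)
  qed
  \<comment> \<open>Weighted arithmetic-geometric mean: \<epsilon> falls on \<open>dens\<close>,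
    whose shell mass is only bounded, and 1 / \<epsilon> on the gradient, whose shell mass tends to
    0.\<close>
  have e2: "\<bar>e2 z\<bar> \<le> a * (8 * \<epsilon> * (?i z * dens z) + 8 / \<epsilon> * (?i z * grad2 z))" for z
  proof -
    have "0 \<le> A z * (\<epsilon> * \<bar>u z\<bar> - \<bar>Zu z\<bar>)\<^sup>2 / \<epsilon>" using assms(2) A0[of z] by simp
    also have "\<dots> = \<epsilon> * (A z * (u z)\<^sup>2) + A z * (Zu z)\<^sup>2 / \<epsilon> - 2 * (A z * \<bar>u z\<bar> * \<bar>Zu z\<bar>)"
      using assms(2) by (simp add: power2_diff power_mult_distrib field_simps) (simp add: power2_eq_square)
    finally have "2 * (A z * \<bar>u z\<bar> * \<bar>Zu z\<bar>) \<le> \<epsilon> * (A z * (u z)\<^sup>2) + A z * (Zu z)\<^sup>2 / \<epsilon>" by simp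
    also have "A z * (u z)\<^sup>2 = hgauge \<alpha> z * dens z" by (simp add: hardy_weight_def A_def)
    also have "A z * (Zu z)\<^sup>2 / \<epsilon> \<le> hgauge \<alpha> z * grad2 z / \<epsilon>" using AZ[of z] assms(2) by (intro divide_right_mono) auto
    finally have 1: "2 * (A z * \<bar>u z\<bar> * \<bar>Zu z\<bar>) \<le> hgauge \<alpha> z * (\<epsilon> * dens z + grad2 z / \<epsilon>)" by (simp add: algebra_simps)
    have "\<bar>e2 z\<bar> = a * \<bar>d z\<bar> * (2 * (A z * \<bar>u z\<bar> * \<bar>Zu z\<bar>))"
      unfolding e2_def ueta using a0 A0[of z] by (simp add: abs_mult)
    also have "\<dots> \<le> a * \<bar>d z\<bar> * (hgauge \<alpha> z * (\<epsilon> * dens z + grad2 z / \<epsilon>))" using a0 1 by (intro mult_left_mono) auto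
    also have "\<dots> = a * (\<epsilon> * dens z + grad2 z / \<epsilon>) * (\<bar>d z\<bar> * hgauge \<alpha> z)" by simp
    also have "\<dots> \<le> a * (\<epsilon> * dens z + grad2 z / \<epsilon>) * (8 * ?i z)"
      using a0 d assms(2) density_nonneg[of z] by (intro mult_left_mono) auto
    finally show ?thesis by (simp add: algebra_simps)
  qed
  have N: "N * (\<eta> z * \<bar>u z\<bar> powr (p + 1)) = (\<eta> z * ((1 - Q / 2) * grad2 z + Q * primitive z) + e1 z)
      - (1 - Q / 2) * (\<eta> z * (grad2 z - \<bar>u z\<bar> powr (p + 1)) + e2 z) - e1 z + (1 - Q / 2) * e2 z" for z
    by (simp add: N_def primitive_def field_simps)
  have i1: "integrable lborel (\<lambda>z. \<eta> z * ((1 - Q / 2) * grad2 z + Q * primitive z) + e1 z)"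
    and z1: "(LINT z|lborel. \<eta> z * ((1 - Q / 2) * grad2 z + Q * primitive z) + e1 z) = 0"
    unfolding e1_def using pohozaev_identity[of \<eta> r, OF eta eta0] by blast+
  have i2: "integrable lborel (\<lambda>z. \<eta> z * (grad2 z - \<bar>u z\<bar> powr (p + 1)) + e2 z)"
    and z2: "(LINT z|lborel. \<eta> z * (grad2 z - \<bar>u z\<bar> powr (p + 1)) + e2 z) = 0"
    unfolding e2_def using energy_cutoff_identity[of \<eta> r, OF eta eta0] by blast+
  have i3: "integrable lborel (\<lambda>z. \<eta> z * \<bar>u z\<bar> powr (p + 1))"
    by (rule integrable_continuous_bounded_support[where r = r],
        rule continuous_on_mult[OF C1_fun_continuous[OF eta] continuous_power]) (simp add: eta0)
  \<comment> \<open>The sign of N multiplies the two identities before absolute values are taken, so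
    they still integrate to 0 and only the errors \<open>e1\<close> and \<open>e2\<close> are
    estimated.\<close>
  have le: "\<bar>N\<bar> * (\<eta> z * \<bar>u z\<bar> powr (p + 1)) \<le> sgn N * ((\<eta> z * ((1 - Q / 2) * grad2 z + Q * primitive z) + e1 z)
      - (1 - Q / 2) * (\<eta> z * (grad2 z - \<bar>u z\<bar> powr (p + 1)) + e2 z))
      + (a * (24 * (?i z * grad2 z) + 16 * (?i z * \<bar>u z\<bar> powr (p + 1)))
      + \<bar>1 - Q / 2\<bar> * (a * (8 * \<epsilon> * (?i z * dens z) + 8 / \<epsilon> * (?i z * grad2 z))))" for z
  proof -
    have "\<bar>N\<bar> * (\<eta> z * \<bar>u z\<bar> powr (p + 1)) = sgn N * (N * (\<eta> z * \<bar>u z\<bar> powr (p + 1)))"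
      by (simp add: abs_sgn[of N] mult_ac)
    also have "\<dots> = sgn N * ((\<eta> z * ((1 - Q / 2) * grad2 z + Q * primitive z) + e1 z)
      - (1 - Q / 2) * (\<eta> z * (grad2 z - \<bar>u z\<bar> powr (p + 1)) + e2 z)) + sgn N * ((1 - Q / 2) * e2 z - e1 z)"
      unfolding N by (simp add: algebra_simps)
    also have "sgn N * ((1 - Q / 2) * e2 z - e1 z) \<le> \<bar>(1 - Q / 2) * e2 z - e1 z\<bar>"
      by (cases "N = 0"; cases "0 < N") auto
    also have "\<bar>(1 - Q / 2) * e2 z - e1 z\<bar> \<le> \<bar>e1 z\<bar> + \<bar>1 - Q / 2\<bar> * \<bar>e2 z\<bar>"
      using abs_triangle_ineq4[of "(1 - Q / 2) * e2 z" "e1 z"] by (simp only: abs_mult)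
    also have "\<dots> \<le> a * (24 * (?i z * grad2 z) + 16 * (?i z * \<bar>u z\<bar> powr (p + 1)))
      + \<bar>1 - Q / 2\<bar> * (a * (8 * \<epsilon> * (?i z * dens z) + 8 / \<epsilon> * (?i z * grad2 z)))"
      using e1 e2 by (intro add_mono mult_left_mono) auto
    finally show ?thesis by simp
  qed
  note jG = integrable_mass[OF continuous_grad2, of R "2 * R"] and jU = integrable_mass[OF continuous_power, of R "2 * R"]
    and jV = integrable_mass[OF continuous_density, of R "2 * R"]
  have "\<bar>N\<bar> * mass (\<lambda>z. \<bar>u z\<bar> powr (p + 1)) 1 R = (LINT z|lborel. \<bar>N\<bar> * (indicator (shell \<alpha> 1 R) z * \<bar>u z\<bar> powr (p + 1)))"
    by simp
  also have "\<dots> \<le> (LINT z|lborel. \<bar>N\<bar> * (\<eta> z * \<bar>u z\<bar> powr (p + 1)))"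
  proof (intro integral_le_pointwise integrable_mult_right integrable_mass continuous_power i3 mult_left_mono mult_right_mono)
    show "indicator (shell \<alpha> 1 R) z \<le> \<eta> z" for z :: "(real^'m) \<times> (real^'n)"
      using cutoff_inside(1)[OF R0(1), of "hgauge \<alpha> z"] cutoff_bounds(1)[of R "hgauge \<alpha> z"]
      by (auto simp: indicator_shell \<eta>_def)
  qed auto
  also have "\<dots> \<le> (LINT z|lborel. sgn N * ((\<eta> z * ((1 - Q / 2) * grad2 z + Q * primitive z) + e1 z)
      - (1 - Q / 2) * (\<eta> z * (grad2 z - \<bar>u z\<bar> powr (p + 1)) + e2 z))
      + (a * (24 * (?i z * grad2 z) + 16 * (?i z * \<bar>u z\<bar> powr (p + 1)))
      + \<bar>1 - Q / 2\<bar> * (a * (8 * \<epsilon> * (?i z * dens z) + 8 / \<epsilon> * (?i z * grad2 z)))))"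
    by (rule integral_le_pointwise[OF _ _ le];
      intro Bochner_Integration.integrable_add Bochner_Integration.integrable_diff integrable_mult_right i1 i2 i3 jG jU jV)
  also have "\<dots> = a * (24 * G + 16 * U) + \<bar>1 - Q / 2\<bar> * (a * (8 * \<epsilon> * V + 8 / \<epsilon> * G))"
  proof -
    note k12 = Bochner_Integration.integrable_diff[OF i1 integrable_mult_right[OF i2, of "1 - Q / 2"]]
    note kGU = Bochner_Integration.integrable_add[OF integrable_mult_right[OF jG, of 24] integrable_mult_right[OF jU, of 16]]
    note kVG = Bochner_Integration.integrable_add[OF integrable_mult_right[OF jV, of "8 * \<epsilon>"] integrable_mult_right[OF jG, of "8 / \<epsilon>"]]
    show ?thesis
      unfolding Bochner_Integration.integral_add[OF integrable_mult_right[OF k12] Bochner_Integration.integrable_add[OF integrable_mult_right[OF kGU] integrable_mult_right[OF integrable_mult_right[OF kVG]]]]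
        Bochner_Integration.integral_add[OF integrable_mult_right[OF kGU] integrable_mult_right[OF integrable_mult_right[OF kVG]]]
        Bochner_Integration.integral_mult_right_zero
        Bochner_Integration.integral_diff[OF i1 integrable_mult_right[OF i2, of "1 - Q / 2"]]
        Bochner_Integration.integral_add[OF integrable_mult_right[OF jG, of 24] integrable_mult_right[OF jU, of 16]]
        Bochner_Integration.integral_add[OF integrable_mult_right[OF jV, of "8 * \<epsilon>"] integrable_mult_right[OF jG, of "8 / \<epsilon>"]]
        z1 z2 G_def U_def V_def
      by simp
  qed
  finally show ?thesis unfolding N_def a_def by (simp add: algebra_simps)
qed

text \<open>Along R = 4^(k + 1) at fixed \<epsilon>, the gradient and power terms of
  \<open>pohozaev_estimate\<close> vanish and a multiple of \<epsilon> C0 is left; then \<epsilon>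
  tends to 0.\<close>

lemma solution_eq_0:
  assumes bound: "\<And>R. 2 * H0 \<le> R \<Longrightarrow> mass dens R (2 * R) \<le> C0"
    and N: "Q / (p + 1) - (Q - 2) / 2 \<noteq> 0"
  shows "u = (\<lambda>z. 0)"
proof -
  obtain C where C: "\<And>R. 2 * H0 \<le> R \<Longrightarrow> mass (\<lambda>z. \<bar>u z\<bar> powr (p + 1)) 1 R \<le> C"
    "\<And>R. 2 * H0 \<le> R \<Longrightarrow> mass grad2 1 R \<le> C"
    using finite_energy[OF bound] by blast
  define q where "q k = (4::real) ^ Suc k" for k
  have G: "(\<lambda>k. mass grad2 (q k) (2 * q k)) \<longlonglongrightarrow> 0"
    unfolding q_def by (rule shells_vanish[OF alpha continuous_grad2 _ C(2)]) auto
  have U: "(\<lambda>k. mass (\<lambda>z. \<bar>u z\<bar> powr (p + 1)) (q k) (2 * q k)) \<longlonglongrightarrow> 0"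
    unfolding q_def by (rule shells_vanish[OF alpha continuous_power _ C(1)]) auto
  have q_top: "filterlim q at_top sequentially"
  proof (rule filterlim_at_top_mono[OF filterlim_real_sequentially], rule always_eventually, rule allI)
    fix k
    have "real k \<le> 2 ^ k" by (rule less_imp_le[OF of_nat_less_two_power])
    also have "\<dots> \<le> (4::real) ^ k" by (rule power_mono) auto
    also have "\<dots> \<le> q k" by (simp add: q_def)
    finally show "real k \<le> q k" .
  qed
  have C00: "0 \<le> C0" using bound[of "2 * H0"] mass_nonneg[of dens "2 * H0" "2 * (2 * H0)"] density_nonneg by force
  have zero: "mass (\<lambda>z. \<bar>u z\<bar> powr (p + 1)) 1 R = 0" for R
  proof -
    define m where "m = mass (\<lambda>z. \<bar>u z\<bar> powr (p + 1)) 1 R"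
    define c where "c = (\<alpha> + 1) * (8 * \<bar>1 - Q / 2\<bar> * C0)"
    have m0: "0 \<le> m" unfolding m_def by (rule mass_nonneg) simp
    have c0: "0 \<le> c" using alpha C00 by (simp add: c_def)
    have le: "\<bar>Q / (p + 1) - (Q - 2) / 2\<bar> * m \<le> c * \<epsilon>" if e: "0 < \<epsilon>" for \<epsilon>
    proof -
      have lim: "(\<lambda>k. (\<alpha> + 1) * (24 * mass grad2 (q k) (2 * q k) + 16 * mass (\<lambda>z. \<bar>u z\<bar> powr (p + 1)) (q k) (2 * q k)
            + 8 * \<bar>1 - Q / 2\<bar> * (\<epsilon> * C0 + mass grad2 (q k) (2 * q k) / \<epsilon>)))
          \<longlonglongrightarrow> (\<alpha> + 1) * (24 * 0 + 16 * 0 + 8 * \<bar>1 - Q / 2\<bar> * (\<epsilon> * C0 + 0 / \<epsilon>))"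
        by (intro tendsto_intros G U) (use e in simp)
      have "eventually (\<lambda>k. \<bar>Q / (p + 1) - (Q - 2) / 2\<bar> * m \<le> (\<alpha> + 1) * (24 * mass grad2 (q k) (2 * q k)
            + 16 * mass (\<lambda>z. \<bar>u z\<bar> powr (p + 1)) (q k) (2 * q k)
            + 8 * \<bar>1 - Q / 2\<bar> * (\<epsilon> * C0 + mass grad2 (q k) (2 * q k) / \<epsilon>))) sequentially"
        using filterlim_at_top[THEN iffD1, OF q_top, rule_format, of "max R (2 * H0)"]
      proof eventually_elim
        case (elim k)
        have "m \<le> mass (\<lambda>z. \<bar>u z\<bar> powr (p + 1)) 1 (q k)"
          unfolding m_def by (rule mass_mono[OF continuous_power]) (use elim in auto)
        then have "\<bar>Q / (p + 1) - (Q - 2) / 2\<bar> * m \<le> \<bar>Q / (p + 1) - (Q - 2) / 2\<bar> * mass (\<lambda>z. \<bar>u z\<bar> powr (p + 1)) 1 (q k)"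
          by (intro mult_left_mono) auto
        also have "\<dots> \<le> (\<alpha> + 1) * (24 * mass grad2 (q k) (2 * q k) + 16 * mass (\<lambda>z. \<bar>u z\<bar> powr (p + 1)) (q k) (2 * q k)
            + 8 * \<bar>1 - Q / 2\<bar> * (\<epsilon> * mass dens (q k) (2 * q k) + mass grad2 (q k) (2 * q k) / \<epsilon>))"
          by (rule pohozaev_estimate) (use elim e in auto)
        also have "\<dots> \<le> (\<alpha> + 1) * (24 * mass grad2 (q k) (2 * q k) + 16 * mass (\<lambda>z. \<bar>u z\<bar> powr (p + 1)) (q k) (2 * q k)
            + 8 * \<bar>1 - Q / 2\<bar> * (\<epsilon> * C0 + mass grad2 (q k) (2 * q k) / \<epsilon>))"
          using bound[of "q k"] elim e alpha by (intro mult_left_mono add_left_mono add_right_mono) auto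
        finally show ?case .
      qed
      from tendsto_lowerbound[OF lim this] show ?thesis by (simp add: c_def mult_ac)
    qed
    have "\<bar>Q / (p + 1) - (Q - 2) / 2\<bar> * m \<le> 0"
    proof (rule field_le_epsilon)
      fix e :: real assume e: "0 < e"
      \<comment> \<open>The denominator is c + 1 because c can be 0.\<close>
      have "\<bar>Q / (p + 1) - (Q - 2) / 2\<bar> * m \<le> c * (e / (c + 1))" using e c0 by (intro le) simp
      also have "\<dots> \<le> e" using e c0 by (simp add: field_simps)
      finally show "\<bar>Q / (p + 1) - (Q - 2) / 2\<bar> * m \<le> 0 + e" by simp
    qed
    then have "m \<le> 0" using N by (simp add: mult_le_0_iff)
    then show ?thesis using m0 unfolding m_def by (rule antisym)
  qed
  show ?thesis
  proof (rule ccontr)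
    assume "u \<noteq> (\<lambda>z. 0)"
    then obtain z0 where z0: "u z0 \<noteq> 0" unfolding fun_eq_iff by blast
    define R where "R = hgauge \<alpha> z0 + 1"
    \<comment> \<open>A nonzero value of u persists on a nonempty open set inside one gauge ball,
      and such a set is not null.\<close>
    define S where "S = {z. u z \<noteq> 0} \<inter> {z::(real^'m) \<times> (real^'n). hgauge \<alpha> z < R}"
    have "open S" unfolding S_def
      by (intro open_Int open_Collect_neq open_Collect_less continuous_intros continuous_u continuous_gauge alpha)
    moreover have "S \<noteq> {}" using z0 by (auto simp: S_def R_def)
    ultimately have "\<not> negligible S" by (rule open_not_negligible)
    have "AE z in lborel. indicator (shell \<alpha> 1 R) z * \<bar>u z\<bar> powr (p + 1) = 0"
      using zero[of R] integral_nonneg_eq_0_iff_AE[OF integrable_mass[OF continuous_power, of 1 R]] by simp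
    then have "AE z in lborel. z \<notin> S"
      by (rule AE_mp) (auto intro!: AE_I2 simp: indicator_shell S_def gauge_ge_1)
    then have "S \<in> null_sets lborel" using AE_iff_null_sets[of S lborel] \<open>open S\<close> by simp
    then have "negligible S" by (simp add: negligible_iff_null_sets null_sets_completionI)
    with \<open>\<not> negligible S\<close> show False by simp
  qed
qed

text \<open>The hypothesis says that \<open>p < p_JL\<close>: at \<open>b = \<theta> / 2\<close> the slope of \<open>R\<^bsup>-b\<^esup>\<close> is still dominated by
  Hardy's constant.\<close>

lemma solution_eq_0_supercritical:
  assumes "2 < Q" "0 < \<theta>" "((\<alpha> + 1) * \<theta>)\<^sup>2 < (p - 1) / p * ((Q - 2) / 2)\<^sup>2" "Q / (p + 1) - (Q - 2) / 2 \<noteq> 0"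
  shows "u = (\<lambda>z. 0)"
proof -
  define \<kappa> where "\<kappa> = (p - 1) / p * ((Q - 2) / 2)\<^sup>2"
  have "(\<alpha> + 1) * \<theta> < sqrt \<kappa>" using assms(3) by (intro real_less_rsqrt) (simp add: \<kappa>_def)
  \<comment> \<open>A value strictly in between makes b exceed \<theta> / 2, which removes the outer
    cutoff, while its slope stays below Hardy's constant.\<close>
  then obtain s where s: "(\<alpha> + 1) * \<theta> < s" "s < sqrt \<kappa>" using dense by blast
  have s0: "0 < s" using s(1) assms(2) alpha by (smt (verit) mult_pos_pos)
  have "s\<^sup>2 < (sqrt \<kappa>)\<^sup>2" using s(2) s0 by (intro power_strict_mono) auto
  then have s2: "s\<^sup>2 < \<kappa>" using p by (simp add: \<kappa>_def)
  define b where "b = s / (2 * (\<alpha> + 1))"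
  have b: "0 < b" "\<theta> < 2 * b" "4 * (\<alpha> + 1)\<^sup>2 * b\<^sup>2 < (p - 1) / p * ((Q - 2) / 2)\<^sup>2"
  proof -
    have "2 * (\<alpha> + 1) * b = s" using alpha by (simp add: b_def)
    moreover have "(2 * x * y)\<^sup>2 = 4 * x\<^sup>2 * y\<^sup>2" for x y :: real by (simp add: power_mult_distrib)
    ultimately have e: "4 * (\<alpha> + 1)\<^sup>2 * b\<^sup>2 = s\<^sup>2" by metis
    show "0 < b" using s0 alpha by (simp add: b_def)
    have "2 * (x / (2 * y)) = x / y" for x y :: real by simp
    then have "2 * b = s / (\<alpha> + 1)" unfolding b_def .
    then show "\<theta> < 2 * b" using s(1) alpha by (simp add: pos_less_divide_eq mult.commute)
    show "4 * (\<alpha> + 1)\<^sup>2 * b\<^sup>2 < (p - 1) / p * ((Q - 2) / 2)\<^sup>2" unfolding e using s2 by (simp add: \<kappa>_def)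
  qed
  obtain C where C: "\<And>M. 2 * H0 \<le> M \<Longrightarrow> mass dens (2 * H0) M \<le> C"
    using density_decay[OF assms(1) b] by blast
  show ?thesis
  proof (rule solution_eq_0[OF _ assms(4)])
    fix R assume R: "2 * H0 \<le> R"
    have "mass dens R (2 * R) \<le> mass dens (2 * H0) (2 * R)"
      by (rule mass_mono[OF continuous_density density_nonneg]) (use R in auto)
    also have "\<dots> \<le> C" using R H0(1) by (intro C) auto
    finally show "mass dens R (2 * R) \<le> C" .
  qed
qed

lemma solution_eq_0_subcritical:
  assumes "\<theta> \<le> 0" "Q / (p + 1) - (Q - 2) / 2 \<noteq> 0"
  shows "u = (\<lambda>z. 0)"
proof -
  obtain C where C: "0 \<le> C" "\<And>R. 2 * H0 \<le> R \<Longrightarrow> mass dens R (2 * R) \<le> C * (1 + R powr \<theta>)"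
    using density_growth by blast
  show ?thesis
  proof (rule solution_eq_0[OF _ assms(2)])
    fix R assume R: "2 * H0 \<le> R"
    have "R powr \<theta> \<le> R powr 0" using R H0(1) assms(1) by (intro powr_mono) auto
    then have "R powr \<theta> \<le> 1" using R H0(1) by simp
    then have "C * (1 + R powr \<theta>) \<le> C * 2" using C(1) by (intro mult_left_mono) auto
    then show "mass dens R (2 * R) \<le> C * 2" using C(2)[OF R] by linarith
  qed
qed

end

text \<open>Applied with N = Q - 2 and s = 2 / (p - 1). Right side minus left side is N + 1 - (s -
  (N - 2)/2)^2, with roots (N - 2)/2 - sqrt (N + 1) and (N - 2)/2 + sqrt (N + 1); s < N / 2 lies
  below the larger one.\<close>

lemma joseph_lundgren_inequality:
  fixes N s :: real
  assumes "0 < s" "s < N / 2" and JL: "8 < N \<Longrightarrow> (N - 2) / 2 - sqrt (N + 1) < s"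
  shows "N\<^sup>2 / 4 < (s + 2) * (N - s)"
proof (cases "N \<le> 8")
  \<comment> \<open>For N \<le> 8 the smaller root is at most 0, so 0 < s is enough; N = 8 is the
    threshold Q = 10.\<close>
  case True
  have "0 < s * (N / 2 - s)" using assms by simp
  then have 1: "s * s < s * N / 2" by (simp add: algebra_simps)
  show ?thesis
  proof (cases "4 \<le> N")
    case True
    have "0 \<le> (N - 4) * s" "0 \<le> N * (8 - N)" using True \<open>N \<le> 8\<close> assms by simp_all
    then show ?thesis using 1 by (simp add: power2_eq_square algebra_simps)
  next
    case False
    then have "0 < (4 - N) * (N / 2 - s)" using assms by simp
    moreover have "(4 - N) * (N / 2 - s) = 2 * N - 4 * s - N * N / 2 + N * s" by (simp add: algebra_simps)
    ultimately have 2: "0 < 2 * N - 4 * s - N * N / 2 + N * s" by simp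
    have 3: "s * s < N * s / 2" using 1 by (simp add: mult.commute)
    have key: "x < y / 2 \<Longrightarrow> 0 < 2 * N - 4 * s - z / 2 + y \<Longrightarrow> z / 4 < y - x + 2 * N - 2 * s" for x y z
      using assms(1,2) by linarith
    have "(s + 2) * (N - s) = N * s - s * s + 2 * N - 2 * s" by (simp add: algebra_simps)
    then show ?thesis using key[OF 3 2] by (simp add: power2_eq_square)
  qed
next
  case False
  define q where "q = sqrt (N + 1)"
  have q: "1 \<le> q" "q\<^sup>2 = N + 1" using False by (simp_all add: q_def)
  have "s < (N - 2) / 2 + q" using assms(2) q(1) by (simp add: field_simps)
  then have "0 < (s - ((N - 2) / 2 - q)) * ((N - 2) / 2 + q - s)"
    using JL False by (simp add: q_def)
  also have "(s - (m - q)) * (m + q - s) = q\<^sup>2 - (s - m)\<^sup>2" for m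
    by (simp add: power2_eq_square algebra_simps)
  also have "(s - (N - 2) / 2)\<^sup>2 = s * s - s * N + 2 * s + N\<^sup>2 / 4 - N + 1"
    by (simp add: power2_eq_square field_simps)
  finally show ?thesis unfolding q(2) by (simp add: algebra_simps)
qed

text \<open>With s = sqrt (Q - 1), numerator and denominator share the factors s - 1 and s + 3, and
  p_JL becomes (s - 1)^2 / ((s + 1)(s - 3)). Hence p_JL - 1 = 4 / ((s + 1)(s - 3)), and (s + 1)(s -
  3)/2 is (Q - 4)/2 - sqrt (Q - 1).\<close>

lemma p_JL_bound:
  assumes "10 < Q" "1 < p" "ereal p < p_JL Q"
  shows "(Q - 4) / 2 - sqrt (Q - 1) < 2 / (p - 1)"
proof -
  define s where "s = sqrt (Q - 1)"
  have s2: "s\<^sup>2 = Q - 1" using assms(1) by (simp add: s_def)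
  have "3\<^sup>2 < s\<^sup>2" using s2 assms by simp
  then have s3: "3 < s" by (rule power_less_imp_less_base) (use assms(1) in \<open>simp add: s_def\<close>)
  have Q: "Q = s\<^sup>2 + 1" using s2 by simp
  have "(Q - 2)\<^sup>2 - 4 * Q + 8 * s = (s + 1)\<^sup>2 * (s - 1)\<^sup>2 - 4 * s\<^sup>2 - 4 + 8 * s"
    unfolding Q by (simp add: power2_eq_square algebra_simps)
  also have "\<dots> = (s - 1)\<^sup>2 * ((s + 1)\<^sup>2 - 4)" by (simp add: power2_eq_square algebra_simps)
  also have "\<dots> = (s - 1)\<^sup>2 * ((s + 3) * (s - 1))" by (simp add: power2_eq_square algebra_simps)
  finally have num: "(Q - 2)\<^sup>2 - 4 * Q + 8 * s = (s - 1)\<^sup>2 * ((s + 3) * (s - 1))" .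
  have den: "(Q - 2) * (Q - 10) = (s - 1) * (s + 1) * ((s - 3) * (s + 3))"
    unfolding Q by (simp add: power2_eq_square algebra_simps)
  have "p < ((Q - 2)\<^sup>2 - 4 * Q + 8 * s) / ((Q - 2) * (Q - 10))"
    using assms by (simp add: p_JL_def s_def)
  also have "\<dots> = (s - 1)\<^sup>2 / ((s + 1) * (s - 3))"
    unfolding num den by (subst frac_eq_eq) (use s3 in auto)
  finally have "p * ((s + 1) * (s - 3)) < (s - 1)\<^sup>2" using s3 by (simp add: pos_less_divide_eq)
  then have "(s + 1) * (s - 3) * (p - 1) < 4" by (simp add: power2_eq_square algebra_simps)
  then have "(s + 1) * (s - 3) < 4 / (p - 1)" using assms(2) by (simp only: pos_less_divide_eq diff_gt_0_iff_gt)
  moreover have "(Q - 4) / 2 - s = (s + 1) * (s - 3) / 2" unfolding Q by (simp add: power2_eq_square field_simps)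
  moreover have "4 / (p - 1) = 2 * (2 / (p - 1))" by simp
  ultimately show ?thesis unfolding s_def[symmetric] by linarith
qed

lemma grushin_solution_zero:
  assumes "1 < p" shows "grushin_solution \<alpha> p (\<lambda>z. 0)" "stable_outside_compact \<alpha> p (\<lambda>z. 0)"
proof -
  have d: "dir_deriv v (\<lambda>z. 0) = (\<lambda>z. 0)" for v :: "(real^'m) \<times> (real^'n)"
    by (rule ext, rule dir_deriv_eq[where f' = "\<lambda>_. 0"]) simp
  show "grushin_solution \<alpha> p (\<lambda>z::(real^'m) \<times> (real^'n). 0)"
    by (simp add: grushin_solution_def C2_fun_def C1_fun_const d grushin_laplacian_def laplacian_x_def laplacian_y_def)
  show "stable_outside_compact \<alpha> p (\<lambda>z::(real^'m) \<times> (real^'n). 0)"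
    unfolding stable_outside_compact_def by (intro exI[of _ "{}"]) (simp add: Bochner_Integration.integral_nonneg)
qed

theorem theorem1p1:
  fixes \<alpha> Q p :: real
  assumes "\<alpha> \<ge> 0"
    and "Q = real CARD('m::finite) + real CARD('n::finite) * (\<alpha> + 1)"
  shows "(1 < p \<and> ereal p < p_S Q \<longrightarrow>
           (\<forall>u :: (real^'m) \<times> (real^'n) \<Rightarrow> real.
             grushin_solution \<alpha> p u \<and> stable_outside_compact \<alpha> p u \<longleftrightarrow> u = (\<lambda>z. 0))) \<and>
         (p_S Q < ereal p \<and> ereal p < p_JL Q \<longrightarrow>
           (\<forall>u :: (real^'m) \<times> (real^'n) \<Rightarrow> real.
             grushin_solution \<alpha> p u \<and> stable_outside_compact \<alpha> p u \<longleftrightarrow> u = (\<lambda>z. 0)))"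
proof -
  have card: "1 \<le> real CARD('m)" "1 \<le> real CARD('n)" by (simp_all add: Suc_leI)
  have "1 * 1 \<le> real CARD('n) * (\<alpha> + 1)" using card assms(1) by (intro mult_mono) auto
  then have Q2: "2 \<le> Q" using card assms(2) by linarith
  \<comment> \<open>The compact set hidden in the definition of stability becomes the locale
    parameter K; the converse is the stability of the zero function.\<close>
  have zero_iff: "grushin_solution \<alpha> p u \<and> stable_outside_compact \<alpha> p u \<longleftrightarrow> u = (\<lambda>z. 0)"
    if "1 < p" and eq: "\<And>K. grushin_stable \<alpha> Q p u K \<Longrightarrow> u = (\<lambda>z. 0)" for u :: "(real^'m) \<times> (real^'n) \<Rightarrow> real"
    using grushin_solution_zero[OF that(1), of \<alpha>] eq assms that(1)
    unfolding stable_outside_compact_def grushin_stable_def by blast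
  have N: "Q / (p + 1) - (Q - 2) / 2 \<noteq> 0" if "1 < p" "p * (Q - 2) \<noteq> Q + 2"
    using that by (simp add: field_simps)
  show ?thesis
  proof (intro conjI impI allI; elim conjE)
    fix u :: "(real^'m) \<times> (real^'n) \<Rightarrow> real"
    assume p: "1 < p" "ereal p < p_S Q"
    have sub: "p * (Q - 2) < Q + 2"
      using p Q2 by (cases "Q = 2") (auto simp: p_S_def pos_less_divide_eq)
    show "grushin_solution \<alpha> p u \<and> stable_outside_compact \<alpha> p u \<longleftrightarrow> u = (\<lambda>z. 0)"
    proof (rule zero_iff[OF p(1)])
      fix K assume "grushin_stable \<alpha> Q p u K"
      then interpret grushin_stable \<alpha> Q p u K .
      have "Q \<le> 2 * (p + 1) / (p - 1)" using sub p by (simp add: pos_le_divide_eq algebra_simps)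
      then have "\<theta> \<le> 0" using alpha by (simp add: \<theta>_def divide_nonpos_pos)
      then show "u = (\<lambda>z. 0)" using N p sub by (intro solution_eq_0_subcritical) auto
    qed
  next
    fix u :: "(real^'m) \<times> (real^'n) \<Rightarrow> real"
    assume p: "p_S Q < ereal p" "ereal p < p_JL Q"
    \<comment> \<open>For Q = 2 the exponent p_S is infinite and the range of p is empty.\<close>
    then have Qgt: "2 < Q" using Q2 by (cases "Q = 2") (auto simp: p_S_def)
    then have sup: "Q + 2 < p * (Q - 2)" using p Qgt by (simp add: p_S_def pos_divide_less_eq)
    have p1: "1 < p"
    proof (rule ccontr)
      assume "\<not> 1 < p"
      then have "p * (Q - 2) \<le> 1 * (Q - 2)" using Qgt by (intro mult_right_mono) auto
      then show False using sup by simp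
    qed
    define s where "s = 2 / (p - 1)"
    have s0: "0 < s" using p1 by (simp add: s_def)
    have ps: "p = 1 + 2 / s" using p1 by (simp add: s_def field_simps)
    have sN: "s < (Q - 2) / 2" unfolding s_def
    proof -
      have "2 < (Q - 2) / 2 * (p - 1)" using sup by (simp add: algebra_simps)
      then show "2 / (p - 1) < (Q - 2) / 2" using p1 by (simp only: pos_divide_less_eq diff_gt_0_iff_gt)
    qed
    have "(Q - 2)\<^sup>2 / 4 < (s + 2) * (Q - 2 - s)"
    proof (rule joseph_lundgren_inequality[OF s0 sN])
      assume "8 < Q - 2"
      then show "(Q - 2 - 2) / 2 - sqrt (Q - 2 + 1) < s"
        using p_JL_bound[OF _ p1 p(2)] by (simp add: s_def)
    qed
    show "grushin_solution \<alpha> p u \<and> stable_outside_compact \<alpha> p u \<longleftrightarrow> u = (\<lambda>z. 0)"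
    proof (rule zero_iff[OF p1])
      fix K assume "grushin_stable \<alpha> Q p u K"
      then interpret grushin_stable \<alpha> Q p u K .
      have "2 * (p + 1) / (p - 1) = 2 + 2 * s" using p1 by (simp add: s_def field_simps)
      then have th: "(\<alpha> + 1) * \<theta> = (Q - 2) / 2 - s"
        using alpha by (simp add: \<theta>_def field_simps)
      have "0 < (\<alpha> + 1) * \<theta>" using th sN by simp
      then have th0: "0 < \<theta>" using alpha by (simp add: zero_less_mult_iff)
      \<comment> \<open>The quadratic inequality times s: the constant terms of (s + 2)(N/2 - s)^2
        and 2 (N/2)^2 agree for N = Q - 2, so their difference has the factor s. Since (p - 1) / p =
        2 / (s + 2), this is the comparison with Hardy's constant.\<close>
      have "(s + 2) * ((Q - 2) / 2 - s)\<^sup>2 < 2 * ((Q - 2) / 2)\<^sup>2"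
      proof -
        have "s * ((Q - 2)\<^sup>2 / 4) < s * ((s + 2) * (Q - 2 - s))"
          using \<open>(Q - 2)\<^sup>2 / 4 < (s + 2) * (Q - 2 - s)\<close> s0 by (rule mult_strict_left_mono)
        moreover have "(s + 2) * (N / 2 - s)\<^sup>2 = 2 * (N / 2)\<^sup>2 + s * (N\<^sup>2 / 4) - s * ((s + 2) * (N - s))" for N
          by (simp add: power2_eq_square algebra_simps)
        ultimately show ?thesis by simp
      qed
      moreover have "(p - 1) / p = 2 / (s + 2)" unfolding ps using s0 by (simp add: field_simps)
      ultimately have "((\<alpha> + 1) * \<theta>)\<^sup>2 < (p - 1) / p * ((Q - 2) / 2)\<^sup>2"
        unfolding th using s0 by (simp add: pos_less_divide_eq mult.commute)
      then show "u = (\<lambda>z. 0)" using Qgt th0 N p1 sup by (intro solution_eq_0_supercritical) auto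
    qed
  qed
qed

end
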